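(* Let $G=GL(q,\mathbb F)$, $K=U(q,\mathbb F)$, let $\nu_G$ be a $K$-biinvariant probability measure on $G$, let $(X_k)_{k\ge1}$ be i.i.d. with law $\nu_G$, $S_k:=X_1\cdots X_k$, and let $\nu\in M^1(C_q^A)$ be the image of $\nu_G$ under $g\mapsto\ln\sigma_{sing}(g)$. If $\int_{C_q^A}t_j^2\,d\nu(t)<\infty$ for all $j=1,\dots,q$, then $$\frac1{\sqrt k}\bigl(\ln\sigma_{sing}(S_k)-k\,m_{\bf 1}(\nu)\bigr)\longrightarrow N(0,\Sigma^2(\nu))$$ in distribution as $k\to\infty$, where $N(0,\Sigma^2(\nu))$ is the centered normal distribution on $\mathbb R^q$ with covariance matrix $\Sigma^2(\nu)$.
   Context: $\mathbb F\in\{\mathbb R,\mathbb C,\mathbb H\}$, $d=\dim_{\mathbb R}\mathbb F\in\{1,2,4\}$, $q\ge2$ an integer, $K=U(q,\mathbb F)$ with normalized Haar measure $du$. $C_q^A=\{t\in\mathbb R^q: t_1\ge t_2\ge\dots\ge t_q\}$. For $g\in GL(q,\mathbb F)$, $\sigma_{sing}(g)=(x_1,\dots,x_q)$ with $x_1\ge\dots\ge x_q>0$ the singular values of $g$ and $\ln\sigma_{sing}(g)=(\ln x_1,\dots,\ln x_q)$. For $t\in\mathbb R^q$, $e^{2\underline t}=\mathrm{diag}(e^{2t_1},\dots,e^{2t_q})$. For a positive definite Hermitian $q\times q$ matrix $x=(x_{ij})$ over $\mathbb F$, $\Delta_r(x)=\det((x_{ij})_{1\le i,j\le r})$ for $r=1,\dots,q$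 and $\Delta_0:=1$; for $\mathbb F=\mathbb H$ determinants are Dieudonné determinants, $\det A=(\det_{\mathbb C}A)^{1/2}$. For $l\in\mathbb N_0^q$ and $t\in C_q^A$, $m_l(t)=2^{-|l|}\int_K\prod_{j=1}^q\bigl(\ln(\Delta_j(u^{-1}e^{2\underline t}u)/\Delta_{j-1}(u^{-1}e^{2\underline t}u))\bigr)^{l_j}\,du$. $m_{\bf 1}(t)=(m_{e_1}(t),\dots,m_{e_q}(t))$ (row vector), $m_{\bf 2}(t)$ is the $q\times q$ matrix with entries $m_{j,l}(t):=m_{e_j+e_l}(t)$. For $\nu$ with finite second moments, $m_{\bf 1}(\nu)=\int m_{\bf 1}\,d\nu$, $m_{\bf 2}(\nu)=\int m_{\bf 2}\,d\nu$ and $\Sigma^2(\nu)=m_{\bf 2}(\nu)-m_{\bf 1}(\nu)^Tm_{\bf 1}(\nu)$. *)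

theory Defs
  imports "HOL-Analysis.Analysis" "HOL-Probability.Probability"
begin

text \<open>A quaternion a0 + a1 i + a2 j + a3 k is the vector with components a0,a1,a2,a3
  (indices 0,1,2,3 of type 4).  R and C are the subalgebras where the last 3 resp. 2
  components vanish, so F = Fld d with d = dim_R F in {1,2,4}.\<close>

type_synonym quat = "real^4"

definition qmult :: "quat \<Rightarrow> quat \<Rightarrow> quat" where
  "qmult a b = (\<chi> i.
     if i = 0 then a$0*b$0 - a$1*b$1 - a$2*b$2 - a$3*b$3
     else if i = 1 then a$0*b$1 + a$1*b$0 + a$2*b$3 - a$3*b$2
     else if i = 2 then a$0*b$2 - a$1*b$3 + a$2*b$0 + a$3*b$1
     else a$0*b$3 + a$1*b$2 - a$2*b$1 + a$3*b$0)"

definition qconj :: "quat \<Rightarrow> quat" where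
  "qconj a = (\<chi> i. if i = 0 then a$0 else - (a$i))"

definition qreal :: "real \<Rightarrow> quat" where
  "qreal r = (\<chi> i. if i = 0 then r else 0)"

definition Fld :: "nat \<Rightarrow> quat set" where
  "Fld d = {x. (d \<le> 1 \<longrightarrow> x$1 = 0) \<and> (d \<le> 2 \<longrightarrow> x$2 = 0 \<and> x$3 = 0)}"

type_synonym 'n fmat = "quat^'n^'n"

definition fmul :: "('n::finite) fmat \<Rightarrow> 'n fmat \<Rightarrow> 'n fmat" where
  "fmul A B = (\<chi> i j. \<Sum>k\<in>UNIV. qmult (A$i$k) (B$k$j))"

definition fadj :: "('n::finite) fmat \<Rightarrow> 'n fmat" where
  "fadj A = (\<chi> i j. qconj (A$j$i))"

definition fid :: "('n::finite) fmat" where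
  "fid = (\<chi> i j. if i = j then qreal 1 else 0)"

definition Mat :: "nat \<Rightarrow> ('n::finite) fmat set" where
  "Mat d = {A. \<forall>i j. A$i$j \<in> Fld d}"

definition GLF :: "nat \<Rightarrow> ('n::finite) fmat set" where
  "GLF d = {A \<in> Mat d. \<exists>B \<in> Mat d. fmul A B = fid \<and> fmul B A = fid}"

definition UF :: "nat \<Rightarrow> ('n::finite) fmat set" where
  "UF d = {u \<in> Mat d. fmul (fadj u) u = fid}"

definition finv :: "nat \<Rightarrow> ('n::finite) fmat \<Rightarrow> 'n fmat" where
  "finv d A = (THE B. B \<in> Mat d \<and> fmul A B = fid \<and> fmul B A = fid)"

definition ediag :: "real^('n::finite) \<Rightarrow> 'n fmat" where
  "ediag t = (\<chi> i j. if i = j then qreal (exp (t$i)) else 0)"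

definition CqA :: "((real,'n::{finite,linorder}) vec) set" where
  "CqA = {t. \<forall>i j. i \<le> j \<longrightarrow> t$j \<le> t$i}"

text \<open>ln of the singular values: the unique t in C_q^A with g = u e^t v, u,v in K
  (singular value decomposition).\<close>
definition ln_sing :: "nat \<Rightarrow> ('n::{finite,linorder}) fmat \<Rightarrow> (real,'n) vec" where
  "ln_sing d g = (THE t. t \<in> CqA \<and> (\<exists>u\<in>UF d. \<exists>v\<in>UF d. g = fmul u (fmul (ediag t) v)))"

definition haarK :: "nat \<Rightarrow> ('n::finite) fmat measure" where
  "haarK d = (THE \<mu>. prob_space \<mu> \<and> sets \<mu> = sets borel \<and> emeasure \<mu> (UF d) = 1 \<and>
      (\<forall>v\<in>UF d. distr \<mu> borel (fmul v) = \<mu>))"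

definition pos :: "('n::{finite,linorder}) \<Rightarrow> nat" where
  "pos i = card {j. j < i}"

definition first_idx :: "nat \<Rightarrow> ('n::{finite,linorder}) set" where
  "first_idx r = {i. pos i < r}"

definition cdet :: "'i set \<Rightarrow> ('i \<Rightarrow> 'i \<Rightarrow> complex) \<Rightarrow> complex" where
  "cdet S M = (\<Sum>p\<in>{p. p permutes S}. of_int (sign p) * (\<Prod>i\<in>S. M i (p i)))"

definition qcpl1 :: "quat \<Rightarrow> complex" where "qcpl1 a = Complex (a$0) (a$1)"
definition qcpl2 :: "quat \<Rightarrow> complex" where "qcpl2 a = Complex (a$2) (a$3)"

text \<open>complex representation [[A1, A2], [-conj A2, conj A1]] of A = A1 + A2 j\<close>
definition crep :: "('n::finite) fmat \<Rightarrow> ('n \<times> bool) \<Rightarrow> ('n \<times> bool) \<Rightarrow> complex" where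
  "crep x = (\<lambda>(i,b) (j,c).
     if \<not> b \<and> \<not> c then qcpl1 (x$i$j)
     else if \<not> b \<and> c then qcpl2 (x$i$j)
     else if b \<and> \<not> c then - cnj (qcpl2 (x$i$j))
     else cnj (qcpl1 (x$i$j)))"

text \<open>Delta_r(x); for F = H the Dieudonne determinant (det_C of complex rep)^(1/2).
  Delta_0 = 1 holds automatically (empty determinant).\<close>
definition Delta :: "nat \<Rightarrow> nat \<Rightarrow> ('n::{finite,linorder}) fmat \<Rightarrow> real" where
  "Delta d r x = (if d = 4 then sqrt (Re (cdet (first_idx r \<times> UNIV) (crep x)))
                  else Re (cdet (first_idx r) (\<lambda>i j. qcpl1 (x$i$j))))"

definition Lfun :: "nat \<Rightarrow> ('n::{finite,linorder}) \<Rightarrow> 'n fmat \<Rightarrow> real" where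
  "Lfun d j x = ln (Delta d (pos j + 1) x / Delta d (pos j) x)"

definition mom :: "nat \<Rightarrow> (('n::{finite,linorder}) \<Rightarrow> nat) \<Rightarrow> (real,'n) vec \<Rightarrow> real" where
  "mom d l t = 2 powr (- real (\<Sum>j\<in>UNIV. l j)) *
     (\<integral>u. (\<Prod>j\<in>UNIV. (Lfun d j (fmul (finv d u) (fmul (ediag (2 *\<^sub>R t)) u))) ^ l j) \<partial>haarK d)"

definition unitv :: "'n \<Rightarrow> 'n \<Rightarrow> nat" where
  "unitv j = (\<lambda>i. if i = j then 1 else 0)"

definition m1 :: "nat \<Rightarrow> (real,'n::{finite,linorder}) vec \<Rightarrow> (real,'n) vec" where
  "m1 d t = (\<chi> j. mom d (unitv j) t)"

definition m2 :: "nat \<Rightarrow> (real,'n::{finite,linorder}) vec \<Rightarrow> ((real,'n) vec,'n) vec" where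
  "m2 d t = (\<chi> j l. mom d (\<lambda>i. unitv j i + unitv l i) t)"

definition m1_nu :: "nat \<Rightarrow> ((real,'n::{finite,linorder}) vec) measure \<Rightarrow> (real,'n) vec" where
  "m1_nu d \<nu> = (\<chi> j. \<integral>t. m1 d t $ j \<partial>\<nu>)"

definition Sigma2 :: "nat \<Rightarrow> ((real,'n::{finite,linorder}) vec) measure \<Rightarrow> ((real,'n) vec,'n) vec" where
  "Sigma2 d \<nu> = (\<chi> j l. (\<integral>t. m2 d t $ j $ l \<partial>\<nu>) - m1_nu d \<nu> $ j * m1_nu d \<nu> $ l)"

fun fprod :: "(nat \<Rightarrow> ('n::finite) fmat) \<Rightarrow> nat \<Rightarrow> 'n fmat" where
  "fprod Y 0 = fid"
| "fprod Y (Suc k) = fmul (fprod Y k) (Y (Suc k))"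

definition is_normal_cov :: "real^'n^'n \<Rightarrow> (real^('n::finite)) measure \<Rightarrow> bool" where
  "is_normal_cov Sig \<mu> \<longleftrightarrow> prob_space \<mu> \<and> sets \<mu> = sets borel \<and>
     (\<forall>\<xi>. (\<integral>x. cis (\<xi> \<bullet> x) \<partial>\<mu>) =
            complex_of_real (exp (- (\<Sum>j\<in>UNIV. \<Sum>l\<in>UNIV. \<xi>$j * Sig$j$l * \<xi>$l) / 2)))"

definition weak_conv_vec :: "(nat \<Rightarrow> (real^('n::finite)) measure) \<Rightarrow> (real^'n) measure \<Rightarrow> bool" where
  "weak_conv_vec \<mu>s \<mu> \<longleftrightarrow> (\<forall>f :: real^'n \<Rightarrow> real. continuous_on UNIV f \<and> bounded (range f) \<longrightarrow>
      (\<lambda>k. \<integral>x. f x \<partial>\<mu>s k) \<longlonglongrightarrow> (\<integral>x. f x \<partial>\<mu>))"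

end

theory Submission
  imports Defs
begin

text \<open>Let \<open>A(g)\<close> denote the logarithm of the diagonal of the triangular factor in \<open>g = u r\<close> with
  \<open>u\<close> unitary and \<open>r\<close> upper triangular with positive diagonal. Since
  \<open>\<Delta>\<^sub>j(g* g) / \<Delta>\<^sub>j\<^sub>-\<^sub>1(g* g)\<close> is the square of the \<open>j\<close>-th diagonal entry of \<open>r\<close>, the moment functions
  are the moments of \<open>A(e\<^sup>t u)\<close> for Haar distributed \<open>u\<close>, so that \<open>m\<^sub>1(\<nu>)\<close> and \<open>\<Sigma>\<^sup>2(\<nu>)\<close> are mean
  and covariance of \<open>A(X\<^sub>1)\<close>. From \<open>A(g h) = A(g u(h)) + A(h)\<close> and right invariance, \<open>A(S\<^sub>k)\<close> has the
  law of a sum of \<open>k\<close> independent copies of \<open>A(X\<^sub>1)\<close>, hence satisfies the classical central limit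
  theorem. Finally \<open>(A(S\<^sub>k), ln \<sigma>(S\<^sub>k))\<close> has the law of \<open>(A(e\<^sup>t u), t)\<close> with \<open>t = ln \<sigma>(S\<^sub>k)\<close> and an
  independent Haar distributed \<open>u\<close>; almost every \<open>u\<close> has an LU decomposition, and for such \<open>u\<close> the difference
  \<open>A(e\<^sup>t u) - t\<close> is bounded uniformly in decreasing \<open>t\<close>. So \<open>A(S\<^sub>k) - ln \<sigma>(S\<^sub>k)\<close> is tight and
  disappears after division by \<open>\<surd>k\<close>. Haar measure itself is the law of the unitary factor
  of \<open>X\<^sub>1\<close>.\<close>

section \<open>Quaternions\<close>

text \<open>All three fields are treated at once inside the quaternions, so noncommutativity shapes
  the linear algebra. Determinants and eigenvalues are avoided until the minors themselves enter:
  both decompositions come from maximising a real trace or entry over the compact unitary group,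
  invertibility is a dimension count for real-linear maps, and singularity of a leading block means
  that it has a kernel vector. For the same reason the nongeneric unitary matrices are shown to be
  null by translation invariance and not as zeros of a polynomial.

  The law of \<open>IA d\<close> along the product is handled through characteristic functions,
  which are k-th powers. The limit is computed for genuine i.i.d. sums at a fixed frequency and
  carried over by equality of characteristic functions for each k; hence the need for a continuity
  theorem in several dimensions and for a possibly degenerate normal law, realised as a linear image
  of independent normals. The comparison of \<open>IA d\<close> with \<open>ln_sing d\<close> is
  governed by one Haar probability that depends neither on k nor on the law of the steps.\<close>

notation qmult (infixl "\<odot>" 70)

abbreviation (input) qre :: "quat \<Rightarrow> real" where "qre a \<equiv> a $ 0"

lemma four_eq_zero: "(4::4) = 0"
  by simp

lemma quat_eq_iff: "(a::quat) = b \<longleftrightarrow> a$0 = b$0 \<and> a$1 = b$1 \<and> a$2 = b$2 \<and> a$3 = b$3"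
  by (simp add: vec_eq_iff forall_4 four_eq_zero conj_commute) auto

lemma sum_quat: "sum f (UNIV::4 set) = f 0 + f 1 + f 2 + f 3"
  by (simp add: sum_4 four_eq_zero add_ac)

lemma qmult_nth:
  "(a \<odot> b)$0 = a$0*b$0 - a$1*b$1 - a$2*b$2 - a$3*b$3"
  "(a \<odot> b)$1 = a$0*b$1 + a$1*b$0 + a$2*b$3 - a$3*b$2"
  "(a \<odot> b)$2 = a$0*b$2 - a$1*b$3 + a$2*b$0 + a$3*b$1"
  "(a \<odot> b)$3 = a$0*b$3 + a$1*b$2 - a$2*b$1 + a$3*b$0"
  by (simp_all add: qmult_def)

lemma qconj_nth [simp]: "qconj a $ i = (if i = 0 then a$0 else - (a$i))"
  by (simp add: qconj_def)

lemma qreal_nth [simp]: "qreal r $ i = (if i = 0 then r else 0)"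
  by (simp add: qreal_def)

lemma qmult_assoc: "a \<odot> b \<odot> c = a \<odot> (b \<odot> c)"
  by (simp add: quat_eq_iff qmult_nth algebra_simps)

lemma bilinear_qmult: "bilinear qmult"
  unfolding bilinear_def
  by (auto intro!: linearI simp: quat_eq_iff qmult_nth algebra_simps)

lemma bounded_bilinear_qmult: "bounded_bilinear qmult"
  using bilinear_qmult by (simp add: bilinear_conv_bounded_bilinear)

interpretation qmult: bounded_bilinear qmult
  by (rule bounded_bilinear_qmult)

declare qmult.zero_left [simp] qmult.zero_right [simp]

lemma qreal_0 [simp]: "qreal 0 = 0"
  by (simp add: quat_eq_iff)

lemma qmult_qreal_left [simp]: "qreal r \<odot> a = r *\<^sub>R a"
  and qmult_qreal_right [simp]: "a \<odot> qreal r = r *\<^sub>R a"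
  by (simp_all add: quat_eq_iff qmult_nth)

lemma scaleR_qreal [simp]: "r *\<^sub>R qreal s = qreal (r * s)"
  by (simp add: quat_eq_iff)

lemma qreal_eq_iff [simp]: "qreal r = qreal s \<longleftrightarrow> r = s"
  by (simp add: quat_eq_iff)

lemma qreal_eq_0_iff [simp]: "qreal r = 0 \<longleftrightarrow> r = 0"
  by (simp add: quat_eq_iff)

lemma qconj_qreal [simp]: "qconj (qreal r) = qreal r"
  by (simp add: quat_eq_iff)

lemma qconj_qconj [simp]: "qconj (qconj a) = a"
  by (simp add: quat_eq_iff)

lemma linear_qconj: "linear qconj"
  by (auto intro!: linearI simp: quat_eq_iff)

lemmas qconj_add = linear_add[OF linear_qconj]

  and qconj_scaleR = linear_cmul[OF linear_qconj]
  and qconj_sum = linear_sum[OF linear_qconj]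
  and qconj_0 [simp] = linear_0[OF linear_qconj]
  and qconj_minus = linear_neg[OF linear_qconj]

lemma qconj_qmult: "qconj (a \<odot> b) = qconj b \<odot> qconj a"
  by (simp add: quat_eq_iff qmult_nth algebra_simps)

lemma norm_quat_sq: "(norm (a::quat))\<^sup>2 = (a$0)\<^sup>2 + (a$1)\<^sup>2 + (a$2)\<^sup>2 + (a$3)\<^sup>2"
  unfolding power2_norm_eq_inner by (simp add: inner_vec_def sum_quat power2_eq_square)

lemma qmult_qconj_right: "a \<odot> qconj a = qreal ((norm a)\<^sup>2)"
  and qmult_qconj_left: "qconj a \<odot> a = qreal ((norm a)\<^sup>2)"
  unfolding norm_quat_sq by (simp_all add: quat_eq_iff qmult_nth power2_eq_square)

lemma norm_qconj [simp]: "norm (qconj a) = norm a"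
proof -
  have "(norm (qconj a))\<^sup>2 = (norm a)\<^sup>2"
    by (simp add: norm_quat_sq)
  then show ?thesis
    by simp
qed

lemma norm_qmult: "norm (a \<odot> b) = norm a * norm b"
proof -
  have "(norm (a \<odot> b))\<^sup>2 = (norm a * norm b)\<^sup>2"
    unfolding power_mult_distrib norm_quat_sq qmult_nth by algebra
  then show ?thesis
    by (rule power2_eq_imp_eq) simp_all
qed

lemma norm_qreal [simp]: "norm (qreal r) = \<bar>r\<bar>"
proof -
  have "(norm (qreal r))\<^sup>2 = \<bar>r\<bar>\<^sup>2"
    by (simp add: norm_quat_sq)
  then show ?thesis
    by (rule power2_eq_imp_eq) simp_all
qed

lemma qmult_eq_0_iff: "a \<odot> b = 0 \<longleftrightarrow> a = 0 \<or> b = 0"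
  unfolding norm_eq_zero[symmetric, of "a \<odot> b"] by (simp add: norm_qmult)

lemma qre_qmult_commute: "qre (a \<odot> b) = qre (b \<odot> a)"
  by (simp add: qmult_nth)

lemma continuous_on_qmult [continuous_intros]:
  "continuous_on S f \<Longrightarrow> continuous_on S g \<Longrightarrow> continuous_on S (\<lambda>x. f x \<odot> g x)"
  by (rule qmult.continuous_on)

lemma continuous_on_qreal [continuous_intros]:
  "continuous_on S f \<Longrightarrow> continuous_on S (\<lambda>x. qreal (f x))"
proof -
  assume "continuous_on S f"
  moreover have "qreal (f x) = f x *\<^sub>R qreal 1" for x by simp
  ultimately show ?thesis
    by (subst \<open>\<And>x. qreal (f x) = _\<close>) (intro continuous_intros)
qed

section \<open>Closure properties of the coefficient field inside the quaternions\<close>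

lemma subspace_Fld: "subspace (Fld d)"
  by (auto simp: subspace_def Fld_def)

lemma Fld_qmult: "a \<in> Fld d \<Longrightarrow> b \<in> Fld d \<Longrightarrow> a \<odot> b \<in> Fld d"
  by (auto simp: Fld_def qmult_nth)

lemma Fld_qconj: "a \<in> Fld d \<Longrightarrow> qconj a \<in> Fld d"
  by (auto simp: Fld_def)

lemma Fld_qreal [simp]: "qreal r \<in> Fld d"
  by (auto simp: Fld_def)

lemma Fld_0 [simp]: "0 \<in> Fld d"
  by (auto simp: Fld_def)

lemmas Fld_add = subspace_add[OF subspace_Fld]
  and Fld_diff = subspace_diff[OF subspace_Fld]
  and Fld_scaleR = subspace_scale[OF subspace_Fld]
  and Fld_sum = subspace_sum[OF subspace_Fld]
  and Fld_minus = subspace_neg[OF subspace_Fld]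

lemmas Fld_intros = Fld_qmult Fld_qconj Fld_add Fld_diff Fld_scaleR Fld_sum Fld_minus

text \<open>On the unit sphere a linear functional is largest in the direction of its gradient, here
  \<open>(x, qconj y) / N\<close>, where it takes the value
  \<open>N = sqrt (x\<^sup>2 + (norm y)\<^sup>2)\<close>. If (1, 0) is already optimal, nothing is
  left for y. In use, c and b are the parameters of a plane rotation and y is a matrix entry to be
  shown zero.\<close>

lemma rotation_stationary:
  assumes y: "y \<in> Fld d"
    and max: "\<And>c b. b \<in> Fld d \<Longrightarrow> c\<^sup>2 + (norm b)\<^sup>2 = 1 \<Longrightarrow> c * x + qre (b \<odot> y) \<le> x"
  shows "y = 0"
proof (rule ccontr)
  assume "y \<noteq> 0"
  then have y2: "(norm y)\<^sup>2 > 0" by simp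
  define N where "N = sqrt (x\<^sup>2 + (norm y)\<^sup>2)"
  have N2: "N\<^sup>2 = x\<^sup>2 + (norm y)\<^sup>2" and N: "N > 0"
    using y2 by (simp_all add: N_def add_nonneg_pos del: zero_less_power2 zero_less_power_eq_numeral)
  have "(x / N) * x + qre (((1/N) *\<^sub>R qconj y) \<odot> y) \<le> x"
  proof (rule max)
    show "(1/N) *\<^sub>R qconj y \<in> Fld d" by (intro Fld_intros y)
    show "(x / N)\<^sup>2 + (norm ((1/N) *\<^sub>R qconj y))\<^sup>2 = 1"
      using N N2 \<open>y \<noteq> 0\<close>
      by (simp add: power_divide add_divide_distrib[symmetric] power_mult_distrib)
  qed
  then have "N\<^sup>2 / N \<le> x"
    unfolding N2 by (simp add: qmult.scaleR_left qmult_qconj_left add_divide_distrib power2_eq_square)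
  then have "N \<le> x"
    using N by (simp add: power2_eq_square)
  then have "N\<^sup>2 \<le> x\<^sup>2"
    using N by (intro power_mono) auto
  then show False using N2 y2 by simp
qed

text \<open>The unit quaternion \<open>qconj y / norm y\<close> turns y into the positive real
  \<open>norm y\<close>. A real part that no phase can increase therefore equals the norm, and the
  imaginary components must vanish.\<close>

lemma phase_stationary:
  assumes y: "y \<in> Fld d"
    and max: "\<And>b. b \<in> Fld d \<Longrightarrow> norm b = 1 \<Longrightarrow> qre (b \<odot> y) \<le> qre y"
  shows "y = qreal (norm y)"
proof (cases "y = 0")
  case False
  have "qre (((1/norm y) *\<^sub>R qconj y) \<odot> y) \<le> qre y"
    by (rule max) (use False in \<open>auto intro!: Fld_intros y\<close>)
  then have "norm y \<le> qre y"
    using False by (simp add: qmult.scaleR_left qmult_qconj_left power2_eq_square)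
  moreover have "\<bar>qre y\<bar> \<le> norm y"
    by (rule component_le_norm_cart)
  ultimately have r: "qre y = norm y" by simp
  with norm_quat_sq[of y] have "(y$1)\<^sup>2 + (y$2)\<^sup>2 + (y$3)\<^sup>2 = 0" by simp
  then have "y$1 = 0 \<and> y$2 = 0 \<and> y$3 = 0"
    by (simp add: add_nonneg_eq_0_iff)
  with r show ?thesis by (simp add: quat_eq_iff)
qed simp

section \<open>Matrices over the quaternions\<close>

notation fmul (infixl "\<otimes>" 70)

lemma fmul_nth: "(A \<otimes> B)$i$j = (\<Sum>k\<in>UNIV. A$i$k \<odot> B$k$j)"
  by (simp add: fmul_def)

lemma fadj_nth [simp]: "fadj A $ i $ j = qconj (A$j$i)"
  by (simp add: fadj_def)

lemma fid_nth: "fid $ i $ j = (if i = j then qreal 1 else 0)"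
  by (simp add: fid_def)

definition fdiag :: "('n \<Rightarrow> real) \<Rightarrow> ('n::finite) fmat" where
  "fdiag a = (\<chi> i j. if i = j then qreal (a i) else 0)"

lemma fdiag_nth: "fdiag a $ i $ j = (if i = j then qreal (a i) else 0)"
  by (simp add: fdiag_def)

lemma fid_eq_fdiag: "fid = fdiag (\<lambda>_. 1)"
  by (simp add: fid_def fdiag_def)

lemma ediag_eq_fdiag: "ediag t = fdiag (\<lambda>i. exp (t$i))"
  by (simp add: ediag_def fdiag_def)

lemma fmat_eq_iff: "(A::('n::finite) fmat) = B \<longleftrightarrow> (\<forall>i j. A$i$j = B$i$j)"
  by (simp add: vec_eq_iff)

lemma sum_eq_single:
  fixes f :: "'a::finite \<Rightarrow> 'b::comm_monoid_add"
  assumes "\<And>k. k \<noteq> j \<Longrightarrow> f k = 0"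
  shows "sum f UNIV = f j"
proof -
  have "sum f UNIV = sum f {j}"
    by (rule sum.mono_neutral_right) (use assms in auto)
  then show ?thesis by simp
qed

lemma fdiag_fmul_nth: "(fdiag a \<otimes> h)$i$j = a i *\<^sub>R h$i$j"
  unfolding fmul_nth by (subst sum_eq_single[of i]) (auto simp: fdiag_nth)

lemma fmul_fdiag_nth: "(h \<otimes> fdiag a)$i$j = a j *\<^sub>R h$i$j"
  unfolding fmul_nth by (subst sum_eq_single[of j]) (auto simp: fdiag_nth)

lemma fid_fmul [simp]: "fid \<otimes> A = A" and fmul_fid [simp]: "A \<otimes> fid = A"
  by (simp_all add: fmat_eq_iff fid_eq_fdiag fdiag_fmul_nth fmul_fdiag_nth)

lemma fdiag_fmul_fdiag: "fdiag a \<otimes> fdiag b = fdiag (\<lambda>i. a i * b i)"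
  by (simp add: fmat_eq_iff fdiag_fmul_nth fdiag_nth)

lemma fadj_fdiag [simp]: "fadj (fdiag a) = fdiag a"
  by (simp add: fmat_eq_iff fdiag_nth)

lemma fadj_fid [simp]: "fadj fid = fid"
  by (simp add: fid_eq_fdiag)

lemma fadj_fadj [simp]: "fadj (fadj A) = A"
  by (simp add: fmat_eq_iff)

lemma fmul_assoc: "A \<otimes> B \<otimes> C = A \<otimes> (B \<otimes> C)"
proof -
  have "(A \<otimes> B \<otimes> C)$i$j = (A \<otimes> (B \<otimes> C))$i$j" for i j
  proof -
    have "(A \<otimes> B \<otimes> C)$i$j = (\<Sum>k\<in>UNIV. \<Sum>l\<in>UNIV. A$i$l \<odot> B$l$k \<odot> C$k$j)"
      by (simp add: fmul_nth qmult.sum_left)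
    also have "\<dots> = (\<Sum>l\<in>UNIV. \<Sum>k\<in>UNIV. A$i$l \<odot> B$l$k \<odot> C$k$j)"
      by (rule sum.swap)
    also have "\<dots> = (A \<otimes> (B \<otimes> C))$i$j"
      by (simp add: fmul_nth qmult.sum_right qmult_assoc)
    finally show ?thesis .
  qed
  then show ?thesis by (simp add: fmat_eq_iff)
qed

lemma fadj_fmul: "fadj (A \<otimes> B) = fadj B \<otimes> fadj A"
  by (simp add: fmat_eq_iff fmul_nth qconj_sum qconj_qmult)

lemma bounded_bilinear_fmul: "bounded_bilinear (fmul :: 'n fmat \<Rightarrow> 'n::finite fmat \<Rightarrow> _)"
proof -
  have "bilinear (fmul :: 'n fmat \<Rightarrow> 'n fmat \<Rightarrow> _)"
    unfolding bilinear_def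
    by (intro conjI allI linearI)
       (simp_all add: fmat_eq_iff fmul_nth qmult.add_left qmult.add_right qmult.scaleR_left
         qmult.scaleR_right sum.distrib scaleR_sum_right)
  then show ?thesis
    by (simp add: bilinear_conv_bounded_bilinear)
qed

interpretation fmul: bounded_bilinear fmul
  by (rule bounded_bilinear_fmul)

lemma continuous_on_fmul [continuous_intros]:
  "continuous_on S f \<Longrightarrow> continuous_on S g \<Longrightarrow> continuous_on S (\<lambda>x. f x \<otimes> g x)"
  by (rule fmul.continuous_on)

lemma linear_fadj: "linear (fadj :: ('n::finite) fmat \<Rightarrow> _)"
  by (auto intro!: linearI simp: fmat_eq_iff qconj_add qconj_scaleR)

lemma continuous_on_fadj [continuous_intros]:
  "continuous_on S f \<Longrightarrow> continuous_on S (\<lambda>x. fadj (f x))"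
  by (rule bounded_linear.continuous_on[OF linear_fadj[unfolded linear_conv_bounded_linear]])

lemma continuous_on_ediag [continuous_intros]:
  assumes "continuous_on S f"
  shows "continuous_on S (\<lambda>x. ediag (f x))"
  unfolding ediag_def
proof (intro continuous_on_vec_lambda)
  fix i j :: 'b
  show "continuous_on S (\<lambda>x. if i = j then qreal (exp (f x $ i)) else 0)"
    by (cases "i = j") (auto intro!: continuous_intros assms)
qed

definition ftr :: "('n::finite) fmat \<Rightarrow> real" where
  "ftr A = (\<Sum>i\<in>UNIV. qre (A$i$i))"

lemma ftr_fmul_commute: "ftr (A \<otimes> B) = ftr (B \<otimes> A)"
proof -
  have "ftr (A \<otimes> B) = (\<Sum>i\<in>UNIV. \<Sum>k\<in>UNIV. qre (A$i$k \<odot> B$k$i))"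
    by (simp add: ftr_def fmul_nth)
  also have "\<dots> = (\<Sum>k\<in>UNIV. \<Sum>i\<in>UNIV. qre (B$k$i \<odot> A$i$k))"
    by (subst sum.swap) (simp add: qre_qmult_commute)
  finally show ?thesis by (simp add: ftr_def fmul_nth)
qed

lemma ftr_fadj [simp]: "ftr (fadj A) = ftr A"
  by (simp add: ftr_def)

lemma continuous_on_ftr [continuous_intros]:
  "continuous_on S f \<Longrightarrow> continuous_on S (\<lambda>x. ftr (f x))"
  unfolding ftr_def by (intro continuous_intros)

lemma norm_fmat_sq: "(norm (A::('n::finite) fmat))\<^sup>2 = ftr (fadj A \<otimes> A)"
proof -
  have "(norm A)\<^sup>2 = (\<Sum>i\<in>UNIV. \<Sum>k\<in>UNIV. (norm (A$i$k))\<^sup>2)"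
    by (simp add: power2_norm_eq_inner inner_vec_def)
  also have "\<dots> = (\<Sum>k\<in>UNIV. \<Sum>i\<in>UNIV. (norm (A$i$k))\<^sup>2)"
    by (rule sum.swap)
  finally show ?thesis
    by (simp add: ftr_def fmul_nth qmult_qconj_left)
qed

section \<open>Matrices with entries in the coefficient field, and invertibility\<close>

lemma subspace_Mat: "subspace (Mat d)"
  by (simp add: subspace_def Mat_def Fld_add Fld_scaleR)

lemma closed_Mat: "closed (Mat d)"
  by (rule closed_subspace[OF subspace_Mat])

lemma Mat_nth: "A \<in> Mat d \<Longrightarrow> A$i$j \<in> Fld d"
  by (simp add: Mat_def)

lemma Mat_fmul: "A \<in> Mat d \<Longrightarrow> B \<in> Mat d \<Longrightarrow> A \<otimes> B \<in> Mat d"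
  unfolding Mat_def by (simp add: fmul_nth Fld_sum Fld_qmult)

lemma Mat_fadj: "A \<in> Mat d \<Longrightarrow> fadj A \<in> Mat d"
  unfolding Mat_def by (simp add: Fld_qconj)

lemma Mat_fdiag [simp]: "fdiag a \<in> Mat d"
  by (simp add: Mat_def fdiag_nth)

lemma Mat_fid [simp]: "fid \<in> Mat d"
  by (simp add: fid_eq_fdiag)

lemma Mat_ediag [simp]: "ediag t \<in> Mat d"
  by (simp add: ediag_eq_fdiag)

text \<open>Left multiplication by B is an injective real-linear endomorphism of the
  finite-dimensional space of all matrices, hence onto. This dimension count takes the place of a
  determinant argument.\<close>

lemma left_inverse_fmat:
  fixes A :: "('n::finite) fmat"
  assumes "A \<otimes> B = fid"
  shows "B \<otimes> A = fid"
proof -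
  have lin: "linear (\<lambda>X. B \<otimes> X)"
    by (intro linearI) (simp_all add: fmul.add_right fmul.scaleR_right)
  have "inj (\<lambda>X. B \<otimes> X)"
    by (rule inj_on_inverseI[of _ "\<lambda>X. A \<otimes> X"]) (simp add: fmul_assoc[symmetric] assms)
  then have "surj (\<lambda>X. B \<otimes> X)"
    by (intro linear_injective_imp_surjective[OF lin]) simp_all
  then obtain X where X: "B \<otimes> X = fid" by (metis surj_def)
  have "A = A \<otimes> (B \<otimes> X)" by (simp add: X)
  also have "\<dots> = X" by (simp add: fmul_assoc[symmetric] assms)
  finally show ?thesis using X by simp
qed

lemma GLF_iff: "A \<in> GLF d \<longleftrightarrow> A \<in> Mat d \<and> (\<exists>B\<in>Mat d. A \<otimes> B = fid)"
  using left_inverse_fmat by (auto simp: GLF_def)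

lemma GLFI: "A \<in> Mat d \<Longrightarrow> B \<in> Mat d \<Longrightarrow> A \<otimes> B = fid \<Longrightarrow> A \<in> GLF d"
  using GLF_iff by blast

lemma GLF_imp_Mat: "A \<in> GLF d \<Longrightarrow> A \<in> Mat d"
  by (simp add: GLF_def)

lemma GLF_fmul:
  assumes "A \<in> GLF d" "B \<in> GLF d"
  shows "A \<otimes> B \<in> GLF d"
proof -
  obtain A' B' where A: "A' \<in> Mat d" "A \<otimes> A' = fid" and B: "B' \<in> Mat d" "B \<otimes> B' = fid"
    using assms by (auto simp: GLF_def)
  have "A \<otimes> B \<otimes> (B' \<otimes> A') = A \<otimes> (B \<otimes> B') \<otimes> A'"
    by (simp add: fmul_assoc)
  then have "A \<otimes> B \<otimes> (B' \<otimes> A') = fid" using A B by simp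
  then show ?thesis
    using A B assms by (intro GLFI[of _ _ "B' \<otimes> A'"]) (auto intro: Mat_fmul GLF_imp_Mat)
qed

text \<open>The dimension count relative to a subspace. Applied to \<open>Mat d\<close> and to
  spaces of vectors, it produces inverses and solutions whose entries stay in
  \<open>Fld d\<close>.\<close>

lemma linear_inj_subspace_onto:
  fixes f :: "'a::euclidean_space \<Rightarrow> 'a"
  assumes f: "linear f" and S: "subspace S" and im: "f ` S \<subseteq> S"
    and inj: "\<And>x. x \<in> S \<Longrightarrow> f x = 0 \<Longrightarrow> x = 0"
  shows "f ` S = S"
proof (rule subspace_dim_equal)
  show "subspace (f ` S)" by (rule linear_subspace_image[OF f S])
  have "inj_on f S"
  proof (rule inj_onI)
    fix x y assume "x \<in> S" "y \<in> S" "f x = f y"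
    then show "x = y"
      using inj[of "x - y"] S by (simp add: linear_diff[OF f] subspace_diff)
  qed
  then have "inj_on f (span S)"
    using S by (metis span_eq_iff)
  then show "dim S \<le> dim (f ` S)"
    by (simp add: dim_image_eq[OF f])
qed (use S im in auto)

lemma GLF_if_inj:
  assumes A: "A \<in> Mat d" and inj: "\<And>X. X \<in> Mat d \<Longrightarrow> A \<otimes> X = 0 \<Longrightarrow> X = 0"
  shows "A \<in> GLF d"
proof -
  have "(\<lambda>X. A \<otimes> X) ` Mat d = Mat d"
  proof (rule linear_inj_subspace_onto)
    show "linear (\<lambda>X. A \<otimes> X)"
      by (intro linearI) (simp_all add: fmul.add_right fmul.scaleR_right)
  qed (use A inj in \<open>auto intro: subspace_Mat Mat_fmul\<close>)
  then have "fid \<in> (\<lambda>X. A \<otimes> X) ` Mat d" by simp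
  then show ?thesis using A by (auto intro: GLFI)
qed

section \<open>The compact group of unitary matrices\<close>

lemma UF_imp_Mat: "u \<in> UF d \<Longrightarrow> u \<in> Mat d"
  by (simp add: UF_def)

lemma UFI: "u \<in> Mat d \<Longrightarrow> fadj u \<otimes> u = fid \<Longrightarrow> u \<in> UF d"
  by (simp add: UF_def)

lemma UF_left [simp]: "u \<in> UF d \<Longrightarrow> fadj u \<otimes> u = fid"
  by (simp add: UF_def)

lemma UF_right [simp]: "u \<in> UF d \<Longrightarrow> u \<otimes> fadj u = fid"
  by (rule left_inverse_fmat) simp

lemma UF_cancel_left [simp]:
  "u \<in> UF d \<Longrightarrow> fadj u \<otimes> (u \<otimes> A) = A" "u \<in> UF d \<Longrightarrow> u \<otimes> (fadj u \<otimes> A) = A"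
  by (simp_all add: fmul_assoc[symmetric])

lemma UF_fid [simp]: "fid \<in> UF d"
  by (rule UFI) simp_all

lemma UF_fmul: "u \<in> UF d \<Longrightarrow> v \<in> UF d \<Longrightarrow> u \<otimes> v \<in> UF d"
  by (rule UFI) (simp_all add: fadj_fmul fmul_assoc Mat_fmul UF_imp_Mat)

lemma UF_fadj: "u \<in> UF d \<Longrightarrow> fadj u \<in> UF d"
  by (rule UFI) (simp_all add: Mat_fadj UF_imp_Mat)

lemma UF_GLF: "u \<in> UF d \<Longrightarrow> u \<in> GLF d"
  by (rule GLFI[of _ _ "fadj u"]) (auto intro: UF_imp_Mat Mat_fadj)

lemma finv_eqI:
  assumes "B \<in> Mat d" "A \<otimes> B = fid"
  shows "finv d A = B"
  unfolding finv_def
proof (rule the_equality)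
  show "B \<in> Mat d \<and> A \<otimes> B = fid \<and> B \<otimes> A = fid"
    using assms left_inverse_fmat by blast
  fix C assume "C \<in> Mat d \<and> A \<otimes> C = fid \<and> C \<otimes> A = fid"
  then have "C \<otimes> (A \<otimes> B) = B" by (simp add: fmul_assoc[symmetric])
  then show "C = B" using assms by simp
qed

lemma finv_UF: "u \<in> UF d \<Longrightarrow> finv d u = fadj u"
  by (rule finv_eqI) (simp_all add: UF_imp_Mat Mat_fadj)

lemma closed_UF: "closed (UF d :: ('n::finite) fmat set)"
proof -
  have "UF d = Mat d \<inter> (\<lambda>u. fadj u \<otimes> u) -` {fid :: 'n fmat}"
    unfolding UF_def by auto
  moreover have "closed ((\<lambda>u. fadj u \<otimes> u) -` {fid :: 'n fmat})"
    by (intro closed_vimage) (auto intro!: continuous_intros)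
  ultimately show ?thesis
    by (simp add: closed_Int closed_Mat)
qed

lemma compact_UF: "compact (UF d :: ('n::finite) fmat set)"
proof -
  have "norm u \<le> sqrt (ftr (fid :: 'n fmat))" if "u \<in> UF d" for u :: "'n fmat"
    using norm_fmat_sq[of u] that by (simp add: real_le_rsqrt)
  then have "bounded (UF d :: 'n fmat set)"
    unfolding bounded_iff by blast
  then show ?thesis
    by (simp add: compact_eq_bounded_closed closed_UF)
qed

lemma UF_column_norm: "u \<in> UF d \<Longrightarrow> (\<Sum>i\<in>UNIV. (norm (u$i$j))\<^sup>2) = 1"
proof -
  assume "u \<in> UF d"
  then have "qre ((fadj u \<otimes> u)$j$j) = 1" by (simp add: fid_nth)
  then show ?thesis by (simp add: fmul_nth qmult_qconj_left)
qed

lemma UF_row_norm: "u \<in> UF d \<Longrightarrow> (\<Sum>j\<in>UNIV. (norm (u$i$j))\<^sup>2) = 1"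
  using UF_column_norm[OF UF_fadj, of u d i] by simp

text \<open>A plane rotation with real cosine c and sine b in F. Since c commutes with everything,
  \<open>- qconj b\<close> in the opposite corner is what unitarity demands; \<open>c = 0\<close>,
  \<open>b = qreal 1\<close> exchanges two coordinates up to sign.\<close>

definition prot :: "'n \<Rightarrow> 'n \<Rightarrow> real \<Rightarrow> quat \<Rightarrow> ('n::finite) fmat" where
  "prot i j c b = (\<chi> k l.
     if k = i then (if l = i then qreal c else if l = j then b else 0)
     else if k = j then (if l = i then - qconj b else if l = j then qreal c else 0)
     else if k = l then qreal 1 else 0)"

lemma sum_eq_two:
  fixes f :: "'a::finite \<Rightarrow> 'b::comm_monoid_add"
  assumes "i \<noteq> j" "\<And>k. k \<noteq> i \<Longrightarrow> k \<noteq> j \<Longrightarrow> f k = 0"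
  shows "sum f UNIV = f i + f j"
proof -
  have "sum f UNIV = sum f {i, j}"
    by (rule sum.mono_neutral_right) (use assms in auto)
  then show ?thesis using assms by simp
qed

lemma prot_fmul_nth:
  assumes "i \<noteq> j"
  shows "(prot i j c b \<otimes> h)$k$l =
    (if k = i then c *\<^sub>R h$i$l + b \<odot> h$j$l
     else if k = j then - (qconj b \<odot> h$i$l) + c *\<^sub>R h$j$l else h$k$l)"
proof (cases "k = i \<or> k = j")
  case True
  then show ?thesis
    unfolding fmul_nth using assms
    by (subst sum_eq_two[of i j]) (auto simp: prot_def qmult.minus_left)
next
  case False
  then show ?thesis
    unfolding fmul_nth by (subst sum_eq_single[of k]) (auto simp: prot_def)
qed

lemma fadj_prot: "i \<noteq> j \<Longrightarrow> fadj (prot i j c b) = prot i j c (- b)"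
  by (auto simp: fmat_eq_iff prot_def qconj_minus)

lemma prot_UF:
  assumes "i \<noteq> j" "b \<in> Fld d" "c\<^sup>2 + (norm b)\<^sup>2 = 1"
  shows "prot i j c b \<in> UF d"
proof -
  have "(prot i j c (- b) \<otimes> prot i j c b)$k$l = fid$k$l" for k l
    using assms unfolding prot_fmul_nth[OF assms(1)]
    by (auto simp: prot_def fid_nth qconj_minus qmult.minus_left qmult.minus_right
        qmult_qconj_right qmult_qconj_left power2_eq_square quat_eq_iff)
  moreover have "prot i j c b \<in> Mat d"
    using assms by (simp add: Mat_def prot_def Fld_minus Fld_qconj)
  ultimately show ?thesis
    using assms by (intro UFI) (simp_all add: fadj_prot fmat_eq_iff)
qed

definition phase :: "'n \<Rightarrow> quat \<Rightarrow> ('n::finite) fmat" where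
  "phase i b = (\<chi> k l. if k = l then (if k = i then b else qreal 1) else 0)"

lemma phase_fmul_nth: "(phase i b \<otimes> h)$k$l = (if k = i then b \<odot> h$k$l else h$k$l)"
  unfolding fmul_nth by (subst sum_eq_single[of k]) (auto simp: phase_def)

lemma phase_UF:
  assumes "b \<in> Fld d" "norm b = 1"
  shows "phase i b \<in> UF d"
proof -
  have "fadj (phase i b) = phase i (qconj b)"
    by (auto simp: fmat_eq_iff phase_def)
  moreover have "phase i (qconj b) \<otimes> phase i b = fid"
    by (auto simp: fmat_eq_iff phase_fmul_nth) (auto simp: phase_def fid_nth qmult_qconj_left assms)
  moreover have "phase i b \<in> Mat d"
    using assms by (simp add: Mat_def phase_def)
  ultimately show ?thesis by (intro UFI) simp_all
qed

lemma ediag_fmul_nth: "(ediag t \<otimes> h)$i$j = exp (t$i) *\<^sub>R h$i$j"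
  and fmul_ediag_nth: "(h \<otimes> ediag t)$i$j = exp (t$j) *\<^sub>R h$i$j"
  by (simp_all add: ediag_eq_fdiag fdiag_fmul_nth fmul_fdiag_nth)

lemma ediag_fmul_ediag: "ediag s \<otimes> ediag t = ediag (s + t)"
  by (simp add: ediag_eq_fdiag fdiag_fmul_fdiag exp_add)

lemma ediag_0: "ediag 0 = fid"
  by (simp add: ediag_eq_fdiag fid_eq_fdiag)

lemma fadj_ediag [simp]: "fadj (ediag t) = ediag t"
  by (simp add: ediag_eq_fdiag)

lemma ediag_GLF [simp]: "ediag t \<in> GLF d"
  by (rule GLFI[of _ _ "ediag (- t)"]) (simp_all add: ediag_fmul_ediag ediag_0)

section \<open>The Iwasawa (QR) decomposition\<close>

lemma pos_less_iff [simp]: "pos i < pos j \<longleftrightarrow> i < (j::'n::{finite,linorder})"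
proof -
  have *: "pos i < pos j" if "i < j" for i j :: 'n
    unfolding pos_def using that by (intro psubset_card_mono) auto
  have "\<not> pos i < pos j" if "\<not> i < j"
    using that *[of j i] by (cases i j rule: linorder_cases) auto
  with * show ?thesis by blast
qed

lemma pos_eq_iff [simp]: "pos i = pos j \<longleftrightarrow> i = (j::'n::{finite,linorder})"
  by (metis pos_less_iff linorder_neq_iff less_irrefl)

lemma pos_le_iff [simp]: "pos i \<le> pos j \<longleftrightarrow> i \<le> (j::'n::{finite,linorder})"
  by (simp add: linorder_not_less[symmetric])

lemma pos_less_card: "pos (i::'n::{finite,linorder}) < CARD('n)"
  unfolding pos_def by (intro psubset_card_mono) auto

lemma ex_pos_eq: "r < CARD('n) \<Longrightarrow> \<exists>j::'n::{finite,linorder}. pos j = r"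
proof -
  assume r: "r < CARD('n)"
  have "pos ` (UNIV::'n set) = {..<CARD('n)}"
  proof (rule card_subset_eq)
    show "card (pos ` (UNIV::'n set)) = card {..<CARD('n)}"
      by (subst card_image) (auto intro: injI)
  qed (auto simp: pos_less_card)
  then show ?thesis using r by (metis imageE lessThan_iff)
qed

section \<open>Triangular matrices\<close>

definition utri :: "('n::{finite,linorder}) fmat \<Rightarrow> bool" where
  "utri A \<longleftrightarrow> (\<forall>i j. j < i \<longrightarrow> A$i$j = 0)"

lemma utri_fmul_diag:
  assumes "utri A" "utri B"
  shows "(A \<otimes> B)$i$i = A$i$i \<odot> B$i$i"
  unfolding fmul_nth
proof (rule sum_eq_single)
  fix k assume "k \<noteq> i"
  then show "A$i$k \<odot> B$k$i = 0"
    using assms by (cases k i rule: linorder_cases) (auto simp: utri_def)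
qed

lemma utri_fmul:
  assumes "utri A" "utri B"
  shows "utri (A \<otimes> B)"
  unfolding utri_def fmul_nth
proof (intro allI impI sum.neutral ballI)
  fix i j k :: 'a assume "j < i"
  then have "k < i \<or> j < k" by auto
  then show "A$i$k \<odot> B$k$j = 0"
    using assms by (auto simp: utri_def)
qed

text \<open>Induction over the columns of s: once the earlier columns vanish below the diagonal, the
  entry \<open>(s \<otimes> r)$i$j\<close> with \<open>j \<le> i\<close> collapses to
  \<open>s$i$j \<odot> r$j$j\<close>, and the nonzero diagonal of the product shows that
  \<open>r$j$j\<close> can be cancelled. With product \<open>fid\<close> this makes inverses of
  triangular matrices triangular.\<close>

lemma utri_left_quotient:
  assumes r: "utri r" and sr: "utri (s \<otimes> r)" and nz: "\<And>j. (s \<otimes> r)$j$j \<noteq> 0"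
  shows "utri s"
proof -
  have "\<forall>i>j. s$i$j = 0" for j
  proof (induction j rule: measure_induct_rule[of pos])
    case (less j)
    have only_j: "(s \<otimes> r)$i$j = s$i$j \<odot> r$j$j" if "j \<le> i" for i
      unfolding fmul_nth
    proof (rule sum_eq_single)
      fix k assume "k \<noteq> j"
      then consider "k < j" | "j < k" by (meson linorder_neqE)
      then show "s$i$k \<odot> r$k$j = 0"
        using r less.IH[of k] that by cases (auto simp: utri_def)
    qed
    have "r$j$j \<noteq> 0"
      using only_j[of j] nz[of j] by auto
    moreover have "s$i$j \<odot> r$j$j = 0" if "j < i" for i
      using only_j[of i] sr that by (simp add: utri_def)
    ultimately show ?case by (auto simp: qmult_eq_0_iff)
  qed
  then show ?thesis by (auto simp: utri_def)
qed

text \<open>The group \<open>A N\<close> of the Iwasawa decomposition \<open>G = K A N\<close>; real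
  positive diagonal entries are what makes the unitary factor unique.\<close>

definition Tpos :: "nat \<Rightarrow> ('n::{finite,linorder}) fmat set" where
  "Tpos d = {r \<in> Mat d. utri r \<and> (\<forall>i. \<exists>\<rho>>0. r$i$i = qreal \<rho>)}"

lemma Tpos_fmul:
  assumes "r \<in> Tpos d" "s \<in> Tpos d"
  shows "r \<otimes> s \<in> Tpos d"
proof -
  have "\<exists>\<rho>>0. (r \<otimes> s)$i$i = qreal \<rho>" for i
  proof -
    obtain a b where "a > 0" "b > 0" "r$i$i = qreal a" "s$i$i = qreal b"
      using assms unfolding Tpos_def by blast
    moreover have "(r \<otimes> s)$i$i = r$i$i \<odot> s$i$i"
      using assms by (intro utri_fmul_diag) (auto simp: Tpos_def)
    ultimately show ?thesis by (intro exI[of _ "a * b"]) auto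
  qed
  then show ?thesis
    using assms by (auto simp: Tpos_def intro: Mat_fmul utri_fmul)
qed

lemma Tpos_diag: "r \<in> Tpos d \<Longrightarrow> r$i$i = qreal (qre (r$i$i)) \<and> 0 < qre (r$i$i)"
  by (auto simp: Tpos_def dest!: spec[of _ i])

lemma Tpos_pos: "r \<in> Tpos d \<Longrightarrow> 0 < qre (r$i$i)"
  using Tpos_diag by blast

lemma Tpos_diag_nonzero: "r \<in> Tpos d \<Longrightarrow> r$i$i \<noteq> 0"
  using Tpos_pos[of r d i] by auto

lemma Tpos_utri: "r \<in> Tpos d \<Longrightarrow> utri r"
  by (simp add: Tpos_def)

lemma Tpos_Mat: "r \<in> Tpos d \<Longrightarrow> r \<in> Mat d"
  by (simp add: Tpos_def)

lemma GLF_utri_diag_nonzero: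
  assumes "r \<in> GLF d" "utri r"
  shows "r$i$i \<noteq> 0"
proof -
  obtain s where sr: "s \<otimes> r = fid" using assms by (auto simp: GLF_def)
  have "utri s"
    by (rule utri_left_quotient[OF assms(2)]) (simp_all add: sr utri_def fid_nth)
  then have "s$i$i \<odot> r$i$i = qreal 1"
    using utri_fmul_diag[of s r i] assms by (simp add: sr fid_nth)
  then show ?thesis by auto
qed

text \<open>Both w and its adjoint are quotients of triangular matrices, so w is diagonal. Its
  diagonal entries have norm one by unitarity and are positive reals by comparison of the two
  diagonals.\<close>

lemma Tpos_UF_eq:
  assumes w: "w \<in> UF d" and r: "r \<in> Tpos d" and wr: "w \<otimes> r \<in> Tpos d"
  shows "w = fid"
proof -

  have "utri w"
    by (rule utri_left_quotient[OF Tpos_utri[OF r] Tpos_utri[OF wr] Tpos_diag_nonzero[OF wr]])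
  have "utri (fadj w)"
    by (rule utri_left_quotient[OF Tpos_utri[OF wr]]; subst UF_cancel_left(1)[OF w])
      (rule Tpos_utri[OF r] Tpos_diag_nonzero[OF r])+
  have off: "w$i$j = 0" if "i \<noteq> j" for i j
  proof (cases "j < i")
    case True
    then show ?thesis using \<open>utri w\<close> by (simp add: utri_def)
  next
    case False
    then have "fadj w $ j $ i = 0" using that \<open>utri (fadj w)\<close> by (simp add: utri_def)
    then have "qconj (qconj (w$i$j)) = 0" by (simp del: qconj_qconj)
    then show ?thesis by simp
  qed
  have "w$j$j = qreal 1" for j
  proof -
    have "(\<Sum>i\<in>UNIV. (norm (w$i$j))\<^sup>2) = (norm (w$j$j))\<^sup>2"
      by (rule sum_eq_single) (simp add: off)
    then have n1: "norm (w$j$j) = 1"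
      using UF_column_norm[OF w, of j] by (simp add: power2_eq_1_iff) (smt (verit) norm_ge_zero)
    have "(w \<otimes> r)$j$j = w$j$j \<odot> r$j$j"
      by (rule utri_fmul_diag) (use \<open>utri w\<close> r in \<open>auto simp: Tpos_utri\<close>)
    then have "qreal (qre ((w \<otimes> r)$j$j)) = qre (r$j$j) *\<^sub>R w$j$j"
      using Tpos_diag[OF r, of j] Tpos_diag[OF wr, of j] by (metis qmult_qreal_right)
    moreover define a where "a = qre (r$j$j)"
    moreover define b where "b = qre ((w \<otimes> r)$j$j)"
    ultimately have *: "qreal b = a *\<^sub>R w$j$j" by simp
    have "a > 0" "b > 0"
      using Tpos_diag[OF r, of j] Tpos_diag[OF wr, of j] by (auto simp: a_def b_def)
    from * have "norm (qreal b) = norm (a *\<^sub>R w$j$j)" by simp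
    then have "a = b" using n1 \<open>a > 0\<close> \<open>b > 0\<close> by simp
    have "w$j$j = (1/a) *\<^sub>R (a *\<^sub>R w$j$j)" using \<open>a > 0\<close> by simp
    also have "\<dots> = qreal 1" using * \<open>a = b\<close> \<open>a > 0\<close> by (metis nonzero_eq_divide_eq order_less_irrefl
      scaleR_qreal divide_self mult.commute times_divide_eq_right mult.right_neutral)
    finally show ?thesis .
  qed
  with off show ?thesis by (auto simp: fmat_eq_iff fid_nth)
qed

text \<open>The columns are made triangular one at a time: among the unitary matrices fixing the first
  coordinates, one maximises the real part of the next diagonal entry, and stationarity under
  plane rotations forces the entries below it to vanish.\<close>

lemma qr_step:
  fixes h :: "('n::{finite,linorder}) fmat" and j :: 'n
  assumes h: "h \<in> Mat d" and tri: "\<And>k i. k < j \<Longrightarrow> k < i \<Longrightarrow> h$i$k = 0"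
  obtains w where "w \<in> UF d" "\<And>k i. k < j \<Longrightarrow> (w \<otimes> h)$i$k = h$i$k"
    "\<And>i. j < i \<Longrightarrow> (w \<otimes> h)$i$j = 0" "(w \<otimes> h)$j$j = qreal (norm ((w \<otimes> h)$j$j))"
proof -
  \<comment> \<open>Prescribing rows as well as columns gives block matrices that are closed under
    products, so a maximiser multiplied by a further rotation or phase from K still competes for the
    maximum.\<close>
  define K where "K = {w \<in> UF d. \<forall>i k. (i < j \<or> k < j) \<longrightarrow> w$i$k = fid$i$k}"
  have fixK: "w$i$k = (if i = k then qreal 1 else 0)" if "w \<in> K" "i < j \<or> k < j" for w i k
    using that by (auto simp: K_def fid_nth)
  have K_mult: "w \<otimes> w' \<in> K" if "w \<in> K" "w' \<in> K" for w w'
  proof -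
    have "(w \<otimes> w')$i$k = fid$i$k" if ik: "i < j \<or> k < j" for i k
    proof (cases "i < j")
      case True
      have "(w \<otimes> w')$i$k = w$i$i \<odot> w'$i$k"
        unfolding fmul_nth by (rule sum_eq_single) (simp add: fixK[OF \<open>w \<in> K\<close>] True)
      then show ?thesis using True that by (simp add: fixK[OF \<open>w \<in> K\<close>] fixK[OF \<open>w' \<in> K\<close>] fid_nth)
    next
      case False
      with ik have "k < j" by simp
      have "(w \<otimes> w')$i$k = w$i$k \<odot> w'$k$k"
        unfolding fmul_nth by (rule sum_eq_single) (simp add: fixK[OF \<open>w' \<in> K\<close>] \<open>k < j\<close>)
      then show ?thesis using \<open>k < j\<close> by (simp add: fixK[OF \<open>w \<in> K\<close>] fixK[OF \<open>w' \<in> K\<close>] fid_nth)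
    qed
    then show ?thesis using that by (auto simp: K_def intro: UF_fmul)
  qed
  have "compact K"
  proof -
    have "K = UF d \<inter> (\<Inter>i. \<Inter>k. {w. (i < j \<or> k < j) \<longrightarrow> w$i$k = fid$i$k})"
      by (auto simp: K_def)
    moreover have "closed {w :: 'n fmat. (i < j \<or> k < j) \<longrightarrow> w$i$k = fid$i$k}" for i k
      by (cases "i < j \<or> k < j") (auto intro!: closed_Collect_eq continuous_intros)
    ultimately show ?thesis
      by (auto intro!: compact_Int_closed compact_UF)
  qed
  moreover have "fid \<in> K" by (simp add: K_def)
  moreover have "continuous_on K (\<lambda>w. qre ((w \<otimes> h)$j$j))"
    by (intro continuous_intros)
  ultimately obtain w where w: "w \<in> K"
    and max: "\<And>w'. w' \<in> K \<Longrightarrow> qre ((w' \<otimes> h)$j$j) \<le> qre ((w \<otimes> h)$j$j)"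
    using continuous_attains_sup[of K "\<lambda>w. qre ((w \<otimes> h)$j$j)"] by auto
  define h' where "h' = w \<otimes> h"
  have wU: "w \<in> UF d" using w by (simp add: K_def)
  have h': "h' \<in> Mat d" using wU h by (simp add: h'_def Mat_fmul UF_imp_Mat)
  have max': "qre ((w' \<otimes> h')$j$j) \<le> qre (h'$j$j)" if "w' \<in> K" for w'
    using max[OF K_mult[OF that w]] by (simp add: h'_def fmul_assoc)
  show thesis
  proof (rule that[OF wU])
    fix k i assume "k < j"
    have "w$i$l \<odot> h$l$k = fid$i$l \<odot> h$l$k" for l
    proof (cases "l < j")
      case True
      then show ?thesis using w by (simp add: K_def)
    next
      case False
      then show ?thesis using \<open>k < j\<close> tri[of k l] by simp
    qed
    then have "(w \<otimes> h)$i$k = (fid \<otimes> h)$i$k" unfolding fmul_nth by simp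
    then show "(w \<otimes> h)$i$k = h$i$k" by simp
  next
    fix i assume "j < i"
    have "h'$i$j = 0"
    proof (rule rotation_stationary[of _ d])
      fix c b assume b: "b \<in> Fld d" "c\<^sup>2 + (norm b)\<^sup>2 = 1"
      have "prot j i c b \<in> K"
        using \<open>j < i\<close> b by (auto simp: K_def prot_UF) (auto simp: prot_def fid_nth)
      from max'[OF this] show "c * qre (h'$j$j) + qre (b \<odot> h'$i$j) \<le> qre (h'$j$j)"
        using \<open>j < i\<close> by (simp add: prot_fmul_nth)
    qed (rule Mat_nth[OF h'])
    then show "(w \<otimes> h)$i$j = 0" by (simp add: h'_def)
  next
    have "h'$j$j = qreal (norm (h'$j$j))"
    proof (rule phase_stationary[of _ d])
      fix b assume b: "b \<in> Fld d" "norm b = 1"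
      have "phase j b \<in> K"
        using b by (auto simp: K_def phase_UF) (auto simp: phase_def fid_nth)
      from max'[OF this] show "qre (b \<odot> h'$j$j) \<le> qre (h'$j$j)"
        by (simp add: phase_fmul_nth)
    qed (rule Mat_nth[OF h'])
    then show "(w \<otimes> h)$j$j = qreal (norm ((w \<otimes> h)$j$j))" by (simp add: h'_def)
  qed
qed

lemma qr_exists:
  fixes g :: "('n::{finite,linorder}) fmat"
  assumes g: "g \<in> GLF d"
  shows "\<exists>u\<in>UF d. fadj u \<otimes> g \<in> Tpos d"
proof -
  \<comment> \<open>The induction over the number r of treated columns only gives nonnegative
    diagonal entries, because a stationary entry may be zero. Invertibility of g excludes this once
    the whole matrix is triangular.\<close>
  have "\<exists>u\<in>UF d. \<forall>k. pos k < r \<longrightarrow>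
      (\<forall>i>k. (u \<otimes> g)$i$k = 0) \<and> (\<exists>\<rho>\<ge>0. (u \<otimes> g)$k$k = qreal \<rho>)" for r
  proof (induction r)
    case 0
    show ?case by (rule bexI[of _ fid]) simp_all
  next
    case (Suc r)
    then obtain u where u: "u \<in> UF d"
      "\<And>k. pos k < r \<Longrightarrow> (\<forall>i>k. (u \<otimes> g)$i$k = 0) \<and> (\<exists>\<rho>\<ge>0. (u \<otimes> g)$k$k = qreal \<rho>)"
      by blast
    show ?case
    proof (cases "r < CARD('n)")
      case False
      then have "pos k < r" for k :: 'n using pos_less_card[of k] by simp
      then show ?thesis using u by blast
    next
      case True
      then obtain j :: 'n where j: "pos j = r" using ex_pos_eq by blast
      have "u \<otimes> g \<in> Mat d" using u g by (simp add: Mat_fmul UF_imp_Mat GLF_imp_Mat)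
      then obtain w where w: "w \<in> UF d" "\<And>k i. k < j \<Longrightarrow> (w \<otimes> (u \<otimes> g))$i$k = (u \<otimes> g)$i$k"
        "\<And>i. j < i \<Longrightarrow> (w \<otimes> (u \<otimes> g))$i$j = 0"
        "(w \<otimes> (u \<otimes> g))$j$j = qreal (norm ((w \<otimes> (u \<otimes> g))$j$j))"
        using qr_step[of "u \<otimes> g" d j] u j[symmetric] by auto
      show ?thesis
      proof (intro bexI[of _ "w \<otimes> u"] allI impI)
        show "w \<otimes> u \<in> UF d" using w u by (simp add: UF_fmul)
        fix k :: 'n assume "pos k < Suc r"
        then have "k < j \<or> k = j" using j by (metis less_SucE pos_eq_iff pos_less_iff)
        then show "(\<forall>i>k. (w \<otimes> u \<otimes> g)$i$k = 0) \<and> (\<exists>\<rho>\<ge>0. (w \<otimes> u \<otimes> g)$k$k = qreal \<rho>)"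
        proof
          assume "k < j"
          then show ?thesis using u(2)[of k] j w(2) by (auto simp: fmul_assoc)
        next
          assume "k = j"
          then show ?thesis using w(3,4) by (auto simp: fmul_assoc intro: exI[of _ "norm _"])
        qed
      qed
    qed
  qed
  from this[of "CARD('n)"] obtain u where u: "u \<in> UF d"
    and tri: "\<And>i k. k < i \<Longrightarrow> (u \<otimes> g)$i$k = 0"
    and diag: "\<And>k. \<exists>\<rho>\<ge>0. (u \<otimes> g)$k$k = qreal \<rho>"
    using pos_less_card by blast
  have GL: "u \<otimes> g \<in> GLF d" using u g by (simp add: GLF_fmul UF_GLF)
  have tri': "utri (u \<otimes> g)" using tri by (simp add: utri_def)
  have "\<exists>\<rho>>0. (u \<otimes> g)$k$k = qreal \<rho>" for k
  proof -
    obtain \<rho> where "\<rho> \<ge> 0" "(u \<otimes> g)$k$k = qreal \<rho>" using diag by blast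
    with GLF_utri_diag_nonzero[OF GL tri', of k] show ?thesis
      by (intro exI[of _ \<rho>]) (auto simp: less_le)
  qed
  with GL tri' have "u \<otimes> g \<in> Tpos d" by (simp add: Tpos_def GLF_imp_Mat)
  with u show ?thesis by (intro bexI[of _ "fadj u"]) (simp_all add: UF_fadj)
qed

lemma qr_unique:
  assumes "u \<in> UF d" "v \<in> UF d" "fadj u \<otimes> g \<in> Tpos d" "fadj v \<otimes> g \<in> Tpos d"
  shows "u = v"
proof -
  have "fadj v \<otimes> u \<otimes> (fadj u \<otimes> g) = fadj v \<otimes> g"
    using assms by (simp add: fmul_assoc)
  then have "fadj v \<otimes> u = fid"
    using Tpos_UF_eq[of "fadj v \<otimes> u" d "fadj u \<otimes> g"] assms by (simp add: UF_fmul UF_fadj)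
  then have "v \<otimes> (fadj v \<otimes> u) = v" by simp
  then show ?thesis using assms by simp
qed

text \<open>\<open>QU\<close> is the unitary factor, \<open>IA\<close> the logarithm of the abelian factor of the Iwasawa
  decomposition.\<close>

definition QU :: "nat \<Rightarrow> ('n::{finite,linorder}) fmat \<Rightarrow> 'n fmat" where
  "QU d g = (if g \<in> GLF d then THE u. u \<in> UF d \<and> fadj u \<otimes> g \<in> Tpos d else fid)"

definition IA :: "nat \<Rightarrow> ('n::{finite,linorder}) fmat \<Rightarrow> (real,'n) vec" where
  "IA d g = (if g \<in> GLF d then \<chi> j. ln (qre ((fadj (QU d g) \<otimes> g)$j$j)) else 0)"

lemma QU_props:
  assumes "g \<in> GLF d"
  shows "QU d g \<in> UF d" "fadj (QU d g) \<otimes> g \<in> Tpos d"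
proof -
  have "\<exists>!u. u \<in> UF d \<and> fadj u \<otimes> g \<in> Tpos d"
    using qr_exists[OF assms] qr_unique by blast
  from theI'[OF this] assms show "QU d g \<in> UF d" "fadj (QU d g) \<otimes> g \<in> Tpos d"
    by (simp_all add: QU_def)
qed

text \<open>The default value \<open>fid\<close> outside \<open>GLF d\<close> makes this
  unconditional, so that the law of \<open>QU d\<close> gives the unitary group full mass without an
  exceptional set.\<close>

lemma QU_UF [simp]: "QU d g \<in> UF d"
  using QU_props(1)[of g d] by (cases "g \<in> GLF d") (simp_all add: QU_def)

lemma QU_eqI: "g \<in> GLF d \<Longrightarrow> u \<in> UF d \<Longrightarrow> fadj u \<otimes> g \<in> Tpos d \<Longrightarrow> QU d g = u"
  using qr_unique QU_props by blast

text \<open>Back substitution from the last row upwards, which is why the induction measure counts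
  positions from the end.\<close>

lemma utri_GLF:
  fixes r :: "('n::{finite,linorder}) fmat"
  assumes r: "r \<in> Mat d" "utri r" and nz: "\<And>i. r$i$i \<noteq> 0"
  shows "r \<in> GLF d"
proof (rule GLF_if_inj[OF r(1)])
  fix X assume "X \<in> Mat d" and rX: "r \<otimes> X = 0"
  have "\<forall>j. X$i$j = 0" for i
  proof (induction i rule: measure_induct_rule[of "\<lambda>i. CARD('n) - pos i"])
    case (less i)
    show ?case
    proof
      fix j
      have "(r \<otimes> X)$i$j = r$i$i \<odot> X$i$j"
        unfolding fmul_nth
      proof (rule sum_eq_single)
        fix k assume "k \<noteq> i"
        then consider "k < i" | "i < k" by (meson linorder_neqE)
        then show "r$i$k \<odot> X$k$j = 0"
        proof cases
          case 1
          then show ?thesis using r by (simp add: utri_def)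
        next
          case 2
          then have "CARD('n) - pos k < CARD('n) - pos i"
            using pos_less_card[of k] pos_less_iff[of i k] by linarith
          then show ?thesis using less.IH[of k] by simp
        qed
      qed
      then show "X$i$j = 0"
        using rX nz[of i] by (auto simp: qmult_eq_0_iff)
    qed
  qed
  then show "X = 0" by (simp add: fmat_eq_iff)
qed

lemma Tpos_GLF: "r \<in> Tpos d \<Longrightarrow> r \<in> GLF d"
  by (intro utri_GLF Tpos_Mat Tpos_utri Tpos_diag_nonzero)

lemma QU_fmul_Tpos:
  assumes "g \<in> GLF d" "r \<in> Tpos d"
  shows "QU d (g \<otimes> r) = QU d g"
  by (rule QU_eqI) (use assms QU_props[OF assms(1)] in
    \<open>auto simp: fmul_assoc[symmetric] intro: GLF_fmul Tpos_GLF Tpos_fmul\<close>)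

lemma QU_UF_fmul:
  assumes "g \<in> GLF d" "v \<in> UF d"
  shows "QU d (v \<otimes> g) = v \<otimes> QU d g"
  by (rule QU_eqI) (use assms QU_props[OF assms(1)] in
    \<open>auto simp: fadj_fmul fmul_assoc intro: GLF_fmul UF_GLF UF_fmul\<close>)

lemma IA_UF_fmul: "g \<in> GLF d \<Longrightarrow> v \<in> UF d \<Longrightarrow> IA d (v \<otimes> g) = IA d g"
  by (simp add: IA_def QU_UF_fmul fadj_fmul fmul_assoc GLF_fmul UF_GLF)

lemma IA_Tpos: "r \<in> Tpos d \<Longrightarrow> IA d r = (\<chi> j. ln (qre (r$j$j)))"
  using QU_eqI[of r d fid] by (simp add: IA_def Tpos_GLF)

lemma IA_fmul_Tpos:
  assumes "g \<in> GLF d" "r \<in> Tpos d"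
  shows "IA d (g \<otimes> r) = IA d g + IA d r"
proof -
  let ?q = "fadj (QU d g) \<otimes> g"
  have q: "?q \<in> Tpos d" using QU_props[OF assms(1)] by simp
  have "(?q \<otimes> r)$j$j = ?q$j$j \<odot> r$j$j" for j
    by (rule utri_fmul_diag) (use q assms in \<open>auto simp: Tpos_utri\<close>)
  then have diag: "qre ((?q \<otimes> r)$j$j) = qre (?q$j$j) * qre (r$j$j)" for j
    using Tpos_diag[OF q, of j] Tpos_diag[OF assms(2), of j]
    by (metis qmult_qreal_left scaleR_qreal qreal_nth)
  have "IA d (g \<otimes> r) $ j = ln (qre ((?q \<otimes> r)$j$j))" for j
    using assms by (simp add: IA_def QU_fmul_Tpos[OF assms] fmul_assoc GLF_fmul Tpos_GLF)
  also have "\<dots> j = ln (qre (?q$j$j)) + ln (qre (r$j$j))" for j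
    unfolding diag using Tpos_pos[OF q, of j] Tpos_pos[OF assms(2), of j] by (rule ln_mult_pos)
  finally show ?thesis
    using assms by (simp add: vec_eq_iff IA_Tpos[OF assms(2)]) (simp add: IA_def)
qed

text \<open>Writing h as \<open>QU d h\<close> times a triangular factor, that factor can be
  stripped off on the right, where \<open>IA d\<close> is additive; what remains depends on h only
  through its unitary part.\<close>

lemma IA_fmul:
  assumes "g \<in> GLF d" "h \<in> GLF d"
  shows "IA d (g \<otimes> h) = IA d (g \<otimes> QU d h) + IA d h"
proof -
  let ?r = "fadj (QU d h) \<otimes> h"
  have r: "?r \<in> Tpos d" using QU_props[OF assms(2)] by simp
  have "g \<otimes> h = (g \<otimes> QU d h) \<otimes> ?r" by (simp add: fmul_assoc UF_cancel_left(2)[OF QU_UF])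
  also have "IA d \<dots> = IA d (g \<otimes> QU d h) + IA d ?r"
    using r assms by (intro IA_fmul_Tpos) (simp_all add: GLF_fmul UF_GLF)
  also have "IA d ?r = IA d h"
    using assms by (intro IA_UF_fmul) (auto intro: UF_fadj)
  finally show ?thesis .
qed

section \<open>The singular value decomposition\<close>

text \<open>A decomposition is found by maximising \<open>Re tr (D u g v)\<close> over unitary \<open>u, v\<close>, where
  \<open>D\<close> is a diagonal matrix with strictly decreasing positive weights.\<close>

definition wt :: "('n::{finite,linorder}) \<Rightarrow> real" where
  "wt i = real (CARD('n) - pos i)"

lemma wt_pos: "wt i > 0"
  using pos_less_card[of i] by (simp add: wt_def)

lemma wt_less_iff: "wt i < wt j \<longleftrightarrow> j < i"
  using pos_less_card[of i] pos_less_card[of j] pos_less_iff[of j i] by (auto simp: wt_def)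

lemma ftr_fdiag_fmul: "ftr (fdiag a \<otimes> h) = (\<Sum>i\<in>UNIV. a i * qre (h$i$i))"
  by (simp add: ftr_def fdiag_fmul_nth)

lemma sum_split_two:
  fixes f :: "'a::finite \<Rightarrow> 'b::comm_monoid_add"
  assumes "i \<noteq> j"
  shows "sum f UNIV = f i + f j + sum f (UNIV - {i, j})"
proof -
  have "sum f UNIV = sum f (UNIV - {i, j}) + sum f {i, j}"
    by (rule sum.subset_diff) auto
  then show ?thesis using assms by (simp add: add_ac)
qed

text \<open>Rotating by \<open>prot i j c b\<close> changes the weighted trace only in the terms i
  and j, where it becomes c times the old value plus the real part of b times
  \<open>a i *\<^sub>R h$j$i - a j *\<^sub>R qconj (h$i$j)\<close>.
  \<open>rotation_stationary\<close> applies to this expression.\<close>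

lemma trace_stationary:
  fixes h :: "('n::{finite,linorder}) fmat"
  assumes h: "h \<in> Mat d" and max: "\<And>w. w \<in> UF d \<Longrightarrow> ftr (fdiag a \<otimes> (w \<otimes> h)) \<le> ftr (fdiag a \<otimes> h)"
    and ij: "i \<noteq> j"
  shows "a i *\<^sub>R h$j$i = a j *\<^sub>R qconj (h$i$j)"
proof -
  have "a i *\<^sub>R h$j$i - a j *\<^sub>R qconj (h$i$j) = 0"
  proof (rule rotation_stationary[of _ d])
    show "a i *\<^sub>R h$j$i - a j *\<^sub>R qconj (h$i$j) \<in> Fld d"
      by (intro Fld_diff Fld_scaleR Fld_qconj Mat_nth[OF h])
    fix c b assume b: "b \<in> Fld d" "c\<^sup>2 + (norm b)\<^sup>2 = 1"
    have "(\<Sum>k\<in>UNIV. a k * qre ((prot i j c b \<otimes> h)$k$k)) \<le> (\<Sum>k\<in>UNIV. a k * qre (h$k$k))"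
      using max[OF prot_UF[OF ij b]] by (simp add: ftr_fdiag_fmul)
    moreover have "(\<Sum>k\<in>UNIV-{i,j}. a k * qre ((prot i j c b \<otimes> h)$k$k))
        = (\<Sum>k\<in>UNIV-{i,j}. a k * qre (h$k$k))"
      by (intro sum.cong) (auto simp: prot_fmul_nth[OF ij])
    moreover have "qre (qconj b \<odot> h$i$j) = qre (b \<odot> qconj (h$i$j))"
      by (simp add: qmult_nth)
    ultimately show "c * (a i * qre (h$i$i) + a j * qre (h$j$j))
        + qre (b \<odot> (a i *\<^sub>R h$j$i - a j *\<^sub>R qconj (h$i$j))) \<le> a i * qre (h$i$i) + a j * qre (h$j$j)"
      unfolding sum_split_two[OF ij] using ij
      by (simp add: prot_fmul_nth qmult.diff_right qmult.scaleR_right algebra_simps)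
  qed
  then show ?thesis by simp
qed

lemma svd_exists:
  fixes g :: "('n::{finite,linorder}) fmat"
  assumes g: "g \<in> GLF d"
  shows "\<exists>t\<in>CqA. \<exists>u\<in>UF d. \<exists>v\<in>UF d. g = u \<otimes> (ediag t \<otimes> v)"
proof -
  let ?D = "fdiag wt :: 'n fmat"
  let ?f = "\<lambda>(u, v). ftr (?D \<otimes> (u \<otimes> g \<otimes> v))"
  have "compact (UF d \<times> UF d :: ('n fmat \<times> 'n fmat) set)" by (intro compact_Times compact_UF)
  moreover have "(fid, fid) \<in> UF d \<times> (UF d :: 'n fmat set)" by simp
  moreover have "continuous_on (UF d \<times> UF d) ?f"
    unfolding case_prod_beta by (intro continuous_intros)
  ultimately have "\<exists>p\<in>UF d \<times> UF d. \<forall>p'\<in>UF d \<times> UF d. ?f p' \<le> ?f p"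
    by (intro continuous_attains_sup) blast+
  then obtain u v where u: "u \<in> UF d" and v: "v \<in> UF d"
    and max: "\<And>u' v'. u' \<in> UF d \<Longrightarrow> v' \<in> UF d \<Longrightarrow>
      ftr (?D \<otimes> (u' \<otimes> g \<otimes> v')) \<le> ftr (?D \<otimes> (u \<otimes> g \<otimes> v))"
    by auto
  define h where "h = u \<otimes> g \<otimes> v"
  have hGL: "h \<in> GLF d" unfolding h_def using u v g by (simp add: GLF_fmul UF_GLF)
  then have h: "h \<in> Mat d" by (rule GLF_imp_Mat)
  have max2: "ftr (?D \<otimes> (w \<otimes> h \<otimes> w')) \<le> ftr (?D \<otimes> h)" if "w \<in> UF d" "w' \<in> UF d" for w w'
    using max[OF UF_fmul[OF that(1) u] UF_fmul[OF v that(2)]] by (simp add: h_def fmul_assoc)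
  have maxl: "ftr (?D \<otimes> (w \<otimes> h)) \<le> ftr (?D \<otimes> h)" if "w \<in> UF d" for w
    using max2[OF that UF_fid] by simp
  have adj: "ftr (?D \<otimes> fadj m) = ftr (?D \<otimes> m)" for m
    using ftr_fadj[of "m \<otimes> ?D"] by (simp add: fadj_fmul ftr_fmul_commute[of m])
  \<comment> \<open>Maximality under right multiplication becomes maximality under left
    multiplication for the adjoint, since the weight matrix is real and diagonal.\<close>
  have maxr: "ftr (?D \<otimes> (w \<otimes> fadj h)) \<le> ftr (?D \<otimes> fadj h)" if "w \<in> UF d" for w
    using max2[OF UF_fid UF_fadj[OF that]] adj[of "h \<otimes> fadj w"] adj[of h] by (simp add: fadj_fmul)
  have off: "h$j$i = 0" if ij: "i \<noteq> j" for i j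
  proof -
    \<comment> \<open>The stationarity relations for h and for its adjoint combine to
      \<open>(wt i)\<^sup>2\<close> and \<open>(wt j)\<^sup>2\<close> acting equally on
      \<open>h$j$i\<close>; distinct positive weights force the entry to vanish.\<close>
    have 1: "wt i *\<^sub>R h$j$i = wt j *\<^sub>R qconj (h$i$j)"
      by (rule trace_stationary[OF h maxl ij])
    have 2: "wt i *\<^sub>R qconj (h$i$j) = wt j *\<^sub>R h$j$i"
      using trace_stationary[OF Mat_fadj[OF h] maxr ij] by simp
    have "(wt i * wt i) *\<^sub>R h$j$i = wt i *\<^sub>R (wt j *\<^sub>R qconj (h$i$j))"
      by (simp only: 1[symmetric] scaleR_scaleR)
    also have "\<dots> = wt j *\<^sub>R (wt i *\<^sub>R qconj (h$i$j))"
      by (simp add: mult.commute)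
    also have "\<dots> = (wt j * wt j) *\<^sub>R h$j$i"
      by (simp only: 2 scaleR_scaleR)
    finally have "h$j$i = 0 \<or> wt i * wt i = wt j * wt j"
      by (metis scaleR_right_imp_eq)
    moreover have "wt i * wt i \<noteq> wt j * wt j"
      using wt_pos[of i] wt_pos[of j] wt_less_iff[of i j] wt_less_iff[of j i] ij
      unfolding square_eq_iff by (cases i j rule: linorder_cases) auto
    ultimately show ?thesis by blast
  qed
  have diag: "h$i$i = qreal (norm (h$i$i))" for i
  proof (rule phase_stationary[of _ d])
    fix b assume b: "b \<in> Fld d" "norm b = 1"
    have "(\<Sum>k\<in>UNIV. wt k * qre ((phase i b \<otimes> h)$k$k)) \<le> (\<Sum>k\<in>UNIV. wt k * qre (h$k$k))"
      using maxl[OF phase_UF[OF b]] by (simp add: ftr_fdiag_fmul)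
    moreover have "(\<Sum>k\<in>UNIV-{i}. wt k * qre ((phase i b \<otimes> h)$k$k))
        = (\<Sum>k\<in>UNIV-{i}. wt k * qre (h$k$k))"
      by (intro sum.cong) (auto simp: phase_fmul_nth)
    ultimately have "wt i * qre (b \<odot> h$i$i) \<le> wt i * qre (h$i$i)"
      by (simp add: sum.remove[of UNIV i] phase_fmul_nth)
    then show "qre (b \<odot> h$i$i) \<le> qre (h$i$i)"
      using wt_pos[of i] by simp
  qed (rule Mat_nth[OF h])
  define \<sigma> where "\<sigma> i = norm (h$i$i)" for i
  have hd: "h = fdiag \<sigma>"
    using off diag by (auto simp: fmat_eq_iff fdiag_nth \<sigma>_def)
  have \<sigma>_pos: "\<sigma> i > 0" for i
    using GLF_utri_diag_nonzero[OF hGL, of i] off by (simp add: utri_def \<sigma>_def)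
  have \<sigma>_mono: "\<sigma> j \<le> \<sigma> i" if "i < j" for i j
  proof -
    have ij: "i \<noteq> j" using that by simp
    \<comment> \<open>Conjugating by this signed transposition swaps two diagonal entries of h. By
      the rearrangement inequality an increasing pair would enlarge the trace against the decreasing
      weights.\<close>
    let ?w = "prot i j 0 (qreal 1) :: 'n fmat"
    have w: "?w \<in> UF d" by (rule prot_UF[OF ij]) simp_all
    have nth: "(?w \<otimes> h \<otimes> fadj ?w)$k$k = (if k = i then qreal (\<sigma> j) else if k = j then qreal (\<sigma> i) else qreal (\<sigma> k))" for k
    proof -
      have "(?w \<otimes> h \<otimes> fadj ?w)$k$k = (\<Sum>l\<in>UNIV. \<sigma> l *\<^sub>R (?w$k$l \<odot> qconj (?w$k$l)))"
        unfolding fmul_nth[of "?w \<otimes> h"] by (simp add: hd fmul_fdiag_nth qmult.scaleR_left)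
      also have "\<dots> = (\<Sum>l\<in>UNIV. if (k = i \<and> l = j) \<or> (k = j \<and> l = i) \<or> (k \<noteq> i \<and> k \<noteq> j \<and> k = l)
          then qreal (\<sigma> l) else 0)"
        using ij by (intro sum.cong) (auto simp: prot_def qmult_qconj_right qconj_minus qmult.minus_left qmult.minus_right)
      also have "\<dots> = (\<Sum>l\<in>UNIV. if l = (if k = i then j else if k = j then i else k)
          then qreal (\<sigma> l) else 0)"
        using ij by (intro sum.cong) auto
      finally show ?thesis using ij by simp
    qed
    have "(\<Sum>k\<in>UNIV. wt k * qre ((?w \<otimes> h \<otimes> fadj ?w)$k$k)) \<le> (\<Sum>k\<in>UNIV. wt k * qre (h$k$k))"
      using max2[OF w UF_fadj[OF w]] by (simp add: ftr_fdiag_fmul)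
    moreover have "(\<Sum>k\<in>UNIV-{i,j}. wt k * qre ((?w \<otimes> h \<otimes> fadj ?w)$k$k))
        = (\<Sum>k\<in>UNIV-{i,j}. wt k * qre (h$k$k))"
      unfolding nth by (intro sum.cong) (auto simp: hd fdiag_nth)
    ultimately have "wt i * \<sigma> j + wt j * \<sigma> i \<le> wt i * \<sigma> i + wt j * \<sigma> j"
      unfolding sum_split_two[OF ij] nth using ij by (simp add: hd fdiag_nth)
    then have "(wt i - wt j) * (\<sigma> j - \<sigma> i) \<le> 0" by (simp add: algebra_simps)
    moreover have "wt i - wt j > 0" using that wt_less_iff[of j i] by simp
    ultimately show ?thesis by (simp add: mult_le_0_iff)
  qed
  define t :: "(real, 'n) vec" where "t = (\<chi> i. ln (\<sigma> i))"
  have "t \<in> CqA"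
    unfolding CqA_def using \<sigma>_mono \<sigma>_pos by (auto simp: t_def le_less)
  moreover have "h = ediag t"
    unfolding hd using \<sigma>_pos by (simp add: ediag_eq_fdiag t_def)
  moreover have "g = fadj u \<otimes> (h \<otimes> fadj v)"
    using u v by (simp add: h_def fmul_assoc)
  ultimately have "g = fadj u \<otimes> (ediag t \<otimes> fadj v)" by simp
  then show ?thesis
    using \<open>t \<in> CqA\<close> UF_fadj[OF u] UF_fadj[OF v] by (intro bexI)
qed

text \<open>Squaring eliminates v:
  \<open>ediag (s + s) \<otimes> u = u \<otimes> ediag (t + t)\<close>, so \<open>u$k$j\<close> can
  be nonzero only if \<open>s$k = t$j\<close>. Were \<open>t$i < s$i\<close>, the rows
  \<open>k \<le> i\<close> of u would live in the columns \<open>j < i\<close>; summing squared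
  norms over this block by rows and by columns would fit more orthonormal rows than there are
  columns.\<close>

lemma svd_le:
  fixes s t :: "(real, 'n::{finite,linorder}) vec"
  assumes s: "s \<in> CqA" and t: "t \<in> CqA" and uv: "u \<in> UF d" "v \<in> UF d"
    and eq: "ediag s = u \<otimes> (ediag t \<otimes> v)"
  shows "s$i \<le> t$i"
proof (rule ccontr)
  assume "\<not> s$i \<le> t$i"
  then have lt: "t$i < s$i" by simp
  have eq': "ediag s = fadj v \<otimes> (ediag t \<otimes> fadj u)"
    using arg_cong[OF eq, of fadj] by (simp add: fadj_fmul fmul_assoc)
  have "ediag s \<otimes> ediag s = (u \<otimes> (ediag t \<otimes> v)) \<otimes> (fadj v \<otimes> (ediag t \<otimes> fadj u))"
    by (simp only: eq[symmetric] eq'[symmetric])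
  also have "\<dots> = u \<otimes> (ediag t \<otimes> ediag t) \<otimes> fadj u"
    using uv by (simp add: fmul_assoc)
  finally have "ediag (s + s) = u \<otimes> ediag (t + t) \<otimes> fadj u"
    by (simp add: ediag_fmul_ediag)
  then have "ediag (s + s) \<otimes> u = u \<otimes> ediag (t + t)"
    using uv by (simp add: fmul_assoc)
  then have "exp (s$k + s$k) *\<^sub>R u$k$j = exp (t$j + t$j) *\<^sub>R u$k$j" for k j
    by (metis ediag_fmul_nth fmul_ediag_nth vector_add_component)
  then have nz: "u$k$j = 0 \<or> s$k = t$j" for k j
    by (smt (verit) exp_inj_iff scaleR_cancel_right)
  have row: "(\<Sum>j\<in>{j. j < i}. (norm (u$k$j))\<^sup>2) = 1" if "k \<le> i" for k
  proof -
    have "(norm (u$k$j))\<^sup>2 = 0" if "j \<notin> {j. j < i}" for j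
    proof -
      have "t$j \<le> t$i" using t that by (simp add: CqA_def)
      moreover have "s$i \<le> s$k" using s \<open>k \<le> i\<close> by (simp add: CqA_def)
      ultimately show ?thesis using nz[of k j] lt by auto
    qed
    then have "(\<Sum>j\<in>{j. j < i}. (norm (u$k$j))\<^sup>2) = (\<Sum>j\<in>UNIV. (norm (u$k$j))\<^sup>2)"
      by (intro sum.mono_neutral_left) auto
    then show ?thesis using UF_row_norm uv by metis
  qed
  have "real (card {k. k \<le> i}) = (\<Sum>k\<in>{k. k \<le> i}. \<Sum>j\<in>{j. j < i}. (norm (u$k$j))\<^sup>2)"
    by (simp add: row)
  also have "\<dots> = (\<Sum>j\<in>{j. j < i}. \<Sum>k\<in>{k. k \<le> i}. (norm (u$k$j))\<^sup>2)"
    by (rule sum.swap)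
  also have "\<dots> \<le> (\<Sum>j\<in>{j. j < i}. \<Sum>k\<in>UNIV. (norm (u$k$j))\<^sup>2)"
    by (intro sum_mono sum_mono2) auto
  also have "\<dots> = real (card {j. j < i})"
    using uv by (simp add: UF_column_norm)
  finally have "card {k. k \<le> i} \<le> card {j. j < i}" by simp
  moreover have "card {j. j < i} < card {k. k \<le> i}"
    by (intro psubset_card_mono) auto
  ultimately show False by simp
qed

lemma svd_unique:
  assumes "s \<in> CqA" "t \<in> CqA" "u \<in> UF d" "v \<in> UF d" "u' \<in> UF d" "v' \<in> UF d"
    and eq: "u \<otimes> (ediag s \<otimes> v) = u' \<otimes> (ediag t \<otimes> v')"
  shows "s = t"
proof -
  have *: "ediag s = (fadj u \<otimes> u') \<otimes> (ediag t \<otimes> (v' \<otimes> fadj v))"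
    if "u \<in> UF d" "v \<in> UF d" and "u \<otimes> (ediag s \<otimes> v) = u' \<otimes> (ediag t \<otimes> v')" for s t :: "(real, 'a) vec" and u v u' v'
  proof -
    have "fadj u \<otimes> (u \<otimes> (ediag s \<otimes> v)) \<otimes> fadj v = fadj u \<otimes> (u' \<otimes> (ediag t \<otimes> v')) \<otimes> fadj v"
      by (simp only: that(3))
    then show ?thesis using that(1,2) by (simp add: fmul_assoc)
  qed
  have "s$i \<le> t$i" for i
    by (rule svd_le[OF _ _ _ _ *[OF _ _ eq]]) (use assms in \<open>auto intro: UF_fmul UF_fadj\<close>)
  moreover have "t$i \<le> s$i" for i
    by (rule svd_le[OF _ _ _ _ *[OF _ _ eq[symmetric]]]) (use assms in \<open>auto intro: UF_fmul UF_fadj\<close>)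
  ultimately show ?thesis by (simp add: vec_eq_iff order_antisym)
qed

lemma ln_sing_eqI:
  assumes "t \<in> CqA" "u \<in> UF d" "v \<in> UF d"
  shows "ln_sing d (u \<otimes> (ediag t \<otimes> v)) = t"
  unfolding ln_sing_def
  by (rule the_equality) (use assms svd_unique in blast)+

lemma ln_sing_svd:
  assumes "g \<in> GLF d"
  obtains u v where "u \<in> UF d" "v \<in> UF d" "g = u \<otimes> (ediag (ln_sing d g) \<otimes> v)" "ln_sing d g \<in> CqA"
  using svd_exists[OF assms] ln_sing_eqI by metis

lemma ln_sing_fmul_UF:
  assumes "g \<in> GLF d" "u \<in> UF d"
  shows "ln_sing d (g \<otimes> u) = ln_sing d g"
proof -
  obtain w v where "w \<in> UF d" "v \<in> UF d" and eq: "g = w \<otimes> (ediag (ln_sing d g) \<otimes> v)" "ln_sing d g \<in> CqA"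
    using ln_sing_svd[OF assms(1)] .
  then have "ln_sing d (w \<otimes> (ediag (ln_sing d g) \<otimes> (v \<otimes> u))) = ln_sing d g"
    using assms by (intro ln_sing_eqI) (auto intro: UF_fmul)
  then show ?thesis by (subst eq(1)) (simp add: fmul_assoc)
qed

section \<open>Continuity and measurability of the decompositions\<close>

text \<open>A map into a compact space is continuous if its graph is closed, here relative to
  \<open>GLF d \<times> UF d\<close>.\<close>

lemma continuous_on_QU:
  "continuous_on (GLF d) (QU d :: ('n::{finite,linorder}) fmat \<Rightarrow> _)"
proof -
  \<comment> \<open>Positivity of the diagonal is not a closed condition, so T only asks for
    nonnegativity. On invertible triangular matrices the two agree, as no diagonal entry is
    zero.\<close>
  define T where "T = {r :: 'n fmat. (\<forall>i j. j < i \<longrightarrow> r$i$j = 0) \<and>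
    (\<forall>i. r$i$i = qreal (qre (r$i$i)) \<and> 0 \<le> qre (r$i$i))}"
  have "T = (\<Inter>i. \<Inter>j. {r. j < i \<longrightarrow> r$i$j = 0}) \<inter>
      (\<Inter>i. {r. r$i$i = qreal (qre (r$i$i))} \<inter> {r. 0 \<le> qre (r$i$i)})"
    by (auto simp: T_def)
  moreover have "closed {r :: 'n fmat. j < i \<longrightarrow> r$i$j = 0}" for i j
    by (cases "j < i") (auto intro!: closed_Collect_eq continuous_intros)
  ultimately have "closed T"
    by (auto intro!: closed_Int closed_INT closed_Collect_eq closed_Collect_le continuous_intros)
  then have cl: "closed ((\<lambda>p :: 'n fmat \<times> 'n fmat. fadj (snd p) \<otimes> fst p) -` T)"
    by (intro closed_vimage) (auto intro!: continuous_intros)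
  have gr: "(\<lambda>g :: 'n fmat. (g, QU d g)) ` GLF d
      = (GLF d \<times> UF d) \<inter> (\<lambda>p. fadj (snd p) \<otimes> fst p) -` T"
  proof (intro set_eqI iffI)
    fix p :: "'n fmat \<times> 'n fmat" assume "p \<in> (\<lambda>g. (g, QU d g)) ` GLF d"
    then obtain g where g: "g \<in> GLF d" "p = (g, QU d g)" by auto
    note r = QU_props(2)[OF g(1)]
    have "fadj (QU d g) \<otimes> g \<in> T"
      using Tpos_utri[OF r] Tpos_diag[OF r] by (auto simp: T_def utri_def less_imp_le)
    then show "p \<in> (GLF d \<times> UF d) \<inter> (\<lambda>p. fadj (snd p) \<otimes> fst p) -` T"
      using g by simp
  next
    fix p :: "'n fmat \<times> 'n fmat" assume p: "p \<in> (GLF d \<times> UF d) \<inter> (\<lambda>p. fadj (snd p) \<otimes> fst p) -` T"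
    obtain g u where gu: "p = (g, u)" by fastforce
    with p have g: "g \<in> GLF d" and u: "u \<in> UF d" and r: "fadj u \<otimes> g \<in> T" by auto
    have rG: "fadj u \<otimes> g \<in> GLF d" using g u by (simp add: GLF_fmul UF_GLF UF_fadj)
    have ut: "utri (fadj u \<otimes> g)" using r by (simp add: T_def utri_def)
    have "\<exists>\<rho>>0. (fadj u \<otimes> g)$i$i = qreal \<rho>" for i
    proof (intro exI conjI)
      show "(fadj u \<otimes> g)$i$i = qreal (qre ((fadj u \<otimes> g)$i$i))"
        using r unfolding T_def by blast
      then have "qre ((fadj u \<otimes> g)$i$i) \<noteq> 0"
        using GLF_utri_diag_nonzero[OF rG ut, of i] by (metis qreal_0)
      moreover have "0 \<le> qre ((fadj u \<otimes> g)$i$i)"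
        using r unfolding T_def by blast
      ultimately show "0 < qre ((fadj u \<otimes> g)$i$i)" by simp
    qed
    then have "fadj u \<otimes> g \<in> Tpos d"
      using ut GLF_imp_Mat[OF rG] by (simp add: Tpos_def)
    then have "QU d g = u" using g u by (intro QU_eqI)
    then show "p \<in> (\<lambda>g. (g, QU d g)) ` GLF d" using g gu by auto
  qed
  have "closedin (top_of_set (GLF d \<times> UF d)) ((\<lambda>g :: 'n fmat. (g, QU d g)) ` GLF d)"
    unfolding gr closedin_closed using cl by blast
  then show ?thesis
    by (intro iffD2[OF continuous_closed_graph_eq[OF compact_UF]]) auto
qed

lemma continuous_on_IA:
  "continuous_on (GLF d) (IA d :: ('n::{finite,linorder}) fmat \<Rightarrow> _)"
proof (rule continuous_on_eq)
  show "continuous_on (GLF d) (\<lambda>g :: 'n fmat. \<chi> j. ln (qre ((fadj (QU d g) \<otimes> g)$j$j)))"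
  proof (intro continuous_on_vec_lambda continuous_on_ln ballI)
    fix j :: 'n
    show "continuous_on (GLF d) (\<lambda>g :: 'n fmat. qre ((fadj (QU d g) \<otimes> g)$j$j))"
      by (intro continuous_intros continuous_on_QU)
    fix g :: "'n fmat" assume "g \<in> GLF d"
    from Tpos_pos[OF QU_props(2)[OF this]] show "qre ((fadj (QU d g) \<otimes> g)$j$j) \<noteq> 0"
      by (metis less_irrefl)
  qed
qed (simp add: IA_def)

section \<open>Compact exhaustion of the general linear group and measurability\<close>

lemma closed_CqA: "closed (CqA :: ((real,'n::{finite,linorder}) vec) set)"
proof -
  have eq: "(CqA :: ((real,'n) vec) set) = (\<Inter>i. \<Inter>j. {t. i \<le> j \<longrightarrow> t$j \<le> t$i})"
    by (auto simp: CqA_def)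
  have "closed {t :: (real,'n) vec. i \<le> j \<longrightarrow> t$j \<le> t$i}" for i j :: 'n
    by (cases "i \<le> j") (auto intro!: closed_Collect_le continuous_intros)
  then show ?thesis unfolding eq by (intro closed_INT ballI)
qed

text \<open>Invertible matrices whose logarithmic singular values have norm at most n. These compact
  sets exhaust \<open>GLF d\<close>; on each of them closed graph arguments give continuity, and
  countably many suffice for measurability.\<close>

definition svd_piece :: "nat \<Rightarrow> nat \<Rightarrow> (('n::{finite,linorder}) fmat) set" where
  "svd_piece d n = (\<lambda>(u, t, v). u \<otimes> (ediag t \<otimes> v)) ` (UF d \<times> (CqA \<inter> cball 0 (real n)) \<times> UF d)"

lemma compact_svd_domain:
  "compact (UF d \<times> (CqA \<inter> cball (0 :: (real,'n::{finite,linorder}) vec) (real n)) \<times> UF d)"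
  by (intro compact_Times compact_UF closed_Int_compact closed_CqA) simp

lemma compact_svd_piece: "compact (svd_piece d n)"
  unfolding svd_piece_def
  by (intro compact_continuous_image compact_svd_domain) (auto simp: case_prod_beta intro!: continuous_intros)

lemma svd_piece_GLF: "svd_piece d n \<subseteq> GLF d"
  by (auto simp: svd_piece_def GLF_fmul UF_GLF)

lemma Union_svd_piece: "(\<Union>n. svd_piece d n) = (GLF d :: ('n::{finite,linorder}) fmat set)"
proof
  show "GLF d \<subseteq> (\<Union>n. svd_piece d n :: 'n fmat set)"
  proof
    fix g :: "'n fmat" assume "g \<in> GLF d"
    then obtain u v where uv: "u \<in> UF d" "v \<in> UF d" and g: "g = u \<otimes> (ediag (ln_sing d g) \<otimes> v)"
      and t: "ln_sing d g \<in> CqA" using ln_sing_svd by blast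
    obtain n where "norm (ln_sing d g) \<le> real n" using real_arch_simple by blast
    with uv t have "(u, ln_sing d g, v) \<in> UF d \<times> (CqA \<inter> cball 0 (real n)) \<times> UF d" by simp
    moreover have "g = (\<lambda>(u, t, v). u \<otimes> (ediag t \<otimes> v)) (u, ln_sing d g, v)" using g by simp
    ultimately show "g \<in> (\<Union>n. svd_piece d n)" unfolding svd_piece_def by blast
  qed
qed (use svd_piece_GLF in blast)

lemma GLF_borel [measurable]: "GLF d \<in> sets (borel :: ('n::{finite,linorder}) fmat measure)"
  unfolding Union_svd_piece[symmetric]
  by (intro sets.countable_UN) (auto intro!: borel_closed compact_imp_closed compact_svd_piece)

lemma UF_borel [measurable]: "UF d \<in> sets borel"
  by (intro borel_closed closed_UF)

text \<open>The graph is a continuous image of the compact parameter set of triples (u, t, v): the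
  factors u and v are not unique, but t is determined by the product.\<close>

lemma continuous_on_ln_sing_piece:
  "continuous_on (svd_piece d n :: ('n::{finite,linorder}) fmat set) (ln_sing d)"
proof (rule continuous_from_closed_graph)
  let ?D = "UF d \<times> (CqA \<inter> cball (0 :: (real,'n) vec) (real n)) \<times> UF d"
  show "compact (CqA \<inter> cball (0 :: (real,'n) vec) (real n))"
    by (intro closed_Int_compact closed_CqA) simp
  show "ln_sing d \<in> svd_piece d n \<rightarrow> CqA \<inter> cball 0 (real n)"
    by (auto simp: svd_piece_def ln_sing_eqI)
  have "(\<lambda>g :: 'n fmat. (g, ln_sing d g)) ` svd_piece d n = (\<lambda>(u, t, v). (u \<otimes> (ediag t \<otimes> v), t)) ` ?D"
    unfolding svd_piece_def image_image by (intro image_cong) (auto simp: ln_sing_eqI)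
  moreover have "compact ((\<lambda>(u, t, v). (u \<otimes> (ediag t \<otimes> v), t)) ` ?D)"
    by (intro compact_continuous_image compact_svd_domain)
      (auto simp: case_prod_beta intro!: continuous_intros)
  ultimately show "closed ((\<lambda>g :: 'n fmat. (g, ln_sing d g)) ` svd_piece d n)"
    by (simp add: compact_imp_closed)
qed

text \<open>Outside \<open>GLF d\<close> the definite description has no witness and returns one
  unspecified value. That it is the same value for every such g is all that measurability
  requires.\<close>

lemma ln_sing_not_GLF:
  fixes g :: "('n::{finite,linorder}) fmat"
  assumes "g \<notin> GLF d"
  shows "ln_sing d g = (THE t. False)"
proof -
  from assms have "(t \<in> CqA \<and> (\<exists>u\<in>UF d. \<exists>v\<in>UF d. g = u \<otimes> (ediag t \<otimes> v))) = False" for t :: "(real,'n) vec"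
    by (auto simp: GLF_fmul UF_GLF)
  then show ?thesis unfolding ln_sing_def by (simp only:)
qed

lemma measurable_if_continuous_on_svd_pieces:
  fixes f :: "('n::{finite,linorder}) fmat \<Rightarrow> 'b::topological_space"
  assumes cont: "\<And>n. continuous_on (svd_piece d n) f" and out: "\<And>g. g \<notin> GLF d \<Longrightarrow> f g = c"
  shows "f \<in> borel_measurable borel"
proof (rule measurable_piecewise_restrict)
  let ?C = "insert (- GLF d) (range (svd_piece d)) :: 'n fmat set set"
  show "countable ?C" by simp
  show "\<Omega> \<inter> space borel \<in> sets borel" if "\<Omega> \<in> ?C" for \<Omega>
    using that by (auto intro: borel_closed compact_imp_closed compact_svd_piece borel_comp GLF_borel)
  show "space borel \<subseteq> \<Union>?C" using Union_svd_piece[of d] by auto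
  show "f \<in> borel_measurable (restrict_space borel \<Omega>)" if \<Omega>: "\<Omega> \<in> ?C" for \<Omega>
  proof (cases "\<Omega> = - GLF d")
    case True
    have "(\<lambda>_. c) \<in> borel_measurable (restrict_space borel \<Omega>)" by simp
    then show ?thesis
      by (rule measurable_cong[THEN iffD1, rotated])
        (simp add: True space_restrict_space out)
  next
    case False
    then obtain n where "\<Omega> = svd_piece d n" using \<Omega> by auto
    then show ?thesis
      by (simp add: borel_measurable_continuous_on_restrict cont)
  qed
qed

lemma measurable_ln_sing [measurable]:
  "ln_sing d \<in> borel_measurable (borel :: ('n::{finite,linorder}) fmat measure)"
  by (rule measurable_if_continuous_on_svd_pieces[OF continuous_on_ln_sing_piece ln_sing_not_GLF])

lemma finv_svd:
  assumes "u \<in> UF d" "v \<in> UF d"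
  shows "finv d (u \<otimes> (ediag t \<otimes> v)) = fadj v \<otimes> (ediag (- t) \<otimes> fadj u)"
proof (rule finv_eqI)
  have "ediag t \<otimes> (ediag (- t) \<otimes> X) = X" for X :: "'a fmat"
    by (simp add: fmul_assoc[symmetric] ediag_fmul_ediag ediag_0)
  then show "u \<otimes> (ediag t \<otimes> v) \<otimes> (fadj v \<otimes> (ediag (- t) \<otimes> fadj u)) = fid"
    using assms by (simp add: fmul_assoc)
qed (use assms in \<open>simp_all add: Mat_fmul Mat_fadj UF_imp_Mat\<close>)

text \<open>The moment functions integrate an expression in \<open>finv d u\<close> over the ambient
  matrix space, so measurability of \<open>finv d\<close> is wanted there. The closed graph argument
  for \<open>ln_sing d\<close> is repeated with the inverse read off from the factors.\<close>

lemma continuous_on_finv_piece: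
  "continuous_on (svd_piece d n :: ('n::{finite,linorder}) fmat set) (finv d)"
proof (rule continuous_from_closed_graph)
  let ?D = "UF d \<times> (CqA \<inter> cball (0 :: (real,'n) vec) (real n)) \<times> UF d"
  let ?inv = "\<lambda>(u, t, v). fadj v \<otimes> (ediag (- t) \<otimes> fadj u)"
  show "compact (?inv ` ?D)"
    by (intro compact_continuous_image compact_svd_domain)
      (auto simp: case_prod_beta intro!: continuous_intros)
  show "finv d \<in> svd_piece d n \<rightarrow> ?inv ` ?D"
  proof
    fix g :: "'n fmat" assume "g \<in> svd_piece d n"
    then obtain p where p: "p \<in> ?D" "g = (\<lambda>(u, t, v). u \<otimes> (ediag t \<otimes> v)) p"
      unfolding svd_piece_def by blast
    then have "finv d g = ?inv p" by (auto simp: finv_svd)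
    with p show "finv d g \<in> ?inv ` ?D" by blast
  qed
  have "(\<lambda>g :: 'n fmat. (g, finv d g)) ` svd_piece d n = (\<lambda>(u, t, v). (u \<otimes> (ediag t \<otimes> v), ?inv (u, t, v))) ` ?D"
    unfolding svd_piece_def image_image by (intro image_cong) (auto simp: finv_svd)
  moreover have "compact ((\<lambda>(u, t, v). (u \<otimes> (ediag t \<otimes> v), ?inv (u, t, v))) ` ?D)"
    by (intro compact_continuous_image compact_svd_domain)
      (auto simp: case_prod_beta intro!: continuous_intros)
  ultimately show "closed ((\<lambda>g :: 'n fmat. (g, finv d g)) ` svd_piece d n)"
    by (simp add: compact_imp_closed)
qed

lemma measurable_finv [measurable]:
  "finv d \<in> borel_measurable (borel :: ('n::{finite,linorder}) fmat measure)"
proof (rule measurable_if_continuous_on_svd_pieces[OF continuous_on_finv_piece])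
  fix g :: "'n fmat" assume g: "g \<notin> GLF d"
  have "(B \<in> Mat d \<and> g \<otimes> B = fid \<and> B \<otimes> g = fid) = False" for B
  proof -
    \<comment> \<open>The entries of g are not known to lie in F. The inverse B has entries in F and
      is injective on \<open>Mat d\<close>, hence has an inverse C in \<open>Mat d\<close>, and C
      must be g.\<close>
    have "g \<in> GLF d" if B: "B \<in> Mat d" "g \<otimes> B = fid" "B \<otimes> g = fid"
    proof -
      have "B \<in> GLF d"
      proof (rule GLF_if_inj[OF B(1)])
        fix X assume "B \<otimes> X = 0"
        then have "g \<otimes> B \<otimes> X = 0" by (simp add: fmul_assoc fmul.zero_right)
        then show "X = 0" using B by simp
      qed
      then obtain C where C: "C \<in> Mat d" "B \<otimes> C = fid" by (auto simp: GLF_def)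
      have "g = g \<otimes> (B \<otimes> C)" using C by simp
      also have "\<dots> = C" using B by (simp add: fmul_assoc[symmetric])
      finally have "g = C" .
      then show ?thesis using B C by (intro GLFI[of g d B]) auto
    qed
    then show ?thesis using g by blast
  qed
  then show "finv d g = (THE B. False)" unfolding finv_def by (simp only:)
qed

lemma measurable_QU [measurable]:
  "QU d \<in> borel_measurable (borel :: ('n::{finite,linorder}) fmat measure)"
proof -
  have "(\<lambda>g :: 'n fmat. if g \<in> GLF d then QU d g else fid) \<in> borel_measurable borel"
    by (intro borel_measurable_continuous_on_if) (auto intro: continuous_on_QU)
  moreover have "(\<lambda>g :: 'n fmat. if g \<in> GLF d then QU d g else fid) = QU d"
    by (auto simp: QU_def)
  ultimately show ?thesis by simp
qed

lemma measurable_fmul [measurable]: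
  assumes "f \<in> borel_measurable M" "g \<in> borel_measurable M"
  shows "(\<lambda>x. f x \<otimes> g x) \<in> borel_measurable M"
proof -
  have "continuous_on UNIV (\<lambda>p. fst p \<otimes> snd p)" by (intro continuous_intros)
  from borel_measurable_continuous_Pair[OF assms this] show ?thesis by simp
qed

lemma measurable_fadj [measurable]:
  assumes "f \<in> borel_measurable M"
  shows "(\<lambda>x. fadj (f x)) \<in> borel_measurable M"
  by (rule borel_measurable_continuous_on[OF _ assms, of fadj]) (intro continuous_intros)

lemma measurable_ediag [measurable]:
  assumes "f \<in> borel_measurable M"
  shows "(\<lambda>x. ediag (f x)) \<in> borel_measurable M"
  by (rule borel_measurable_continuous_on[OF _ assms, of ediag]) (intro continuous_intros)

lemma measurable_IA [measurable]:
  "IA d \<in> borel_measurable (borel :: ('n::{finite,linorder}) fmat measure)"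
proof -
  have "(\<lambda>g :: 'n fmat. if g \<in> GLF d then IA d g else 0) \<in> borel_measurable borel"
    by (intro borel_measurable_continuous_on_if) (auto intro: continuous_on_IA)
  moreover have "(\<lambda>g :: 'n fmat. if g \<in> GLF d then IA d g else 0) = IA d"
    by (auto simp: IA_def)
  ultimately show ?thesis by simp
qed

section \<open>The Iwasawa component is dominated by the singular values\<close>

lemma fadj_fmul_diag: "(fadj A \<otimes> A)$j$j = qreal (\<Sum>i\<in>UNIV. (norm (A$i$j))\<^sup>2)"
proof -
  have "qreal (\<Sum>i\<in>UNIV. f i) = (\<Sum>i\<in>UNIV. qreal (f i))" for f :: "'a \<Rightarrow> real"
    by (simp add: quat_eq_iff)
  then show ?thesis by (simp add: fmul_nth qmult_qconj_left)
qed

lemma ediag_UF_column_bound: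
  fixes t :: "(real,'n::{finite,linorder}) vec"
  assumes v: "v \<in> UF d"
  shows "(\<Sum>i\<in>UNIV. (norm ((ediag t \<otimes> v)$i$j))\<^sup>2) \<le> (exp (norm t))\<^sup>2"
proof -
  have "(norm ((ediag t \<otimes> v)$i$j))\<^sup>2 \<le> (exp (norm t))\<^sup>2 * (norm (v$i$j))\<^sup>2" for i
  proof -
    have "t$i \<le> norm t" using component_le_norm_cart[of t i] by simp
    then have "exp (t$i) * norm (v$i$j) \<le> exp (norm t) * norm (v$i$j)"
      by (intro mult_right_mono) auto
    then show ?thesis
      unfolding power_mult_distrib[symmetric] by (intro power_mono) (auto simp: ediag_fmul_nth)
  qed
  then have "(\<Sum>i\<in>UNIV. (norm ((ediag t \<otimes> v)$i$j))\<^sup>2) \<le> (\<Sum>i\<in>UNIV. (exp (norm t))\<^sup>2 * (norm (v$i$j))\<^sup>2)"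
    by (intro sum_mono)
  then show ?thesis
    by (simp add: sum_distrib_left[symmetric] UF_column_norm[OF v])
qed

text \<open>The left factor u preserves the norms of columns and the columns of v are unit vectors,
  so only the diagonal factor can enlarge a column, by at most \<open>exp (norm t)\<close>.\<close>

lemma norm_diag_UF_ediag_UF:
  fixes t :: "(real,'n::{finite,linorder}) vec"
  assumes "u \<in> UF d" "v \<in> UF d"
  shows "norm ((u \<otimes> (ediag t \<otimes> v))$j$j) \<le> exp (norm t)"
proof -
  let ?A = "u \<otimes> (ediag t \<otimes> v)" and ?B = "ediag t \<otimes> v"
  have "fadj ?A \<otimes> ?A = fadj ?B \<otimes> ?B"
    using assms by (simp add: fadj_fmul fmul_assoc)
  then have "(\<Sum>i\<in>UNIV. (norm (?A$i$j))\<^sup>2) = (\<Sum>i\<in>UNIV. (norm (?B$i$j))\<^sup>2)"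
    using fadj_fmul_diag[of ?A j] fadj_fmul_diag[of ?B j] by simp
  moreover have "(norm (?A$j$j))\<^sup>2 \<le> (\<Sum>i\<in>UNIV. (norm (?A$i$j))\<^sup>2)"
    by (rule member_le_sum) auto
  ultimately have "(norm (?A$j$j))\<^sup>2 \<le> (exp (norm t))\<^sup>2"
    using ediag_UF_column_bound[OF assms(2), of t j] by linarith
  then show ?thesis by (rule power2_le_imp_le) simp
qed

text \<open>The triangular factor and its inverse both have the form unitary, exponential, unitary,
  with t and \<open>- t\<close> in the middle, so both diagonals are bounded by
  \<open>exp (norm t)\<close>. Reciprocity of the two diagonals gives the lower bound. This
  domination transfers the second moments of the singular values to \<open>IA d\<close>.\<close>

lemma abs_IA_le_norm_ln_sing:
  assumes g: "g \<in> GLF d"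
  shows "\<bar>IA d g $ j\<bar> \<le> norm (ln_sing d g)"
proof -
  define t where "t = ln_sing d g"
  obtain u v where uv: "u \<in> UF d" "v \<in> UF d" and eq: "g = u \<otimes> (ediag t \<otimes> v)"
    using ln_sing_svd[OF g] t_def by metis
  let ?r = "fadj (QU d g) \<otimes> g"
  \<comment> \<open>The inverse of \<open>?r\<close>, assembled from the singular value factors of
    g.\<close>
  let ?s = "fadj v \<otimes> (ediag (- t) \<otimes> (fadj u \<otimes> QU d g))"
  define \<rho> where "\<rho> = qre (?r$j$j)"
  note r = QU_props(2)[OF g]
  have \<rho>: "\<rho> > 0" "?r$j$j = qreal \<rho>" using Tpos_diag[OF r, of j] by (auto simp: \<rho>_def)
  have "?r = fadj (QU d g) \<otimes> u \<otimes> (ediag t \<otimes> v)"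
    by (subst (2) eq) (simp add: fmul_assoc)
  then have "norm (?r$j$j) \<le> exp (norm t)"
    using norm_diag_UF_ediag_UF[of "fadj (QU d g) \<otimes> u" d v t j] uv by (simp add: UF_fmul UF_fadj)
  then have up: "\<rho> \<le> exp (norm t)" using \<rho> by simp
  have gi: "fadj u \<otimes> g = ediag t \<otimes> v"
    using arg_cong[OF eq, of "\<lambda>x. fadj u \<otimes> x"] uv by simp
  have "?s \<otimes> ?r = fadj v \<otimes> (ediag (- t) \<otimes> (fadj u \<otimes> g))"
    by (simp add: fmul_assoc UF_cancel_left(2)[OF QU_UF])
  also have "\<dots> = fadj v \<otimes> (ediag (- t) \<otimes> ediag t \<otimes> v)"
    unfolding gi by (simp add: fmul_assoc)
  also have "\<dots> = fid" using uv by (simp add: ediag_fmul_ediag ediag_0)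
  finally have sr: "?s \<otimes> ?r = fid" .
  have "utri ?s"
    by (rule utri_left_quotient[OF Tpos_utri[OF r]]) (simp_all only: sr, simp_all add: utri_def fid_nth)
  from utri_fmul_diag[OF this Tpos_utri[OF r], of j] sr
  have "\<rho> *\<^sub>R ?s$j$j = qreal 1" by (simp add: \<rho> fid_nth)
  then have "norm (\<rho> *\<^sub>R ?s$j$j) = 1" by simp
  then have "1 = \<rho> * norm (?s$j$j)" using \<rho> by simp
  also have "\<dots> \<le> \<rho> * exp (norm t)"
    using norm_diag_UF_ediag_UF[of "fadj v" d "fadj u \<otimes> QU d g" "- t" j] uv \<rho>
    by (intro mult_left_mono) (auto simp: UF_fmul UF_fadj)
  finally have "exp (- norm t) \<le> \<rho>" by (simp add: exp_minus field_simps)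
  with up \<rho> have "- norm t \<le> ln \<rho>" "ln \<rho> \<le> norm t"
    by (metis ln_exp ln_le_cancel_iff exp_gt_zero)+
  then show ?thesis using g by (simp add: IA_def \<rho>_def t_def)
qed

section \<open>LU decomposition of generic unitary matrices\<close>

definition fapp :: "('n::finite) fmat \<Rightarrow> quat^'n \<Rightarrow> quat^'n" where
  "fapp A x = (\<chi> i. \<Sum>k\<in>UNIV. A$i$k \<odot> x$k)"

text \<open>Scalars act from the right, so that they commute with matrices acting from the left;
  linear independence over noncommuting scalars is understood in this right module.\<close>

definition vscale :: "quat^'n \<Rightarrow> quat \<Rightarrow> quat^('n::finite)" where
  "vscale x c = (\<chi> i. x$i \<odot> c)"

lemma fapp_nth: "fapp A x $ i = (\<Sum>k\<in>UNIV. A$i$k \<odot> x$k)"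
  by (simp add: fapp_def)

lemma vscale_nth [simp]: "vscale x c $ i = x$i \<odot> c"
  by (simp add: vscale_def)

lemma fapp_fmul: "fapp (A \<otimes> B) x = fapp A (fapp B x)"
proof -
  have "fapp (A \<otimes> B) x $ i = fapp A (fapp B x) $ i" for i
  proof -
    have "fapp (A \<otimes> B) x $ i = (\<Sum>k\<in>UNIV. \<Sum>l\<in>UNIV. A$i$l \<odot> B$l$k \<odot> x$k)"
      by (simp add: fapp_nth fmul_nth qmult.sum_left)
    also have "\<dots> = (\<Sum>l\<in>UNIV. \<Sum>k\<in>UNIV. A$i$l \<odot> B$l$k \<odot> x$k)"
      by (rule sum.swap)
    finally show ?thesis
      by (simp add: fapp_nth qmult.sum_right qmult_assoc)
  qed
  then show ?thesis by (simp add: vec_eq_iff)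
qed

lemma fapp_fid [simp]: "fapp fid x = x"
proof -
  have "fapp fid x $ i = x $ i" for i
    unfolding fapp_nth by (subst sum_eq_single[of i]) (auto simp: fid_nth)
  then show ?thesis by (simp add: vec_eq_iff)
qed

lemma linear_fapp: "linear (fapp A)"
  by (intro linearI)
    (simp_all add: vec_eq_iff fapp_nth qmult.add_right qmult.scaleR_right sum.distrib scaleR_sum_right)

lemma fapp_vscale: "fapp A (vscale x c) = vscale (fapp A x) c"
  by (simp add: vec_eq_iff fapp_nth qmult.sum_left qmult_assoc)

lemma continuous_on_fapp [continuous_intros]:
  "continuous_on S f \<Longrightarrow> continuous_on S g \<Longrightarrow> continuous_on S (\<lambda>x. fapp (f x) (g x))"
  unfolding fapp_def by (intro continuous_on_vec_lambda continuous_intros)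

section \<open>Singular leading blocks and their kernel vectors\<close>

definition Vec :: "nat \<Rightarrow> (quat^('n::finite)) set" where
  "Vec d = {x. \<forall>i. x$i \<in> Fld d}"

lemma subspace_Vec: "subspace (Vec d)"
  by (simp add: subspace_def Vec_def Fld_add Fld_scaleR)

lemma Vec_fapp: "A \<in> Mat d \<Longrightarrow> x \<in> Vec d \<Longrightarrow> fapp A x \<in> Vec d"
  by (simp add: Vec_def Mat_def fapp_nth Fld_sum Fld_qmult)

lemma Vec_vscale: "x \<in> Vec d \<Longrightarrow> c \<in> Fld d \<Longrightarrow> vscale x c \<in> Vec d"
  by (simp add: Vec_def Fld_qmult)

lemma fapp_UF_eq_0: "u \<in> UF d \<Longrightarrow> fapp u x = 0 \<Longrightarrow> x = 0"
  using fapp_fmul[of "fadj u" u x] linear_0[OF linear_fapp] by simp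

text \<open>A nonzero x of this kind is a kernel vector of the leading block with last index j,
  padded by zeros. It expresses singularity without a quaternionic minor.\<close>

definition kernel_vec :: "nat \<Rightarrow> 'n \<Rightarrow> ('n::{finite,linorder}) fmat \<Rightarrow> (quat,'n) vec \<Rightarrow> bool" where
  "kernel_vec d j u x \<longleftrightarrow> x \<in> Vec d \<and> (\<forall>i>j. x$i = 0) \<and> (\<forall>i\<le>j. fapp u x $ i = 0)"

text \<open>The unitary matrices whose leading block with last index \<open>j\<close> is singular.\<close>

definition Bad :: "nat \<Rightarrow> 'n \<Rightarrow> (('n::{finite,linorder}) fmat) set" where
  "Bad d j = {u \<in> UF d. \<exists>x. norm x = 1 \<and> kernel_vec d j u x}"

lemma BadI:
  assumes "u \<in> UF d" "kernel_vec d j u x" "x \<noteq> 0"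
  shows "u \<in> Bad d j"
proof -
  let ?y = "(1 / norm x) *\<^sub>R x"
  have "norm ?y = 1" using assms by simp
  moreover have "kernel_vec d j u ?y"
    using assms by (simp add: kernel_vec_def Vec_def Fld_scaleR linear_cmul[OF linear_fapp])
  ultimately show ?thesis using assms unfolding Bad_def by blast
qed

lemma BadE:
  assumes "u \<in> Bad d j"
  obtains x where "u \<in> UF d" "kernel_vec d j u x" "x \<noteq> 0"
  using assms by (auto simp: Bad_def) (metis norm_zero zero_neq_one)

text \<open>Normalising the kernel vector makes the set a projection of a compact set of pairs (u,
  x).\<close>

lemma closed_Bad: "closed (Bad d j :: ('n::{finite,linorder}) fmat set)"
proof -
  let ?P = "{p :: 'n fmat \<times> (quat,'n) vec. snd p \<in> Vec d} \<inter> (\<Inter>i\<in>{j<..}. {p. snd p $ i = 0}) \<inter>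
     (\<Inter>i\<in>{..j}. {p. fapp (fst p) (snd p) $ i = 0})"
  have "closed (Vec d :: (quat,'n) vec set)"
    by (rule closed_subspace[OF subspace_Vec])
  then have "closed (snd -` Vec d :: ('n fmat \<times> (quat,'n) vec) set)"
    by (intro closed_vimage) (auto intro!: continuous_intros)
  moreover have "{p :: 'n fmat \<times> (quat,'n) vec. snd p \<in> Vec d} = snd -` Vec d" by auto
  ultimately have "closed ?P"
    by (auto intro!: closed_Int closed_INT closed_Collect_eq continuous_intros)
  moreover have "compact (UF d \<times> sphere 0 1 :: ('n fmat \<times> (quat,'n) vec) set)"
    by (intro compact_Times compact_UF compact_sphere)
  ultimately have "compact ((UF d \<times> sphere 0 1) \<inter> ?P)"
    by (rule compact_Int_closed[rotated])
  then have "compact (fst ` ((UF d \<times> sphere 0 1) \<inter> ?P))"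
    by (intro compact_continuous_image continuous_intros)
  moreover have "Bad d j = fst ` ((UF d \<times> sphere 0 1) \<inter> ?P)"
  proof (intro set_eqI iffI)
    fix u assume "u \<in> Bad d j"
    then obtain x where "u \<in> UF d" "norm x = 1" "kernel_vec d j u x" by (auto simp: Bad_def)
    then show "u \<in> fst ` ((UF d \<times> sphere 0 1) \<inter> ?P)"
      by (intro image_eqI[of _ _ "(u, x)"]) (auto simp: kernel_vec_def)
  next
    fix u assume "u \<in> fst ` ((UF d \<times> sphere 0 1) \<inter> ?P)"
    then show "u \<in> Bad d j" by (auto simp: Bad_def kernel_vec_def)
  qed
  ultimately show ?thesis by (simp add: compact_imp_closed)
qed

text \<open>The indices before j form the leading block that ends at the predecessor p of j, so x
  would be a kernel vector for p. When j is the least index, x has no coordinates left.\<close>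

lemma leading_block_inj:
  assumes u: "u \<in> UF d" and good: "\<And>i. i < j \<Longrightarrow> u \<notin> Bad d i"
    and x: "x \<in> Vec d" "\<And>i. j \<le> i \<Longrightarrow> x$i = 0" "\<And>i. i < j \<Longrightarrow> fapp u x $ i = 0"
  shows "x = 0"
proof (cases "{i. i < j} = {}")
  case True
  then have "j \<le> i" for i using linorder_not_less by blast
  then show ?thesis using x(2) by (simp add: vec_eq_iff)
next
  case False
  define p where "p = Max {i. i < j}"
  have p: "p < j" using Max_in[OF _ False] by (simp add: p_def)
  have less: "i \<le> p" if "i < j" for i using that by (simp add: p_def)
  have "kernel_vec d p u x"
    unfolding kernel_vec_def
  proof (intro conjI allI impI)
    show "x $ i = 0" if "p < i" for i using x(2)[of i] less[of i] that by force
    show "fapp u x $ i = 0" if "i \<le> p" for i using x(3)[of i] that p by simp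
  qed (rule x(1))
  then show ?thesis using BadI[OF u, of p x] good[OF p] by blast
qed

text \<open>This x is the j-th column of the factor r in \<open>u r = l\<close>: a unit entry at j,
  corrected before j so that \<open>fapp u x\<close> vanishes there. The pivot
  \<open>fapp u x $ j\<close> is nonzero, as x would otherwise be a kernel vector of block
  j.\<close>

lemma leading_block_solve:
  fixes u :: "('n::{finite,linorder}) fmat"
  assumes u: "u \<in> UF d" and good: "\<And>i. u \<notin> Bad d i"
  shows "\<exists>x\<in>Vec d. x$j = qreal 1 \<and> (\<forall>i>j. x$i = 0) \<and> (\<forall>i<j. fapp u x $ i = 0) \<and> fapp u x $ j \<noteq> 0"
proof -
  let ?S = "{x \<in> Vec d. \<forall>i\<ge>j. x$i = 0} :: (quat,'n) vec set"
  \<comment> \<open>The leading block before j as an endomorphism of the vectors supported before j;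
    regularity of the earlier blocks makes it bijective.\<close>
  define f :: "(quat,'n) vec \<Rightarrow> (quat,'n) vec"
    where "f x = (\<chi> i. if i < j then fapp u x $ i else 0)" for x
  have f_im: "f ` ?S = ?S"
  proof (rule linear_inj_subspace_onto)
    show "linear f"
      by (intro linearI)
        (simp_all add: f_def vec_eq_iff linear_add[OF linear_fapp] linear_cmul[OF linear_fapp])
    show "subspace ?S"
      using subspace_Vec[of d] by (auto simp: subspace_def)
    show "f ` ?S \<subseteq> ?S"
    proof clarify
      fix x :: "(quat,'n) vec" assume "x \<in> Vec d"
      then have "fapp u x \<in> Vec d" using u by (simp add: Vec_fapp UF_imp_Mat)
      then show "f x \<in> Vec d \<and> (\<forall>i\<ge>j. f x $ i = 0)" by (auto simp: f_def Vec_def)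
    qed
    fix x :: "(quat,'n) vec" assume x: "x \<in> ?S" and fx: "f x = 0"
    have "fapp u x $ i = 0" if "i < j" for i
      using arg_cong[OF fx, of "\<lambda>z. z $ i"] that by (simp add: f_def)
    then show "x = 0" using x good by (intro leading_block_inj[OF u]) auto
  qed
  let ?e = "axis j (qreal 1) :: (quat,'n) vec"
  have e: "?e \<in> Vec d" by (simp add: Vec_def axis_def)
  then have ue: "fapp u ?e \<in> Vec d" using u by (simp add: Vec_fapp UF_imp_Mat)
  \<comment> \<open>The right-hand side cancels the contribution of the unit vector
    \<open>?e\<close> to the rows before j.\<close>
  then have "(\<chi> i. if i < j then - (fapp u ?e $ i) else 0) \<in> ?S"
    by (auto simp: Vec_def Fld_minus)
  then have "(\<chi> i. if i < j then - (fapp u ?e $ i) else 0) \<in> f ` ?S"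
    by (simp only: f_im)
  then obtain z where z: "(\<chi> i. if i < j then - (fapp u ?e $ i) else 0) = f z" "z \<in> ?S"
    by (rule imageE)
  define x where "x = z + ?e"
  have x: "x \<in> Vec d" using z e by (simp add: x_def subspace_add[OF subspace_Vec])
  have "fapp u x $ i = 0" if "i < j" for i
    using arg_cong[OF z(1), of "\<lambda>w. w $ i"] that
    by (simp add: f_def x_def linear_add[OF linear_fapp]) (metis add.left_inverse)
  moreover have xj: "x$j = qreal 1" using z by (simp add: x_def axis_def)
  moreover have supp: "\<forall>i>j. x$i = 0" using z by (auto simp: x_def axis_def)
  moreover have "fapp u x $ j \<noteq> 0"
  proof
    assume "fapp u x $ j = 0"
    with calculation x have "kernel_vec d j u x"
      by (auto simp: kernel_vec_def le_less)
    moreover have "x \<noteq> 0" using xj by auto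
    ultimately show False using BadI[OF u] good by blast
  qed
  ultimately show ?thesis using x by blast
qed

lemma lu_exists:
  fixes u :: "('n::{finite,linorder}) fmat"
  assumes u: "u \<in> UF d" and good: "\<And>i. u \<notin> Bad d i"
  shows "\<exists>r\<in>Tpos d. (\<forall>j. r$j$j = qreal 1) \<and> utri (fadj (u \<otimes> r)) \<and> (\<forall>j. (u \<otimes> r)$j$j \<noteq> 0)"
proof -
  obtain x where x: "\<And>j. x j \<in> Vec d" "\<And>j. x j $ j = qreal 1" "\<And>j i. j < i \<Longrightarrow> x j $ i = 0"
    "\<And>j i. i < j \<Longrightarrow> fapp u (x j) $ i = 0" "\<And>j. fapp u (x j) $ j \<noteq> 0"
    using leading_block_solve[OF u good] by metis
  define r :: "'n fmat" where "r = (\<chi> i j. x j $ i)"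
  have "(u \<otimes> r)$i$j = fapp u (x j) $ i" for i j
    by (simp add: fmul_nth fapp_nth r_def)
  moreover have "r \<in> Tpos d"
    using x unfolding Tpos_def utri_def by (auto simp: r_def Mat_def Vec_def intro!: exI[of _ "1::real"])
  ultimately show ?thesis
    using x by (intro bexI[of _ r]) (auto simp: utri_def r_def)
qed

lemma ediag_Tpos: "ediag t \<in> Tpos d"
  unfolding Tpos_def utri_def by (auto simp: ediag_eq_fdiag fdiag_nth)

lemma IA_ediag: "IA d (ediag t) = t"
  unfolding IA_Tpos[OF ediag_Tpos] by (simp add: vec_eq_iff ediag_eq_fdiag fdiag_nth)

lemma GLF_fadj: "A \<in> GLF d \<Longrightarrow> fadj A \<in> GLF d"
proof -
  assume A: "A \<in> GLF d"
  then obtain B where "B \<in> Mat d" "B \<otimes> A = fid" by (auto simp: GLF_def)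
  then have "fadj A \<otimes> fadj B = fid" by (simp add: fadj_fmul[symmetric])
  then show ?thesis using A \<open>B \<in> Mat d\<close> by (intro GLFI[of _ _ "fadj B"] Mat_fadj) (auto intro: GLF_imp_Mat)
qed

text \<open>With \<open>u r = l\<close> lower triangular, \<open>e\<^sup>t u r = (e\<^sup>t l e\<^sup>-\<^sup>t) e\<^sup>t\<close>, and for decreasing \<open>t\<close> the entries of
  \<open>e\<^sup>t l e\<^sup>-\<^sup>t\<close> are dominated by those of \<open>l\<close> while the diagonal is unchanged, so that it
  ranges in a compact set of invertible matrices.\<close>

lemma IA_ediag_fmul_bounded:
  fixes u :: "('n::{finite,linorder}) fmat"
  assumes u: "u \<in> UF d" and good: "\<And>i. u \<notin> Bad d i"
  shows "\<exists>B. \<forall>t\<in>CqA. norm (IA d (ediag t \<otimes> u) - t) \<le> B"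
proof -
  obtain r where r: "r \<in> Tpos d" "\<And>j. r$j$j = qreal 1" and lt: "utri (fadj (u \<otimes> r))"
    and nz: "\<And>j. (u \<otimes> r)$j$j \<noteq> 0"
    using lu_exists[OF u good] by blast
  define l where "l = u \<otimes> r"
  have l: "l$i$j = 0" if "i < j" for i j
  proof -
    have "qconj (l$i$j) = 0" using lt that by (simp add: utri_def l_def)
    then show ?thesis by (metis qconj_0 qconj_qconj)
  qed
  have l_Mat: "l \<in> Mat d" using u r by (simp add: l_def Mat_fmul UF_imp_Mat Tpos_Mat)
  define C where "C = {m \<in> Mat d. \<forall>i j. norm (m$i$j) \<le> norm (l$i$j) \<and> m$i$i = l$i$i}"
  have "closed C"
  proof -
    have eq: "C = Mat d \<inter> (\<Inter>i. \<Inter>j. {m. norm (m$i$j) \<le> norm (l$i$j)} \<inter> {m. m$i$i = l$i$i})"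
      by (auto simp: C_def)
    show ?thesis
      unfolding eq by (intro closed_Int closed_INT ballI closed_Mat closed_Collect_le
          closed_Collect_eq continuous_intros)
  qed
  moreover have "bounded C"
  proof -
    have "norm m \<le> norm l" if "m \<in> C" for m
    proof (rule power2_le_imp_le)
      show "(norm m)\<^sup>2 \<le> (norm l)\<^sup>2"
        unfolding norm_fmat_sq ftr_def fadj_fmul_diag
        using that by (auto simp: C_def intro!: sum_mono power_mono)
    qed simp
    then show ?thesis unfolding bounded_iff by blast
  qed
  ultimately have "compact C" by (simp add: compact_eq_bounded_closed)
  have C_GLF: "C \<subseteq> GLF d"
  proof
    fix m assume m: "m \<in> C"
    \<comment> \<open>The matrix m is lower triangular, so the criterion for upper triangular
      matrices is applied to its adjoint.\<close>
    have "fadj m \<in> GLF d"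
    proof (rule utri_GLF)
      show "fadj m \<in> Mat d" using m by (simp add: C_def Mat_fadj)
      show "utri (fadj m)"
        unfolding utri_def
      proof (intro allI impI)
        fix i j :: 'n assume "j < i"
        then have "l$j$i = 0" by (rule l)
        moreover have "norm (m$j$i) \<le> norm (l$j$i)" using m unfolding C_def by blast
        ultimately show "fadj m $ i $ j = 0" by simp
      qed
      fix i
      have "m$i$i \<noteq> 0" using m nz[of i] by (auto simp: C_def l_def)
      then show "fadj m $ i $ i \<noteq> 0" by (metis fadj_nth qconj_0 qconj_qconj)
    qed
    then show "m \<in> GLF d" using GLF_fadj[of "fadj m" d] by simp
  qed
  have "compact (IA d ` C)"
    by (intro compact_continuous_image \<open>compact C\<close> continuous_on_subset[OF continuous_on_IA C_GLF])
  then have "bounded (IA d ` C)" by (rule compact_imp_bounded)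
  then obtain B where B: "\<And>m. m \<in> C \<Longrightarrow> norm (IA d m) \<le> B"
    unfolding bounded_iff by blast
  have "norm (IA d (ediag t \<otimes> u) - t) \<le> B" if t: "t \<in> CqA" for t
  proof -
    define m where "m = ediag t \<otimes> l \<otimes> ediag (- t)"
    have m_nth: "m$i$j = exp (t$i - t$j) *\<^sub>R l$i$j" for i j
      by (simp add: m_def fmul_ediag_nth ediag_fmul_nth exp_diff exp_minus field_simps)
    have "norm (m$i$j) \<le> norm (l$i$j)" for i j
    proof (cases "i < j")
      case True
      then show ?thesis by (simp add: m_nth l)
    next
      case False
      then have "t$i \<le> t$j" using t by (simp add: CqA_def)
      then have "exp (t$i - t$j) \<le> 1" by simp
      then show ?thesis by (simp add: m_nth mult_left_le_one_le)
    qed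
    moreover have "m \<in> Mat d" using l_Mat by (simp add: m_def Mat_fmul)
    ultimately have m: "m \<in> C" by (simp add: C_def m_nth)
    have "ediag t \<otimes> u \<otimes> r = m \<otimes> ediag t"
      by (simp add: m_def l_def fmul_assoc ediag_fmul_ediag ediag_0)
    then have "IA d (ediag t \<otimes> u \<otimes> r) = IA d (m \<otimes> ediag t)" by simp
    moreover have "IA d (ediag t \<otimes> u \<otimes> r) = IA d (ediag t \<otimes> u) + IA d r"
      using u r by (intro IA_fmul_Tpos) (simp_all add: GLF_fmul UF_GLF)
    moreover have "IA d r = 0" using r by (simp add: IA_Tpos vec_eq_iff)
    moreover have "IA d (m \<otimes> ediag t) = IA d m + t"
      using m C_GLF by (subst IA_fmul_Tpos) (auto simp: ediag_Tpos IA_ediag)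
    ultimately have "IA d (ediag t \<otimes> u) - t = IA d m" by simp
    then show ?thesis using B[OF m] by simp
  qed
  then show ?thesis by blast
qed

section \<open>Non-generic unitary matrices are null sets\<close>

text \<open>The sign of the image \<open>- a / |a|\<close> of the \<open>j\<close>-th unit vector is chosen so that the reflection
  vector \<open>a / |a| + e\<^sub>j\<close> never vanishes.\<close>

lemma householder:
  fixes a :: "(real,'n::finite) vec"
  assumes aj: "a$j > 0"
  obtains w where "w \<in> UF d" "\<And>l. w$j$l = qreal (- (a$l / norm a))"
    "\<And>k l. k \<noteq> j \<Longrightarrow> a$k = 0 \<Longrightarrow> w$k$l = fid$k$l"
proof -
  have "a \<noteq> 0" using aj by auto
  define v where "v = (1 / norm a) *\<^sub>R a + axis j 1"
  define \<alpha> where "\<alpha> = a$j / norm a"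
  have \<alpha>: "\<alpha> > 0" using aj \<open>a \<noteq> 0\<close> by (simp add: \<alpha>_def)
  have vj: "v$j = 1 + \<alpha>" by (simp add: v_def \<alpha>_def)
  have vl: "v$l = a$l / norm a" if "l \<noteq> j" for l using that by (simp add: v_def axis_def)
  have "inner a a = norm a * norm a"
    by (simp add: power2_norm_eq_inner[symmetric] power2_eq_square)
  then have "inner v v = 2 * (1 + \<alpha>)"
    using \<open>a \<noteq> 0\<close> by (simp add: v_def inner_add_left inner_add_right inner_axis inner_axis' \<alpha>_def
        add_divide_distrib)
  then have vv: "(\<Sum>k\<in>UNIV. v$k * v$k) = 2 * (1 + \<alpha>)"
    by (simp add: inner_vec_def)
  \<comment> \<open>Since \<open>inner v v = 2 * (1 + \<alpha>)\<close>, this is the kernel of the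
    usual reflection in the hyperplane orthogonal to v.\<close>
  define H where "H k l = (if k = l then 1 else 0) - v$k * v$l / (1 + \<alpha>)" for k l
  define w :: "'n fmat" where "w = (\<chi> k l. qreal (H k l))"
  have HH: "(\<Sum>m\<in>UNIV. H k m * H m l) = (if k = l then 1 else 0)" for k l
  proof -
    have "(\<Sum>m\<in>UNIV. H k m * H m l) = (\<Sum>m\<in>UNIV. (if k = m then (if m = l then 1 else 0) else 0)
        - (if k = m then v$m * v$l / (1 + \<alpha>) else 0) - (if m = l then v$k * v$m / (1 + \<alpha>) else 0)
        + v$k * v$l / (1 + \<alpha>)\<^sup>2 * (v$m * v$m))"
      by (intro sum.cong) (auto simp: H_def algebra_simps power2_eq_square)
    also have "\<dots> = (if k = l then 1 else 0) - 2 * (v$k * v$l / (1 + \<alpha>)) + v$k * v$l / (1 + \<alpha>)\<^sup>2 * (2 * (1 + \<alpha>))"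
      by (simp only: sum.distrib sum_subtractf sum_distrib_left[symmetric] vv) simp
    also have "\<dots> = (if k = l then 1 else 0)"
      using \<alpha> by (simp add: power2_eq_square divide_simps) (simp add: algebra_simps)
    finally show ?thesis .
  qed
  have "fadj w = w" by (simp add: fmat_eq_iff w_def H_def mult.commute)
  moreover have "w \<otimes> w = fid"
  proof -
    have sum: "(\<Sum>i\<in>UNIV. qreal (f i)) = qreal (\<Sum>i\<in>UNIV. f i)" for f :: "'n \<Rightarrow> real"
      by (simp add: quat_eq_iff)
    have "(w \<otimes> w)$k$l = qreal (\<Sum>m\<in>UNIV. H k m * H m l)" for k l
      by (simp add: fmul_nth w_def sum mult.commute)
    then show ?thesis by (simp only: fmat_eq_iff fid_nth HH) simp
  qed
  moreover have "w \<in> Mat d" by (simp add: Mat_def w_def)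
  ultimately have "w \<in> UF d" by (intro UFI) simp_all
  moreover have "w$j$l = qreal (- (a$l / norm a))" for l
    using \<alpha> vl[of l] by (cases "l = j") (simp_all add: w_def H_def vj \<alpha>_def)
  moreover have "w$k$l = fid$k$l" if "k \<noteq> j" "a$k = 0" for k l
    using vl[of k] that by (simp add: w_def H_def fid_nth)
  ultimately show thesis by (rule that)
qed

text \<open>Some real component of some \<open>y$l\<close> is nonzero, and it is a coefficient of a
  real polynomial vanishing at \<open>Suc m\<close> for every m in the set. Only the uniformity of
  the bound in y matters, so the degree is estimated crudely.\<close>

lemma vandermonde_bound:
  fixes y :: "(quat,'n::{finite,linorder}) vec"
  assumes "y \<noteq> 0"
  shows "finite {m::nat. (\<Sum>l\<in>UNIV. real (Suc m) ^ pos l *\<^sub>R y$l) = 0}"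
    "card {m::nat. (\<Sum>l\<in>UNIV. real (Suc m) ^ pos l *\<^sub>R y$l) = 0} \<le> CARD('n)"
proof -
  let ?Z = "{m::nat. (\<Sum>l\<in>UNIV. real (Suc m) ^ pos l *\<^sub>R y$l) = 0}"
  obtain l0 c where l0: "y$l0$c \<noteq> 0" using assms by (auto simp: vec_eq_iff)
  define b where "b i = (\<Sum>l\<in>UNIV. if pos l = i then y$l$c else 0)" for i
  have "b (pos l0) = y$l0$c"
    unfolding b_def by (subst sum_eq_single[of l0]) auto
  then have "b (pos l0) \<noteq> 0" using l0 by simp
  then have roots: "finite {z. (\<Sum>i\<le>CARD('n). b i * z ^ i) = 0}"
    "card {z. (\<Sum>i\<le>CARD('n). b i * z ^ i) = 0} \<le> CARD('n)"
    using polyfun_rootbound_finite[of "CARD('n)" b] polyfun_rootbound_card[of "CARD('n)" b]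
      pos_less_card[of l0] by (auto intro: less_imp_le)
  have poly: "(\<Sum>i\<le>CARD('n). b i * z ^ i) = (\<Sum>l\<in>UNIV. z ^ pos l * y$l$c)" for z
  proof -
    have "(\<Sum>i\<le>CARD('n). b i * z ^ i) = (\<Sum>i\<le>CARD('n). \<Sum>l\<in>UNIV. if pos l = i then z ^ pos l * y$l$c else 0)"
      unfolding b_def sum_distrib_right by (intro sum.cong) auto
    also have "\<dots> = (\<Sum>l\<in>UNIV. \<Sum>i\<le>CARD('n). if pos l = i then z ^ pos l * y$l$c else 0)"
      by (rule sum.swap)
    also have "\<dots> = (\<Sum>l\<in>UNIV. z ^ pos l * y$l$c)"
      by (intro sum.cong) (auto simp: less_imp_le[OF pos_less_card])
    finally show ?thesis .
  qed
  have sub: "(\<lambda>m. real (Suc m)) ` ?Z \<subseteq> {z. (\<Sum>i\<le>CARD('n). b i * z ^ i) = 0}"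
  proof clarify
    fix m assume "(\<Sum>l\<in>UNIV. real (Suc m) ^ pos l *\<^sub>R y$l) = 0"
    then have "(\<Sum>l\<in>UNIV. real (Suc m) ^ pos l *\<^sub>R y$l) $ c = 0" by simp
    then show "(\<Sum>i\<le>CARD('n). b i * real (Suc m) ^ i) = 0" unfolding poly by simp
  qed
  have inj: "inj_on (\<lambda>m. real (Suc m)) ?Z" by (auto intro: inj_onI)
  show "finite ?Z" using finite_imageD[OF finite_subset[OF sub roots(1)] inj] .
  show "card ?Z \<le> CARD('n)"
    using card_image[OF inj] card_mono[OF roots(1) sub] roots(2) by linarith
qed

text \<open>Regularity of all earlier blocks forces a kernel vector of block j to be nonzero at j,
  so the kernel is a single line over right scalars. This makes one fixed vector control all
  translates.\<close>

definition Bad_first :: "nat \<Rightarrow> 'n \<Rightarrow> (('n::{finite,linorder}) fmat) set" where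
  "Bad_first d j = Bad d j - (\<Union>i\<in>{i. i < j}. Bad d i)"

text \<open>Reflections fixing the coordinates before \<open>j\<close> leave the kernel vector of the \<open>j\<close>-th leading block
  unchanged. If their \<open>j\<close>-th rows are of Vandermonde type, only boundedly many of them keep
  that block singular, and translation invariance forces measure zero.\<close>

lemma Bad_first_translates:
  fixes j :: "'n::{finite,linorder}"
  obtains w :: "nat \<Rightarrow> 'n fmat" where "\<And>m. w m \<in> UF d"
    "\<And>u. u \<in> UF d \<Longrightarrow> finite {m. w m \<otimes> u \<in> Bad_first d j} \<and> card {m. w m \<otimes> u \<in> Bad_first d j} \<le> CARD('n)"
proof -
  \<comment> \<open>Zeros before j keep the reflections away from the earlier coordinates; powers of
    the distinct nodes \<open>Suc m\<close> make the j-th rows of Vandermonde type.\<close>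
  define a :: "nat \<Rightarrow> (real,'n) vec" where "a m = (\<chi> l. if l < j then 0 else real (Suc m) ^ pos l)" for m
  have aj: "a m $ j > 0" for m by (simp add: a_def)
  have "\<exists>w. w \<in> UF d \<and> (\<forall>l. w$j$l = qreal (- (a m $ l / norm (a m)))) \<and>
      (\<forall>k l. k < j \<longrightarrow> w$k$l = fid$k$l)" for m
  proof -
    obtain w where "w \<in> UF d" "\<And>l. w$j$l = qreal (- (a m $ l / norm (a m)))"
      "\<And>k l. k \<noteq> j \<Longrightarrow> a m $ k = 0 \<Longrightarrow> w$k$l = fid$k$l"
      using householder[OF aj[of m], of d] by blast
    then show ?thesis by (intro exI[of _ w]) (auto simp: a_def)
  qed
  then obtain w where w: "\<And>m. w m \<in> UF d"
    "\<And>m l. w m $j$l = qreal (- (a m $ l / norm (a m)))"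
    "\<And>m k l. k < j \<Longrightarrow> w m $k$l = fid$k$l"
    by metis
  show thesis
  proof (rule that[OF w(1)])
    fix u :: "'n fmat" assume u: "u \<in> UF d"
    let ?X = "{m. w m \<otimes> u \<in> Bad_first d j}"
    have low: "fapp (w m) z $ i = z $ i" if "i < j" for m z i
    proof -
      have "fapp (w m) z $ i = fapp fid z $ i"
        unfolding fapp_nth using w(3)[OF that] by simp
      then show ?thesis by simp
    qed
    \<comment> \<open>Such an x would make a block of \<open>w m \<otimes> u\<close> before j
      singular, because \<open>w m\<close> acts as the identity on those coordinates.\<close>
    have inj: "x = 0" if m: "m \<in> ?X" and x: "x \<in> Vec d" "\<And>i. j \<le> i \<Longrightarrow> x$i = 0" "\<And>i. i < j \<Longrightarrow> fapp u x $ i = 0"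
      for m and x
    proof (rule leading_block_inj[of "w m \<otimes> u" d j])
      show "w m \<otimes> u \<in> UF d" using w u by (simp add: UF_fmul)
      show "w m \<otimes> u \<notin> Bad d i" if "i < j" for i using m that by (auto simp: Bad_first_def)
    qed (use x in \<open>auto simp: fapp_fmul low\<close>)
    show "finite ?X \<and> card ?X \<le> CARD('n)"
    proof (cases "?X = {}")
      case False
      then obtain m0 where m0: "m0 \<in> ?X" by blast
      have ex: "\<exists>x. kernel_vec d j (w m \<otimes> u) x \<and> x$j \<noteq> 0" if "m \<in> ?X" for m
      proof -
        from that have "w m \<otimes> u \<in> Bad d j" by (simp add: Bad_first_def)
        then obtain x where x: "kernel_vec d j (w m \<otimes> u) x" "x \<noteq> 0" by (rule BadE)
        have "x$j \<noteq> 0"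
        proof
          assume "x$j = 0"
          then have "x = 0"
            using x(1) by (intro inj[OF that]) (auto simp: kernel_vec_def fapp_fmul low le_less)
          with x show False by simp
        qed
        with x show ?thesis by blast
      qed
      obtain x0 where x0: "kernel_vec d j (w m0 \<otimes> u) x0" "x0$j \<noteq> 0" using ex[OF m0] by blast
      have "fapp u x0 \<noteq> 0" using fapp_UF_eq_0[OF u, of x0] x0 by (metis zero_index)
      have ylow: "fapp u x0 $ i = 0" if "i < j" for i
        using x0 that low[OF that, of m0 "fapp u x0"] by (auto simp: kernel_vec_def fapp_fmul)
      \<comment> \<open>All kernel vectors are multiples of the one found for m0, so membership of m
        says that the j-th row of \<open>w m\<close> annihilates the fixed nonzero vector
        \<open>fapp u x0\<close>.\<close>
      have "?X \<subseteq> {m. (\<Sum>l\<in>UNIV. real (Suc m) ^ pos l *\<^sub>R fapp u x0 $ l) = 0}"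
      proof
        fix m assume m: "m \<in> ?X"
        obtain x where x: "kernel_vec d j (w m \<otimes> u) x" "x$j \<noteq> 0" using ex[OF m] by blast
        \<comment> \<open>The right scalar that matches the j-th coordinates; the difference of x
          and the multiple of x0 is then supported before j and vanishes by
          \<open>inj\<close>.\<close>
        define c where "c = (1 / (norm (x0$j))\<^sup>2) *\<^sub>R (qconj (x0$j) \<odot> x$j)"
        have cj: "x0$j \<odot> c = x$j"
          using x0 by (simp add: c_def qmult.scaleR_right qmult_assoc[symmetric] qmult_qconj_right)
        have "c \<in> Fld d"
          using x0 x unfolding c_def kernel_vec_def Vec_def by (intro Fld_scaleR Fld_qmult Fld_qconj) auto
        then have zV: "x - vscale x0 c \<in> Vec d"
          using x x0 by (intro subspace_diff[OF subspace_Vec] Vec_vscale) (auto simp: kernel_vec_def)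
        have "x - vscale x0 c = 0"
        proof (rule inj[OF m zV])
          fix i assume "j \<le> i"
          then show "(x - vscale x0 c) $ i = 0"
            using x x0 cj by (auto simp: kernel_vec_def le_less)
        next
          fix i assume "i < j"
          then show "fapp u (x - vscale x0 c) $ i = 0"
            using x ylow[of i] low[of i m "fapp u x"]
            by (auto simp: kernel_vec_def linear_diff[OF linear_fapp] fapp_vscale fapp_fmul)
        qed
        then have "fapp (w m \<otimes> u) x $ j = fapp (w m) (fapp u x0) $ j \<odot> c"
          by (simp add: fapp_fmul fapp_vscale)
        moreover have "fapp (w m \<otimes> u) x $ j = 0" using x by (simp add: kernel_vec_def)
        moreover have "c \<noteq> 0" using cj x by auto
        ultimately have "fapp (w m) (fapp u x0) $ j = 0" by (simp add: qmult_eq_0_iff)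
        then have "(\<Sum>l\<in>UNIV. (- (a m $ l / norm (a m))) *\<^sub>R fapp u x0 $ l) = 0"
          by (simp add: fapp_nth[of "w m"] w(2))
        moreover have "(- (a m $ l / norm (a m))) *\<^sub>R fapp u x0 $ l
            = (- 1 / norm (a m)) *\<^sub>R (real (Suc m) ^ pos l *\<^sub>R fapp u x0 $ l)" for l
          using ylow[of l] by (auto simp: a_def)
        ultimately have "(- 1 / norm (a m)) *\<^sub>R (\<Sum>l\<in>UNIV. real (Suc m) ^ pos l *\<^sub>R fapp u x0 $ l) = 0"
          by (simp only: scaleR_sum_right)
        moreover have "norm (a m) \<noteq> 0" using aj[of m] by auto
        ultimately show "m \<in> {m. (\<Sum>l\<in>UNIV. real (Suc m) ^ pos l *\<^sub>R fapp u x0 $ l) = 0}" by simp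
      qed
      with vandermonde_bound[OF \<open>fapp u x0 \<noteq> 0\<close>] show ?thesis
        by (meson card_mono finite_subset order_trans)
    qed simp
  qed
qed

text \<open>The property inside the definite description \<open>haarK\<close>. Results are proved
  for any measure that has it, and \<open>haarK_eq\<close> carries them over.\<close>

definition is_haar :: "nat \<Rightarrow> ('n::finite) fmat measure \<Rightarrow> bool" where
  "is_haar d \<mu> \<longleftrightarrow> prob_space \<mu> \<and> sets \<mu> = sets borel \<and> emeasure \<mu> (UF d) = 1 \<and>
      (\<forall>v\<in>UF d. distr \<mu> borel (fmul v) = \<mu>)"

section \<open>Left invariance and null sets\<close>

lemma is_haar_AE_UF:
  assumes "is_haar d \<mu>"
  shows "AE u in \<mu>. u \<in> UF d"
proof -
  interpret prob_space \<mu> using assms by (simp add: is_haar_def)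
  have "prob (UF d) = 1" using assms by (simp add: is_haar_def measure_def)
  moreover have "UF d \<in> events" using assms closed_UF[of d] by (simp add: is_haar_def borel_closed)
  ultimately show ?thesis by (simp add: prob_eq_1)
qed

lemma is_haar_translate:
  assumes H: "is_haar d \<mu>" and w: "w \<in> UF d" and f: "f \<in> borel_measurable borel"
  shows "(\<integral>\<^sup>+u. f (w \<otimes> u) \<partial>\<mu>) = (\<integral>\<^sup>+u. f u \<partial>\<mu>)"
proof -
  have s: "sets \<mu> = sets borel" using H by (simp add: is_haar_def)
  have "fmul w \<in> borel_measurable borel"
    by (intro borel_measurable_continuous_onI continuous_intros)
  then have "fmul w \<in> measurable \<mu> borel" by (simp add: measurable_cong_sets[OF s refl])
  then have "(\<integral>\<^sup>+u. f u \<partial>distr \<mu> borel (fmul w)) = (\<integral>\<^sup>+u. f (w \<otimes> u) \<partial>\<mu>)"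
    using f by (simp add: nn_integral_distr)
  then show ?thesis using H w by (simp add: is_haar_def)
qed

text \<open>The preimages of B under M translations all have the measure of B and overlap at most N
  times at almost every point. Hence M times the measure is at most N for every M.\<close>

lemma null_if_finitely_many_translates:
  fixes w :: "nat \<Rightarrow> ('n::finite) fmat" and \<mu> :: "'n fmat measure"
  assumes H: "is_haar d \<mu>" and B: "B \<in> sets borel" and w: "\<And>m. w m \<in> UF d"
    and fin: "\<And>u. u \<in> UF d \<Longrightarrow> finite {m. w m \<otimes> u \<in> B} \<and> card {m. w m \<otimes> u \<in> B} \<le> N"
  shows "emeasure \<mu> B = 0"
proof -
  interpret prob_space \<mu> using H by (simp add: is_haar_def)
  have s: "sets \<mu> = sets borel" using H by (simp add: is_haar_def)
  have bd: "of_nat M * emeasure \<mu> B \<le> of_nat N" for M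
  proof -
    have meas: "(\<lambda>u. indicator B (w m \<otimes> u) :: ennreal) \<in> borel_measurable \<mu>" for m
      unfolding measurable_cong_sets[OF s refl] using B by measurable
    have "of_nat M * emeasure \<mu> B = (\<Sum>m<M. \<integral>\<^sup>+u. indicator B (w m \<otimes> u) \<partial>\<mu>)"
      using B by (simp add: is_haar_translate[OF H w] s)
    also have "\<dots> = (\<integral>\<^sup>+u. (\<Sum>m<M. indicator B (w m \<otimes> u)) \<partial>\<mu>)"
      by (rule nn_integral_sum[symmetric]) (rule meas)
    also have "\<dots> \<le> (\<integral>\<^sup>+u. of_nat N \<partial>\<mu>)"
    proof (rule nn_integral_mono_AE, use is_haar_AE_UF[OF H] in eventually_elim)
      fix u :: "'n fmat" assume "u \<in> UF d"
      then have f: "finite {m. w m \<otimes> u \<in> B}" "card {m. w m \<otimes> u \<in> B} \<le> N" using fin by auto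
      have "(\<Sum>m<M. indicator B (w m \<otimes> u) :: ennreal) = of_nat (card {m\<in>{..<M}. w m \<otimes> u \<in> B})"
        by (simp add: indicator_def sum.If_cases Int_def)
      moreover have "card {m\<in>{..<M}. w m \<otimes> u \<in> B} \<le> card {m. w m \<otimes> u \<in> B}"
        by (rule card_mono[OF f(1)]) auto
      ultimately show "(\<Sum>m<M. indicator B (w m \<otimes> u) :: ennreal) \<le> of_nat N"
        using f(2) by (simp add: order_trans)
    qed
    also have "\<dots> = of_nat N" by (simp add: emeasure_space_1)
    finally show ?thesis .
  qed
  have "real M * prob B \<le> real N" for M
  proof -
    have "ennreal (real M * prob B) \<le> ennreal (real N)"
      using bd[of M] by (simp add: emeasure_eq_measure ennreal_mult' ennreal_of_nat_eq_real_of_nat)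
    then show ?thesis by simp
  qed
  then have "prob B \<le> 0"
    by (meson not_le ex_less_of_nat_mult)
  then show ?thesis by (simp add: emeasure_eq_measure measure_le_0_iff)
qed

lemma emeasure_Bad:
  fixes \<mu> :: "('n::{finite,linorder}) fmat measure"
  assumes H: "is_haar d \<mu>"
  shows "emeasure \<mu> (Bad d j) = 0"
proof (induction j rule: measure_induct_rule[of pos])
  case (less j)
  have B: "Bad d i \<in> sets borel" for i :: 'n by (intro borel_closed closed_Bad)
  have s: "sets \<mu> = sets borel" using H by (simp add: is_haar_def)
  have "Bad_first d j \<in> sets borel" unfolding Bad_first_def by (intro sets.Diff sets.finite_UN B) simp
  then have "emeasure \<mu> (Bad_first d j) = 0"
    using Bad_first_translates[of d j] null_if_finitely_many_translates[OF H] by metis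
  then have "Bad_first d j \<in> null_sets \<mu>"
    using \<open>Bad_first d j \<in> sets borel\<close> s by (auto intro: null_setsI)
  moreover have "Bad d i \<in> null_sets \<mu>" if "i < j" for i
    using less.IH[of i] that B s by (auto intro: null_setsI)
  then have "(\<Union>i\<in>{i. i < j}. Bad d i) \<in> null_sets \<mu>"
    by (intro null_sets_UN') auto
  ultimately have "Bad_first d j \<union> (\<Union>i\<in>{i. i < j}. Bad d i) \<in> null_sets \<mu>"
    by (rule null_sets.Un)
  then have "Bad d j \<in> null_sets \<mu>"
    by (rule null_sets_subset) (auto simp: Bad_first_def B s)
  then show ?case by auto
qed

section \<open>Leading principal minors\<close>

text \<open>Padding by the identity turns the minor over S into a full determinant, so that
  multiplicativity of \<open>det\<close> becomes available for minors.\<close>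

definition extm :: "'i set \<Rightarrow> ('i \<Rightarrow> 'i \<Rightarrow> complex) \<Rightarrow> complex^'i^('i::finite)" where
  "extm S M = (\<chi> i j. if i \<in> S \<and> j \<in> S then M i j else if i = j then 1 else 0)"

lemma cdet_eq_det: "cdet S M = det (extm S M)"
proof -
  let ?t = "\<lambda>p. of_int (sign p) * (\<Prod>i\<in>UNIV. extm S M $ i $ p i)"
  have "det (extm S M) = (\<Sum>p\<in>{p. p permutes S}. ?t p)"
    unfolding det_def
  proof (rule sum.mono_neutral_right)
    show "{p. p permutes S} \<subseteq> {p. p permutes UNIV}"
      by (auto intro: permutes_subset)
    show "\<forall>p\<in>{p. p permutes UNIV} - {p. p permutes S}. ?t p = 0"
    proof
      fix p assume p: "p \<in> {p. p permutes (UNIV :: 'a set)} - {p. p permutes S}"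
      then have "\<exists>i. i \<notin> S \<and> p i \<noteq> i" by (auto simp: permutes_def)
      then obtain i where "i \<notin> S" "p i \<noteq> i" by blast
      then have "extm S M $ i $ p i = 0" by (simp add: extm_def)
      then have "(\<Prod>i\<in>UNIV. extm S M $ i $ p i) = 0" by (intro prod_zero) auto
      then show "?t p = 0" by simp
    qed
  qed (simp add: finite_permutations)
  also have "\<dots> = cdet S M"
    unfolding cdet_def
  proof (intro sum.cong refl arg_cong2[of _ _ _ _ "(*)"])
    fix p assume "p \<in> {p. p permutes S}"
    then have p: "p permutes S" by simp
    have "(\<Prod>i\<in>UNIV. extm S M $ i $ p i) = (\<Prod>i\<in>S. extm S M $ i $ p i)"
      by (rule prod.mono_neutral_right) (use p in \<open>auto simp: extm_def permutes_not_in\<close>)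
    also have "\<dots> = (\<Prod>i\<in>S. M i (p i))"
      by (rule prod.cong) (use p in \<open>auto simp: extm_def permutes_in_image\<close>)
    finally show "(\<Prod>i\<in>UNIV. extm S M $ i $ p i) = (\<Prod>i\<in>S. M i (p i))" .
  qed
  finally show ?thesis ..
qed

text \<open>The inner sum runs over S only. This is the situation of a lower triangular left factor
  and a leading index set, where the Cauchy-Binet formula has a single term.\<close>

lemma cdet_mult:
  fixes A B M :: "'i::finite \<Rightarrow> 'i \<Rightarrow> complex"
  assumes M: "\<And>i j. i \<in> S \<Longrightarrow> j \<in> S \<Longrightarrow> M i j = (\<Sum>k\<in>S. A i k * B k j)"
  shows "cdet S M = cdet S A * cdet S B"
proof -
  have "(extm S A ** extm S B) $ i $ j = extm S M $ i $ j" for i j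
  proof (cases "i \<in> S")
    case True
    have "(extm S A ** extm S B) $ i $ j = (\<Sum>k\<in>S. extm S A $ i $ k * extm S B $ k $ j)"
      unfolding matrix_matrix_mult_def using True
      by simp (rule sum.mono_neutral_right, auto simp: extm_def)
    also have "\<dots> = extm S M $ i $ j"
    proof (cases "j \<in> S")
      case True
      then have "extm S M $ i $ j = (\<Sum>k\<in>S. A i k * B k j)"
        using \<open>i \<in> S\<close> by (simp add: extm_def M)
      also have "\<dots> = (\<Sum>k\<in>S. extm S A $ i $ k * extm S B $ k $ j)"
        using True \<open>i \<in> S\<close> by (intro sum.cong) (auto simp: extm_def)
      finally show ?thesis by simp
    next
      case False
      then show ?thesis using \<open>i \<in> S\<close> by (auto simp: extm_def intro!: sum.neutral)
    qed
    finally show ?thesis .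
  next
    case False
    then show ?thesis
      unfolding matrix_matrix_mult_def
      by simp (subst sum_eq_single[of i], auto simp: extm_def)
  qed
  then have "extm S M = extm S A ** extm S B" by (simp add: vec_eq_iff)
  then show ?thesis by (simp add: cdet_eq_det det_mul)
qed

text \<open>The sum of \<open>f (p i) - f i\<close> over S is zero for a permutation p, so p either
  lowers f somewhere, and its term vanishes, or fixes f everywhere and is the identity. The
  integer-valued f encodes the order, so that reversed orders and pairs of indices are covered as
  well.\<close>

lemma cdet_triangular:
  fixes f :: "'i \<Rightarrow> int"
  assumes S: "finite S" and inj: "inj_on f S"
    and tri: "\<And>i j. i \<in> S \<Longrightarrow> j \<in> S \<Longrightarrow> f j < f i \<Longrightarrow> A i j = 0"
  shows "cdet S A = (\<Prod>i\<in>S. A i i)"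
proof -
  have "cdet S A = (\<Sum>p\<in>{id}. of_int (sign p) * (\<Prod>i\<in>S. A i (p i)))"
    unfolding cdet_def
  proof (rule sum.mono_neutral_right)
    show "\<forall>p\<in>{p. p permutes S} - {id}. of_int (sign p) * (\<Prod>i\<in>S. A i (p i)) = 0"
    proof
      fix p assume "p \<in> {p. p permutes S} - {id}"
      then have p: "p permutes S" and "p \<noteq> id" by auto
      have "\<exists>i\<in>S. f (p i) < f i"
      proof (rule ccontr)
        assume "\<not> ?thesis"
        then have le: "f i \<le> f (p i)" if "i \<in> S" for i using that by force
        have "(\<Sum>i\<in>S. f (p i)) = (\<Sum>i\<in>S. f i)"
          using sum.permute[OF p, of f] by (simp add: o_def)
        then have "(\<Sum>i\<in>S. f (p i) - f i) = 0" by (simp add: sum_subtractf)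
        then have "f (p i) - f i = 0" if "i \<in> S" for i
          using S le that by (subst (asm) sum_nonneg_eq_0_iff) auto
        then have "p i = i" if "i \<in> S" for i
          using inj that permutes_in_image[OF p, of i] by (auto simp: inj_on_def)
        then have "p i = i" for i using permutes_not_in[OF p, of i] by blast
        then show False using \<open>p \<noteq> id\<close> by auto
      qed
      then obtain i where i: "i \<in> S" "f (p i) < f i" by blast
      then have "A i (p i) = 0" using tri[of i "p i"] permutes_in_image[OF p, of i] by blast
      then have "(\<Prod>i\<in>S. A i (p i)) = 0" using i S by (intro prod_zero) auto
      then show "of_int (sign p) * (\<Prod>i\<in>S. A i (p i)) = 0" by simp
    qed
  qed (auto simp: S finite_permutations permutes_id)
  then show ?thesis by simp
qed

text \<open>For \<open>d \<le> 2\<close> the last two components vanish and \<open>qcpl1\<close> is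
  multiplicative. The leading block of the product is then a lower times an upper triangular block
  with the same real diagonal.\<close>

lemma Delta_commutative:
  fixes r :: "('n::{finite,linorder}) fmat"
  assumes d: "d \<le> 2" and r: "r \<in> Tpos d"
  shows "Delta d m (fadj r \<otimes> r) = (\<Prod>i\<in>first_idx m. (qre (r$i$i))\<^sup>2)"
proof -
  let ?S = "first_idx m :: 'n set"
  have mult: "qcpl1 (a \<odot> b) = qcpl1 a * qcpl1 b" if "a \<in> Fld d" "b \<in> Fld d" for a b
    using d that by (auto simp: qcpl1_def Fld_def qmult_nth complex_eq_iff)
  have qsum: "qcpl1 (\<Sum>k\<in>UNIV. f k) = (\<Sum>k\<in>UNIV. qcpl1 (f k))" for f :: "'n \<Rightarrow> quat"
    by (simp add: qcpl1_def complex_eq_iff)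
  have qcj: "qcpl1 (qconj a) = cnj (qcpl1 a)" for a by (simp add: qcpl1_def complex_eq_iff)
  have c0: "qcpl1 0 = 0" by (simp add: qcpl1_def complex_eq_iff)
  have rF: "r$i$j \<in> Fld d" for i j using Tpos_Mat[OF r] by (rule Mat_nth)
  have ut: "r$i$j = 0" if "j < i" for i j using Tpos_utri[OF r] that by (simp add: utri_def)
  have diag: "qcpl1 (r$i$i) = of_real (qre (r$i$i))" for i
  proof -
    have "qcpl1 (qreal a) = of_real a" for a by (simp add: qcpl1_def complex_eq_iff)
    then show ?thesis using Tpos_diag[OF r, of i] by metis
  qed
  let ?A = "\<lambda>i k. cnj (qcpl1 (r$k$i))" and ?B = "\<lambda>k j. qcpl1 (r$k$j)"
  have "cdet ?S (\<lambda>i j. qcpl1 ((fadj r \<otimes> r)$i$j)) = cdet ?S ?A * cdet ?S ?B"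
  proof (rule cdet_mult)
    fix i j :: 'n assume i: "i \<in> ?S"
    have "qcpl1 ((fadj r \<otimes> r)$i$j) = (\<Sum>k\<in>UNIV. ?A i k * ?B k j)"
      by (simp add: fmul_nth qsum mult rF Fld_qconj qcj)
    also have "\<dots> = (\<Sum>k\<in>?S. ?A i k * ?B k j)"
    proof (rule sum.mono_neutral_right)
      show "\<forall>k\<in>UNIV - ?S. ?A i k * ?B k j = 0"
      proof
        fix k assume "k \<in> UNIV - ?S"
        then have "pos i < pos k" using i by (simp add: first_idx_def del: pos_less_iff)
        then show "?A i k * ?B k j = 0" by (simp add: ut c0)
      qed
    qed auto
    finally show "qcpl1 ((fadj r \<otimes> r)$i$j) = (\<Sum>k\<in>?S. ?A i k * ?B k j)" .
  qed
  also have "cdet ?S ?A = (\<Prod>i\<in>?S. ?A i i)"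
    by (rule cdet_triangular[of _ "\<lambda>i. - int (pos i)"]) (auto simp: inj_on_def ut c0)
  also have "cdet ?S ?B = (\<Prod>i\<in>?S. ?B i i)"
    by (rule cdet_triangular[of _ "\<lambda>i. int (pos i)"]) (auto simp: inj_on_def ut c0)
  also have "(\<Prod>i\<in>?S. ?A i i) * (\<Prod>i\<in>?S. ?B i i) = of_real (\<Prod>i\<in>?S. (qre (r$i$i))\<^sup>2)"
    by (simp add: diag prod.distrib[symmetric] power2_eq_square)
  finally have "Re (cdet ?S (\<lambda>i j. qcpl1 ((fadj r \<otimes> r)$i$j))) = (\<Prod>i\<in>?S. (qre (r$i$i))\<^sup>2)"
    by (simp only: Re_complex_of_real)
  then show ?thesis using d by (simp add: Delta_def)
qed

lemma crep_fmul:
  fixes X Y :: "('n::finite) fmat"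
  shows "crep (X \<otimes> Y) p q = (\<Sum>k\<in>UNIV. crep X p k * crep Y k q)"
proof -
  have q1: "qcpl1 (a \<odot> b) = qcpl1 a * qcpl1 b - qcpl2 a * cnj (qcpl2 b)"
    and q2: "qcpl2 (a \<odot> b) = qcpl1 a * qcpl2 b + qcpl2 a * cnj (qcpl1 b)" for a b
    by (simp_all add: qcpl1_def qcpl2_def qmult_nth complex_eq_iff)
  have s1: "qcpl1 (\<Sum>k\<in>UNIV. f k) = (\<Sum>k\<in>UNIV. qcpl1 (f k))"
    and s2: "qcpl2 (\<Sum>k\<in>UNIV. f k) = (\<Sum>k\<in>UNIV. qcpl2 (f k))" for f :: "'n \<Rightarrow> quat"
    by (simp_all add: qcpl1_def qcpl2_def complex_eq_iff)
  obtain i b where p: "p = (i, b)" by fastforce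
  obtain j c where q: "q = (j, c)" by fastforce
  have "(\<Sum>k\<in>UNIV. crep X p k * crep Y k q)
      = (\<Sum>k\<in>UNIV. \<Sum>e\<in>UNIV. crep X p (k, e) * crep Y (k, e) q)"
    by (simp add: sum.cartesian_product)
  also have "\<dots> = crep (X \<otimes> Y) p q"
    by (cases b; cases c)
      (simp_all add: p q crep_def UNIV_bool fmul_nth s1 s2 q1 q2 sum.distrib sum_subtractf sum_negf algebra_simps)
  finally show ?thesis ..
qed

text \<open>Ordering the pairs lexicographically keeps the complex representation triangular,
  because real diagonal quaternions become scalar 2 by 2 blocks. Each diagonal entry then occurs
  twice in either factor, and the square root in \<open>Delta\<close> removes the doubling.\<close>

lemma Delta_quaternionic:
  fixes r :: "('n::{finite,linorder}) fmat"
  assumes r: "r \<in> Tpos 4"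
  shows "Delta 4 m (fadj r \<otimes> r) = (\<Prod>i\<in>first_idx m. (qre (r$i$i))\<^sup>2)"
proof -
  let ?S = "first_idx m \<times> UNIV :: ('n \<times> bool) set"
  have z: "qcpl1 0 = 0" "qcpl2 0 = 0" by (simp_all add: qcpl1_def qcpl2_def complex_eq_iff)
  have qr: "qcpl1 (qreal a) = of_real a" "qcpl2 (qreal a) = 0" for a
    by (simp_all add: qcpl1_def qcpl2_def complex_eq_iff)
  have ut: "r$i$j = 0" if "j < i" for i j using Tpos_utri[OF r] that by (simp add: utri_def)
  have diag: "r$i$i = qreal (qre (r$i$i))" for i using Tpos_diag[OF r] by blast
  have diag1: "qcpl1 (r$i$i) = of_real (qre (r$i$i))" "qcpl2 (r$i$i) = 0"
    "qcpl1 (qconj (r$i$i)) = of_real (qre (r$i$i))" "qcpl2 (qconj (r$i$i)) = 0" for i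
    by (metis diag qr qconj_qreal)+
  define f :: "'n \<times> bool \<Rightarrow> int" where "f p = 2 * int (pos (fst p)) + (if snd p then 1 else 0)" for p
  have f_less: "f p < f q \<Longrightarrow> fst p < fst q \<or> (fst p = fst q \<and> \<not> snd p \<and> snd q)" for p q
    by (cases "fst p" "fst q" rule: linorder_cases)
      (auto simp: f_def split: if_splits dest: iffD2[OF pos_less_iff])
  have inj: "inj_on f ?S"
  proof (rule inj_onI)
    fix p q assume "f p = f q"
    then show "p = q" using f_less[of p q] f_less[of q p]
      by (auto simp: f_def prod_eq_iff split: if_splits) presburger+
  qed
  have up: "crep r p q = 0" if "f q < f p" for p q
    using f_less[OF that] by (cases p; cases q) (auto simp: crep_def ut z diag1)
  have lo: "crep (fadj r) p q = 0" if "f p < f q" for p q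
    using f_less[OF that] by (cases p; cases q) (auto simp: crep_def ut z diag1)
  have "cdet ?S (crep (fadj r \<otimes> r)) = cdet ?S (crep (fadj r)) * cdet ?S (crep r)"
  proof (rule cdet_mult)
    fix p q :: "'n \<times> bool" assume p: "p \<in> ?S"
    have "crep (fadj r) p k = 0" if "k \<notin> ?S" for k
    proof (rule lo)
      have "pos (fst p) < pos (fst k)" using p that by (auto simp: first_idx_def mem_Times_iff simp del: pos_less_iff)
      then show "f p < f k"
        by (cases "snd p"; cases "snd k"; simp only: f_def if_True if_False; linarith)
    qed
    then show "crep (fadj r \<otimes> r) p q = (\<Sum>k\<in>?S. crep (fadj r) p k * crep r k q)"
      unfolding crep_fmul by (intro sum.mono_neutral_right) auto
  qed
  also have "cdet ?S (crep (fadj r)) = (\<Prod>p\<in>?S. crep (fadj r) p p)"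
    by (rule cdet_triangular[of _ "\<lambda>p. - f p"]) (use inj lo in \<open>auto simp: inj_on_def\<close>)
  also have "cdet ?S (crep r) = (\<Prod>p\<in>?S. crep r p p)"
    by (rule cdet_triangular[OF _ inj]) (use up in auto)
  also have "(\<Prod>p\<in>?S. crep (fadj r) p p) = (\<Prod>p\<in>?S. of_real (qre (r$fst p$fst p)))"
    by (intro prod.cong) (auto simp: crep_def diag1)
  also have "(\<Prod>p\<in>?S. crep r p p) = (\<Prod>p\<in>?S. of_real (qre (r$fst p$fst p)))"
    by (intro prod.cong) (auto simp: crep_def diag1)
  also have "(\<Prod>p\<in>?S. of_real (qre (r$fst p$fst p))) = (of_real (\<Prod>i\<in>first_idx m. (qre (r$i$i))\<^sup>2) :: complex)"
  proof -
    have "(\<Prod>p\<in>?S. of_real (qre (r$fst p$fst p)))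
        = (\<Prod>i\<in>first_idx m. \<Prod>b\<in>(UNIV::bool set). (of_real (qre (r$i$i)) :: complex))"
      by (subst prod.cartesian_product) (simp add: case_prod_beta)
    then show ?thesis by (simp add: power2_eq_square)
  qed
  also have "(of_real (\<Prod>i\<in>first_idx m. (qre (r$i$i))\<^sup>2) * of_real (\<Prod>i\<in>first_idx m. (qre (r$i$i))\<^sup>2) :: complex)
      = of_real ((\<Prod>i\<in>first_idx m. (qre (r$i$i))\<^sup>2)\<^sup>2)"
    by (simp only: power2_eq_square of_real_mult)
  finally have "Re (cdet ?S (crep (fadj r \<otimes> r))) = (\<Prod>i\<in>first_idx m. (qre (r$i$i))\<^sup>2)\<^sup>2"
    by (simp only: Re_complex_of_real)
  then show ?thesis by (simp add: Delta_def prod_nonneg)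
qed

lemma Delta_Tpos:
  assumes "d \<in> {1, 2, 4}" "r \<in> Tpos d"
  shows "Delta d m (fadj r \<otimes> r) = (\<Prod>i\<in>first_idx m. (qre (r$i$i))\<^sup>2)"
  using assms Delta_commutative[of d r m] Delta_quaternionic[of r m] by auto

text \<open>The Gram matrix \<open>fadj g \<otimes> g\<close> only sees the triangular factor, and
  the quotient of consecutive minors leaves one squared diagonal entry. The resulting factor 2 is
  compensated by the power of 2 in \<open>mom\<close>.\<close>

lemma Lfun_eq_IA:
  assumes d: "d \<in> {1, 2, 4}" and g: "g \<in> GLF d"
  shows "Lfun d j (fadj g \<otimes> g) = 2 * IA d g $ j"
proof -
  let ?r = "fadj (QU d g) \<otimes> g"
  have r: "?r \<in> Tpos d" by (rule QU_props(2)[OF g])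
  have "fadj g \<otimes> g = fadj ?r \<otimes> ?r"
    by (simp add: fadj_fmul fmul_assoc UF_cancel_left(2)[OF QU_UF])
  then have D: "Delta d m (fadj g \<otimes> g) = (\<Prod>i\<in>first_idx m. (qre (?r$i$i))\<^sup>2)" for m
    using Delta_Tpos[OF d r] by simp
  have "first_idx (pos j + 1) = insert j (first_idx (pos j))"
    by (auto simp: first_idx_def less_Suc_eq)
  moreover have "j \<notin> first_idx (pos j)" by (simp add: first_idx_def)
  moreover have "(\<Prod>i\<in>first_idx (pos j). (qre (?r$i$i))\<^sup>2) \<noteq> 0"
    using Tpos_pos[OF r] by (subst prod_zero_iff) (auto simp: less_le)
  ultimately have "Lfun d j (fadj g \<otimes> g) = ln ((qre (?r$j$j))\<^sup>2)"
    unfolding Lfun_def D by simp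
  then show ?thesis
    using g Tpos_pos[OF r, of j] by (simp add: IA_def ln_realpow)
qed

section \<open>Haar measure and the moment functions\<close>

text \<open>Integrate the indicator of A at \<open>fadj v \<otimes> u\<close> over both variables.
  Invariance in u gives the \<mu>-measure of A; invariance in v gives a value in which only \<mu>2
  occurs. Taking \<mu> to be either measure identifies them.\<close>

lemma haar_unique:
  fixes \<mu>1 \<mu>2 :: "('n::{finite,linorder}) fmat measure"
  assumes H1: "is_haar d \<mu>1" and H2: "is_haar d \<mu>2"
  shows "\<mu>1 = \<mu>2"
proof -
  have key: "emeasure \<mu> A = (\<integral>\<^sup>+v. indicator A (fadj v) \<partial>\<mu>2)"
    if H: "is_haar d \<mu>" and A [measurable]: "A \<in> sets borel" for \<mu> :: "'n fmat measure" and A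
  proof -
    have s: "sets \<mu> = sets borel" "sets \<mu>2 = sets borel" using H H2 by (simp_all add: is_haar_def)
    interpret P: prob_space \<mu> using H by (simp add: is_haar_def)
    interpret Q: prob_space \<mu>2 using H2 by (simp add: is_haar_def)
    interpret pair_sigma_finite \<mu> \<mu>2 ..
    have sp: "sets (\<mu> \<Otimes>\<^sub>M \<mu>2) = sets (borel \<Otimes>\<^sub>M borel)"
      by (rule sets_pair_measure_cong) (use s in auto)
    have meas: "(\<lambda>(u, v). indicator A (fadj v \<otimes> u) :: ennreal) \<in> borel_measurable (\<mu> \<Otimes>\<^sub>M \<mu>2)"
      unfolding measurable_cong_sets[OF sp refl] by measurable
    have "emeasure \<mu> A = (\<integral>\<^sup>+v. emeasure \<mu> A \<partial>\<mu>2)"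
      by (simp add: Q.emeasure_space_1)
    also have "\<dots> = (\<integral>\<^sup>+v. \<integral>\<^sup>+u. indicator A (fadj v \<otimes> u) \<partial>\<mu> \<partial>\<mu>2)"
    proof (rule nn_integral_cong_AE, use is_haar_AE_UF[OF H2] in eventually_elim)
      fix v :: "'n fmat" assume v: "v \<in> UF d"
      have "(\<integral>\<^sup>+u. indicator A (fadj v \<otimes> u) \<partial>\<mu>) = (\<integral>\<^sup>+u. indicator A u \<partial>\<mu>)"
        by (intro is_haar_translate[OF H UF_fadj[OF v]]) measurable
      then show "emeasure \<mu> A = (\<integral>\<^sup>+u. indicator A (fadj v \<otimes> u) \<partial>\<mu>)" using A s by simp
    qed
    also have "\<dots> = (\<integral>\<^sup>+u. \<integral>\<^sup>+v. indicator A (fadj v \<otimes> u) \<partial>\<mu>2 \<partial>\<mu>)"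
      by (rule Fubini'[OF meas])
    also have "\<dots> = (\<integral>\<^sup>+u. \<integral>\<^sup>+v. indicator A (fadj v) \<partial>\<mu>2 \<partial>\<mu>)"
    proof (rule nn_integral_cong_AE, use is_haar_AE_UF[OF H] in eventually_elim)
      fix u :: "'n fmat" assume u: "u \<in> UF d"
      have "(\<integral>\<^sup>+v. indicator A (fadj (fadj u \<otimes> v)) \<partial>\<mu>2) = (\<integral>\<^sup>+v. indicator A (fadj v) \<partial>\<mu>2)"
        by (intro is_haar_translate[OF H2 UF_fadj[OF u]]) measurable
      then show "(\<integral>\<^sup>+v. indicator A (fadj v \<otimes> u) \<partial>\<mu>2) = (\<integral>\<^sup>+v. indicator A (fadj v) \<partial>\<mu>2)"
        by (simp add: fadj_fmul)
    qed
    also have "\<dots> = (\<integral>\<^sup>+v. indicator A (fadj v) \<partial>\<mu>2)"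
      by (simp add: P.emeasure_space_1)
    finally show ?thesis .
  qed
  show ?thesis
  proof (rule measure_eqI)
    show "sets \<mu>1 = sets \<mu>2" using H1 H2 by (simp add: is_haar_def)
    fix A assume "A \<in> sets \<mu>1"
    then have "A \<in> sets borel" using H1 by (simp add: is_haar_def)
    then show "emeasure \<mu>1 A = emeasure \<mu>2 A" using key[OF H1] key[OF H2] by simp
  qed
qed

lemma haarK_eq: "is_haar d \<mu> \<Longrightarrow> haarK d = (\<mu> :: ('n::{finite,linorder}) fmat measure)"
  unfolding haarK_def is_haar_def[symmetric]
  by (rule the_equality) (auto intro: haar_unique)

section \<open>Measurability of the integrand and evaluation of the moment functions\<close>

lemma measurable_qcpl [measurable]:
  "qcpl1 \<in> borel_measurable borel" "qcpl2 \<in> borel_measurable borel"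
  unfolding qcpl1_def qcpl2_def Complex_eq
  by (intro borel_measurable_continuous_onI continuous_intros)+

lemma measurable_vec_nth [measurable]:
  assumes "f \<in> borel_measurable M"
  shows "(\<lambda>x. f x $ i) \<in> borel_measurable M"
  by (rule borel_measurable_continuous_on[OF _ assms, of "\<lambda>A. A $ i"]) (intro continuous_intros)

lemma measurable_crep [measurable]: "(\<lambda>x. crep x p q) \<in> borel_measurable borel"
proof -
  obtain i b j c where "p = (i, b)" "q = (j, c)" by (cases p, cases q) blast
  moreover have "cnj \<in> borel_measurable borel"
    by (intro borel_measurable_continuous_onI continuous_intros)
  note this [measurable]
  have "(\<lambda>x. crep x (i, b) (j, c)) \<in> borel_measurable borel"
    unfolding crep_def by (cases b; cases c) simp_all
  ultimately show ?thesis by simp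
qed

lemma measurable_Delta [measurable]:
  "Delta d r \<in> borel_measurable (borel :: ('n::{finite,linorder}) fmat measure)"
  unfolding Delta_def cdet_def by measurable

lemma measurable_Lfun:
  "Lfun d j \<in> borel_measurable (borel :: ('n::{finite,linorder}) fmat measure)"
  unfolding Lfun_def by measurable

text \<open>For unitary u the matrix in \<open>mom\<close> is the Gram matrix of
  \<open>ediag t \<otimes> u\<close>, which brings in \<open>IA d\<close>. As the integral runs over
  the ambient matrix space, the identity is used almost everywhere.\<close>

lemma mom_eq:
  fixes t :: "(real,'n::{finite,linorder}) vec"
  assumes d: "d \<in> {1, 2, 4}" and H: "is_haar d \<mu>"
  shows "mom d l t = (\<integral>u. (\<Prod>j\<in>UNIV. (IA d (ediag t \<otimes> u) $ j) ^ l j) \<partial>\<mu>)"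
proof -
  have s: "sets \<mu> = sets borel" using H by (simp add: is_haar_def)
  let ?P = "\<lambda>u. \<Prod>j\<in>UNIV. (Lfun d j (finv d u \<otimes> (ediag (2 *\<^sub>R t) \<otimes> u))) ^ l j"
  let ?Q = "\<lambda>u. \<Prod>j\<in>UNIV. (IA d (ediag t \<otimes> u) $ j) ^ l j"
  have eq: "?P u = 2 ^ (\<Sum>j\<in>UNIV. l j) * ?Q u" if u: "u \<in> UF d" for u
  proof -
    have "ediag (2 *\<^sub>R t) = ediag t \<otimes> ediag t"
      by (simp only: scaleR_2 ediag_fmul_ediag)
    then have "finv d u \<otimes> (ediag (2 *\<^sub>R t) \<otimes> u) = fadj (ediag t \<otimes> u) \<otimes> (ediag t \<otimes> u)"
      using u by (simp only: finv_UF fadj_fmul fmul_assoc fadj_ediag)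
    moreover have "ediag t \<otimes> u \<in> GLF d" using u by (simp add: GLF_fmul UF_GLF)
    ultimately have "?P u = (\<Prod>j\<in>UNIV. (2 * IA d (ediag t \<otimes> u) $ j) ^ l j)"
      by (simp only: Lfun_eq_IA[OF d])
    then show ?thesis by (simp only: power_mult_distrib prod.distrib power_sum)
  qed
  have "AE u in \<mu>. ?P u = 2 ^ (\<Sum>j\<in>UNIV. l j) * ?Q u"
    using is_haar_AE_UF[OF H] by eventually_elim (rule eq)
  moreover have "?P \<in> borel_measurable borel"
  proof (intro borel_measurable_prod borel_measurable_power measurable_compose[OF _ measurable_Lfun])
    show "(\<lambda>u. finv d u \<otimes> (ediag (2 *\<^sub>R t) \<otimes> u)) \<in> borel_measurable borel"
      by (intro measurable_fmul measurable_finv) simp_all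
  qed
  moreover have "?Q \<in> borel_measurable borel" by measurable
  ultimately have "(\<integral>u. ?P u \<partial>\<mu>) = (\<integral>u. 2 ^ (\<Sum>j\<in>UNIV. l j) * ?Q u \<partial>\<mu>)"
    by (intro integral_cong_AE borel_measurable_times) (simp_all add: measurable_cong_sets[OF s refl])
  moreover have "2 powr (- real n) * (2 ^ n * x) = x" for n and x :: real
    by (simp add: powr_minus powr_realpow)
  ultimately show ?thesis
    by (simp only: mom_def haarK_eq[OF H] integral_mult_right_zero)
qed

section \<open>Levy's continuity theorem on Euclidean spaces\<close>

text \<open>Finite combinations of characters: closed under products, as Stone-Weierstrass demands,
  while integrals converge on them by linearity from the characteristic functions.\<close>

inductive trig :: "('a::euclidean_space \<Rightarrow> complex) \<Rightarrow> bool" where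
  basic: "trig (\<lambda>x. c * cis (\<xi> \<bullet> x))"
| add: "trig f \<Longrightarrow> trig g \<Longrightarrow> trig (\<lambda>x. f x + g x)"

lemma trig_mult:
  assumes "trig f" "trig g"
  shows "trig (\<lambda>x. f x * g x)"
  using assms(1)
proof (induction f)
  case (basic c \<xi>)
  show ?case using assms(2)
  proof (induction g)
    case (basic c' \<eta>)
    have "trig (\<lambda>x. (c * c') * cis ((\<xi> + \<eta>) \<bullet> x))" by (rule trig.basic)
    moreover have "(\<lambda>x. (c * c') * cis ((\<xi> + \<eta>) \<bullet> x)) = (\<lambda>x. c * cis (\<xi> \<bullet> x) * (c' * cis (\<eta> \<bullet> x)))"
      by (simp add: inner_add_left cis_mult[symmetric] mult_ac)
    ultimately show ?case by simp
  next
    case (add f g)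
    then show ?case using trig.add[OF add.IH] by (simp add: distrib_left)
  qed
next
  case (add f h)
  then show ?case using trig.add[OF add.IH] by (simp add: distrib_right)
qed

lemma trig_const: "trig (\<lambda>x. c)"
  using trig.basic[of c 0] by simp

lemma trig_continuous: "trig f \<Longrightarrow> continuous_on UNIV f"
proof (induction f rule: trig.induct)
  case (basic c \<xi>)
  show ?case unfolding cis_conv_exp by (intro continuous_intros)
qed (intro continuous_intros)

lemma trig_bounded: "trig f \<Longrightarrow> \<exists>B. \<forall>x. norm (f x) \<le> B"
proof (induction f rule: trig.induct)
  case (basic c \<xi>)
  show ?case by (intro exI[of _ "norm c"]) (simp add: norm_mult)
next
  case (add f g)
  then obtain A B where "\<forall>x. norm (f x) \<le> A" "\<forall>x. norm (g x) \<le> B" by blast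
  then show ?case by (intro exI[of _ "A + B"]) (meson norm_add_leD add_mono norm_triangle_le)
qed

lemma integrable_bounded_continuous:
  fixes f :: "'a::topological_space \<Rightarrow> 'b::{banach, second_countable_topology}"
  assumes "prob_space M" "sets M = sets borel" "continuous_on UNIV f" "\<And>x. norm (f x) \<le> B"
  shows "integrable M f"
proof -
  interpret prob_space M by fact
  have "f \<in> borel_measurable M"
    unfolding measurable_cong_sets[OF assms(2) refl] by (rule borel_measurable_continuous_onI) fact
  then show ?thesis using assms(4) by (intro integrable_const_bound[of _ B]) auto
qed

lemma trig_integral_tendsto:
  assumes P: "\<And>k. prob_space (\<mu>s k)" "\<And>k. sets (\<mu>s k) = sets borel" "prob_space \<mu>" "sets \<mu> = sets borel"
    and char: "\<And>\<xi>. (\<lambda>k. \<integral>x. cis (\<xi> \<bullet> x) \<partial>\<mu>s k) \<longlonglongrightarrow> (\<integral>x. cis (\<xi> \<bullet> x) \<partial>\<mu>)"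
    and f: "trig f"
  shows "(\<lambda>k. \<integral>x. f x \<partial>\<mu>s k) \<longlonglongrightarrow> (\<integral>x. f x \<partial>\<mu>)"
  using f
proof (induction f)
  case (basic c \<xi>)
  show ?case by (simp add: tendsto_mult_left char)
next
  case (add f g)
  have int: "integrable M h" if "trig h" "prob_space M" "sets M = sets borel" for h M
    using trig_bounded[OF that(1)] integrable_bounded_continuous[OF that(2,3) trig_continuous[OF that(1)]]
    by blast
  show ?case
    using tendsto_add[OF add.IH] by (simp add: int add.hyps P)
qed

definition rtrig :: "('a::euclidean_space \<Rightarrow> real) \<Rightarrow> bool" where
  "rtrig h \<longleftrightarrow> trig (\<lambda>x. complex_of_real (h x))"

lemma rtrig_const: "rtrig (\<lambda>x. c)"
  and rtrig_add: "rtrig f \<Longrightarrow> rtrig g \<Longrightarrow> rtrig (\<lambda>x. f x + g x)"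
  and rtrig_mult: "rtrig f \<Longrightarrow> rtrig g \<Longrightarrow> rtrig (\<lambda>x. f x * g x)"
  by (simp_all add: rtrig_def trig_const trig.add trig_mult)

lemma rtrig_sin: "rtrig (\<lambda>x. sin (\<xi> \<bullet> x))"
proof -
  have "trig (\<lambda>x. - (\<i> / 2) * cis (\<xi> \<bullet> x) + (\<i> / 2) * cis ((- \<xi>) \<bullet> x))"
    by (intro trig.add trig.basic)
  moreover have "(\<lambda>x. - (\<i> / 2) * cis (\<xi> \<bullet> x) + (\<i> / 2) * cis ((- \<xi>) \<bullet> x)) = (\<lambda>x. of_real (sin (\<xi> \<bullet> x)))"
    by (simp add: fun_eq_iff complex_eq_iff)
  ultimately show ?thesis by (simp add: rtrig_def)
qed

lemma rtrig_polynomial: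
  assumes p: "rtrig p" and q: "real_polynomial_function q"
  shows "rtrig (\<lambda>x. q (p x :: real))"
  using q
proof (induction q rule: real_polynomial_function.induct)
  case (linear f)
  have "f s = s * f 1" for s :: real
    using linear_cmul[OF bounded_linear.linear[OF linear], of s 1] by simp
  then have "(\<lambda>x. f (p x)) = (\<lambda>x. p x * f 1)" by blast
  moreover have "rtrig (\<lambda>x. p x * f 1)" by (intro rtrig_mult p rtrig_const)
  ultimately show ?case by (simp only:)
qed (intro rtrig_const rtrig_add rtrig_mult; assumption)+

lemma rtrig_continuous: "rtrig h \<Longrightarrow> continuous_on S h"
  using continuous_on_Re[OF continuous_on_subset[OF trig_continuous, of "\<lambda>x. complex_of_real (h x)" S]]
  by (simp add: rtrig_def)

text \<open>A trigonometric polynomial close to \<open>f\<close> on a box may be large elsewhere; composing it with an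
  ordinary polynomial close to a truncation makes it globally bounded.\<close>

lemma rtrig_dense:
  fixes f :: "'a::euclidean_space \<Rightarrow> real"
  assumes f: "continuous_on UNIV f" and M: "\<And>x. \<bar>f x\<bar> \<le> M" and e: "e > 0" and R: "R \<ge> 0"
  obtains g where "rtrig g" "\<And>x. \<bar>g x\<bar> \<le> M + e" "\<And>x. (\<forall>b\<in>Basis. \<bar>x \<bullet> b\<bar> \<le> R) \<Longrightarrow> \<bar>f x - g x\<bar> < 2 * e"
proof -
  let ?K = "cbox (- (R *\<^sub>R One)) (R *\<^sub>R One) :: 'a set"
  have K: "x \<in> ?K \<longleftrightarrow> (\<forall>b\<in>Basis. \<bar>x \<bullet> b\<bar> \<le> R)" for x
    by (auto simp: mem_box abs_le_iff minus_le_iff)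
  have "\<exists>p. rtrig p \<and> (\<forall>x\<in>?K. \<bar>f x - p x\<bar> < e)"
  proof (rule Stone_Weierstrass_HOL)
    show "\<exists>h. rtrig h \<and> h x \<noteq> h y" if xy: "x \<in> ?K \<and> y \<in> ?K \<and> x \<noteq> y" for x y
    proof -
      obtain b where b: "b \<in> Basis" "x \<bullet> b \<noteq> y \<bullet> b" using xy by (metis euclidean_eqI)
      \<comment> \<open>The scaling keeps the argument of the sine in [-1, 1], where sine is
        injective, so points that differ in one coordinate are separated.\<close>
      let ?\<xi> = "(1 / (R + 1)) *\<^sub>R b"
      have le: "\<bar>?\<xi> \<bullet> z\<bar> \<le> pi / 2" if "z \<in> ?K" for z
      proof -
        have "\<bar>z \<bullet> b\<bar> \<le> R" using that b K by blast
        then have "\<bar>?\<xi> \<bullet> z\<bar> \<le> 1" using R by (simp add: inner_commute divide_le_eq abs_mult)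
        then show ?thesis using pi_ge_two by linarith
      qed
      have "?\<xi> \<bullet> x \<noteq> ?\<xi> \<bullet> y" using b R by (simp add: inner_commute)
      moreover have "- (pi / 2) \<le> ?\<xi> \<bullet> z \<and> ?\<xi> \<bullet> z \<le> pi / 2" if "z \<in> ?K" for z
        using le[OF that] by linarith
      ultimately have "sin (?\<xi> \<bullet> x) \<noteq> sin (?\<xi> \<bullet> y)"
        using sin_inj_pi[of "?\<xi> \<bullet> x" "?\<xi> \<bullet> y"] xy by blast
      then show ?thesis using rtrig_sin[of ?\<xi>] by blast
    qed
  qed (use f e in \<open>auto intro: rtrig_const rtrig_add rtrig_mult rtrig_continuous continuous_on_subset\<close>)
  then obtain p where p: "rtrig p" "\<And>x. x \<in> ?K \<Longrightarrow> \<bar>f x - p x\<bar> < e" by blast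
  obtain B where "\<And>x. norm (complex_of_real (p x)) \<le> B"
    using trig_bounded p(1) unfolding rtrig_def by blast
  then have B: "\<bar>p x\<bar> \<le> B" for x by simp
  let ?c = "\<lambda>s. max (- M) (min M s)"
  have M0: "0 \<le> M" using M[of 0] by linarith
  have "continuous_on {-B..B} ?c" by (intro continuous_intros)
  then obtain q where q: "real_polynomial_function q" "\<And>s. s \<in> {-B..B} \<Longrightarrow> \<bar>?c s - q s\<bar> < e"
    using Stone_Weierstrass_real_polynomial_function[of "{-B..B}" ?c e] e by (metis compact_Icc)
  show thesis
  proof (rule that)
    show "rtrig (\<lambda>x. q (p x))" by (rule rtrig_polynomial[OF p(1) q(1)])
    have qc: "\<bar>?c (p x) - q (p x)\<bar> < e" for x
      using q(2)[of "p x"] B[of x] by (auto simp: abs_le_iff)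
    show "\<bar>q (p x)\<bar> \<le> M + e" for x
      using qc[of x] M0 by linarith
    show "\<bar>f x - q (p x)\<bar> < 2 * e" if "\<forall>b\<in>Basis. \<bar>x \<bullet> b\<bar> \<le> R" for x
      using qc[of x] p(2)[of x] that M[of x] K[of x] by linarith
  qed
qed

text \<open>A continuous substitute for the indicator of large values, zero up to R and one from
  \<open>R + 1\<close> on; continuity lets weak convergence control tails.\<close>

definition cutoff :: "real \<Rightarrow> real \<Rightarrow> real" where
  "cutoff R s = min 1 (max 0 (\<bar>s\<bar> - R))"

lemma cutoff_bounds: "0 \<le> cutoff R s" "cutoff R s \<le> 1"
  by (simp_all add: cutoff_def)

lemma cutoff_eq_1: "R + 1 \<le> \<bar>s\<bar> \<Longrightarrow> cutoff R s = 1"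
  by (simp add: cutoff_def)

lemma cutoff_continuous [continuous_intros]:
  "continuous_on S f \<Longrightarrow> continuous_on S (\<lambda>x. cutoff R (f x))"
  unfolding cutoff_def by (intro continuous_intros)

lemma cutoff_tendsto_0:
  fixes \<mu> :: "('a::euclidean_space) measure"
  assumes P: "prob_space \<mu>" "sets \<mu> = sets borel"
  shows "(\<lambda>n. \<integral>x. cutoff (real n) (x \<bullet> b) \<partial>\<mu>) \<longlonglongrightarrow> 0"
proof -
  interpret prob_space \<mu> by fact
  have "(\<lambda>n. \<integral>x. cutoff (real n) (x \<bullet> b) \<partial>\<mu>) \<longlonglongrightarrow> (\<integral>x. 0 \<partial>\<mu>)"
  proof (rule integral_dominated_convergence[where w = "\<lambda>_. 1"])
    show "AE x in \<mu>. (\<lambda>n. cutoff (real n) (x \<bullet> b)) \<longlonglongrightarrow> 0"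
    proof (intro AE_I2 tendsto_eventually)
      fix x
      obtain N where "\<bar>x \<bullet> b\<bar> \<le> real N" using real_arch_simple by blast
      then have "cutoff (real n) (x \<bullet> b) = 0" if "n \<ge> N" for n
        using that by (simp add: cutoff_def)
      then show "\<forall>\<^sub>F n in sequentially. cutoff (real n) (x \<bullet> b) = 0"
        by (rule eventually_sequentiallyI)
    qed
    show "(\<lambda>x. cutoff (real n) (x \<bullet> b)) \<in> borel_measurable \<mu>" for n
      unfolding measurable_cong_sets[OF P(2) refl]
      by (intro borel_measurable_continuous_onI continuous_intros)
  qed (auto simp: cutoff_bounds)
  then show ?thesis by simp
qed

text \<open>The marginal along b has at t the characteristic function of the measure at
  \<open>t *\<^sub>R b\<close>, so the one-dimensional continuity theorem applies. Summed over a
  basis this supplies tightness.\<close>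

lemma marginal_cutoff_tendsto:
  fixes \<mu> :: "('a::euclidean_space) measure"
  assumes P: "\<And>k. prob_space (\<mu>s k)" "\<And>k. sets (\<mu>s k) = sets borel" "prob_space \<mu>" "sets \<mu> = sets borel"
    and char: "\<And>\<xi>. (\<lambda>k. \<integral>x. cis (\<xi> \<bullet> x) \<partial>\<mu>s k) \<longlonglongrightarrow> (\<integral>x. cis (\<xi> \<bullet> x) \<partial>\<mu>)"
  shows "(\<lambda>k. \<integral>x. cutoff R (x \<bullet> b) \<partial>\<mu>s k) \<longlonglongrightarrow> (\<integral>x. cutoff R (x \<bullet> b) \<partial>\<mu>)"
proof -
  have m: "(\<lambda>x. x \<bullet> b) \<in> borel_measurable M" if "sets M = sets borel" for M :: "'a measure"
    unfolding measurable_cong_sets[OF that refl] by (intro borel_measurable_continuous_onI continuous_intros)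
  let ?D = "\<lambda>M. distr M borel (\<lambda>x. x \<bullet> b)"
  have rd: "real_distribution (?D M)" if "prob_space M" "sets M = sets borel" for M
    using that m by (intro prob_space.real_distribution_distr) auto
  have ch: "char (?D M) t = (\<integral>x. cis ((t *\<^sub>R b) \<bullet> x) \<partial>M)" if "sets M = sets borel" for M t
    unfolding char_def using m[OF that] by (subst integral_distr) (auto simp: cis_conv_exp inner_commute)
  have "weak_conv_m (\<lambda>k. ?D (\<mu>s k)) (?D \<mu>)"
    by (rule levy_continuity) (simp_all only: rd P ch char)
  then have "(\<lambda>k. \<integral>s. cutoff R s \<partial>?D (\<mu>s k)) \<longlonglongrightarrow> (\<integral>s. cutoff R s \<partial>?D \<mu>)"
  proof (rule weak_conv_imp_integral_bdd_continuous_conv[rotated 2])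
    have "continuous_on UNIV (cutoff R)" by (intro continuous_intros)
    then show "isCont (cutoff R) x" for x by (simp add: continuous_on_eq_continuous_at)
    show "norm (cutoff R x) \<le> 1" for x using cutoff_bounds[of R x] by simp
  qed (auto simp: rd P)
  moreover have "(\<integral>s. cutoff R s \<partial>?D M) = (\<integral>x. cutoff R (x \<bullet> b) \<partial>M)" if "sets M = sets borel" for M
    using m[OF that]
    by (intro integral_distr borel_measurable_continuous_onI continuous_intros)
  ultimately show ?thesis by (simp add: P)
qed

theorem levy_continuity_euclidean:
  fixes f :: "'a::euclidean_space \<Rightarrow> real"
  assumes P: "\<And>k. prob_space (\<mu>s k)" "\<And>k. sets (\<mu>s k) = sets borel" "prob_space \<mu>" "sets \<mu> = sets borel"
    and char: "\<And>\<xi>. (\<lambda>k. \<integral>x. cis (\<xi> \<bullet> x) \<partial>\<mu>s k) \<longlonglongrightarrow> (\<integral>x. cis (\<xi> \<bullet> x) \<partial>\<mu>)"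
    and f: "continuous_on UNIV f" "\<And>x. \<bar>f x\<bar> \<le> M"
  shows "(\<lambda>k. \<integral>x. f x \<partial>\<mu>s k) \<longlonglongrightarrow> (\<integral>x. f x \<partial>\<mu>)"
proof (rule LIMSEQ_I)
  fix r :: real assume r: "r > 0"
  have M0: "0 \<le> M" using f(2)[of 0] by linarith
  \<comment> \<open>Either replacement of f by g costs less than 3e and the convergence for g less
    than e, in all 7e. The bound by 1 makes \<open>2 * M + 1\<close> dominate the difference of f
    and g off the box.\<close>
  define e where "e = min 1 (r / 8)"
  have e: "0 < e" "e \<le> 1" "8 * e \<le> r" using r by (auto simp: e_def)
  let ?h = "\<lambda>R x. \<Sum>b\<in>Basis. cutoff (real R) (x \<bullet> b)"
  have int: "integrable N g" if "N = \<mu> \<or> (\<exists>k. N = \<mu>s k)" "continuous_on UNIV g" "\<And>x. \<bar>g x\<bar> \<le> B"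
    for g :: "'a \<Rightarrow> real" and B N
    using that P by (intro integrable_bounded_continuous[of N g B]) auto
  have inth: "integrable N (\<lambda>x. cutoff R (x \<bullet> b))" if "N = \<mu> \<or> (\<exists>k. N = \<mu>s k)" for N R b
    using that cutoff_bounds by (intro int[of _ _ 1]) (auto intro!: continuous_intros)
  have hsum: "(\<integral>x. ?h R x \<partial>N) = (\<Sum>b\<in>Basis. \<integral>x. cutoff (real R) (x \<bullet> b) \<partial>N)"
    if "N = \<mu> \<or> (\<exists>k. N = \<mu>s k)" for N R
    by (rule Bochner_Integration.integral_sum) (rule inth[OF that])
  have "(\<lambda>R. \<integral>x. ?h R x \<partial>\<mu>) \<longlonglongrightarrow> (\<Sum>b\<in>(Basis::'a set). 0)"
    unfolding hsum[OF disjI1[OF refl]] by (intro tendsto_sum cutoff_tendsto_0 P)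
  then have "\<forall>\<^sub>F R in sequentially. (\<integral>x. ?h R x \<partial>\<mu>) < e / (2 * M + 1)"
    using e M0 by (intro order_tendstoD(2)) auto
  then obtain R where R: "(\<integral>x. ?h R x \<partial>\<mu>) < e / (2 * M + 1)"
    by (meson eventually_sequentially order_refl)
  obtain g where g: "rtrig g" "\<And>x. \<bar>g x\<bar> \<le> M + e"
    "\<And>x. (\<forall>b\<in>Basis. \<bar>x \<bullet> b\<bar> \<le> real R + 1) \<Longrightarrow> \<bar>f x - g x\<bar> < 2 * e"
    using rtrig_dense[OF f e(1), of "real R + 1"] by auto
  have gc: "continuous_on UNIV g" by (rule rtrig_continuous[OF g(1)])
  have close: "\<bar>f x - g x\<bar> \<le> 2 * e + (2 * M + 1) * ?h R x" for x
  proof (cases "\<forall>b\<in>Basis. \<bar>x \<bullet> b\<bar> \<le> real R + 1")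
    case True
    have "0 \<le> (2 * M + 1) * ?h R x" using M0 by (intro mult_nonneg_nonneg sum_nonneg) (auto simp: cutoff_bounds)
    then show ?thesis using g(3)[OF True] by linarith
  next
    case False
    then obtain b where b: "b \<in> Basis" "real R + 1 \<le> \<bar>x \<bullet> b\<bar>" by force
    have "1 = cutoff (real R) (x \<bullet> b)" using b by (simp add: cutoff_eq_1)
    also have "\<dots> \<le> ?h R x" using b by (intro member_le_sum) (auto simp: cutoff_bounds)
    finally have "(2 * M + 1) * 1 \<le> (2 * M + 1) * ?h R x" using M0 by (intro mult_left_mono) auto
    moreover have "\<bar>f x - g x\<bar> \<le> 2 * M + 1" using f(2)[of x] g(2)[of x] e(2) by linarith
    ultimately have "\<bar>f x - g x\<bar> \<le> (2 * M + 1) * ?h R x" by (simp only: mult_1_right order_trans)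
    then show ?thesis by (rule order_trans) (use e in simp)
  qed
  have fg: "\<bar>(\<integral>x. f x \<partial>N) - (\<integral>x. g x \<partial>N)\<bar> \<le> 2 * e + (2 * M + 1) * (\<integral>x. ?h R x \<partial>N)"
    if N: "N = \<mu> \<or> (\<exists>k. N = \<mu>s k)" for N
  proof -
    interpret prob_space N using N P by auto
    have i: "integrable N f" "integrable N g" "integrable N (?h R)"
      using int[OF N f] int[OF N gc g(2)] inth[OF N] by auto
    have "\<bar>(\<integral>x. f x \<partial>N) - (\<integral>x. g x \<partial>N)\<bar> = \<bar>\<integral>x. f x - g x \<partial>N\<bar>" using i by simp
    also have "\<dots> \<le> (\<integral>x. \<bar>f x - g x\<bar> \<partial>N)" by (rule integral_abs_bound)
    also have "\<dots> \<le> (\<integral>x. 2 * e + (2 * M + 1) * ?h R x \<partial>N)"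
      using i close by (intro integral_mono) auto
    also have "\<dots> = 2 * e + (2 * M + 1) * (\<integral>x. ?h R x \<partial>N)"
      using i by (simp add: prob_space)
    finally show ?thesis .
  qed
  have "(\<lambda>k. \<integral>x. ?h R x \<partial>\<mu>s k) \<longlonglongrightarrow> (\<integral>x. ?h R x \<partial>\<mu>)"
  proof -
    have "(\<integral>x. ?h R x \<partial>\<mu>s k) = (\<Sum>b\<in>Basis. \<integral>x. cutoff (real R) (x \<bullet> b) \<partial>\<mu>s k)" for k
      by (rule hsum) blast
    then show ?thesis
      unfolding hsum[OF disjI1[OF refl]] by (simp only:) (intro tendsto_sum marginal_cutoff_tendsto P char)
  qed
  then have ev1: "\<forall>\<^sub>F k in sequentially. (\<integral>x. ?h R x \<partial>\<mu>s k) < e / (2 * M + 1)"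
    using R by (rule order_tendstoD)
  have "(\<lambda>k. \<integral>x. g x \<partial>\<mu>s k) \<longlonglongrightarrow> (\<integral>x. g x \<partial>\<mu>)"
    using tendsto_Re[OF trig_integral_tendsto[OF P char g(1)[unfolded rtrig_def]]] by simp
  then have ev2: "\<forall>\<^sub>F k in sequentially. \<bar>(\<integral>x. g x \<partial>\<mu>s k) - (\<integral>x. g x \<partial>\<mu>)\<bar> < e"
    using e by (auto simp: tendsto_iff dist_real_def)
  from ev1 ev2 have "\<forall>\<^sub>F k in sequentially. \<bar>(\<integral>x. f x \<partial>\<mu>s k) - (\<integral>x. f x \<partial>\<mu>)\<bar> < r"
  proof eventually_elim
    case (elim k)
    have lt: "(2 * M + 1) * y < e" if "y < e / (2 * M + 1)" for y
      using that M0 by (simp add: less_divide_eq mult.commute)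
    have "\<bar>(\<integral>x. f x \<partial>\<mu>s k) - (\<integral>x. g x \<partial>\<mu>s k)\<bar> \<le> 2 * e + (2 * M + 1) * (\<integral>x. ?h R x \<partial>\<mu>s k)"
      by (rule fg) blast
    moreover have "\<bar>(\<integral>x. f x \<partial>\<mu>) - (\<integral>x. g x \<partial>\<mu>)\<bar> \<le> 2 * e + (2 * M + 1) * (\<integral>x. ?h R x \<partial>\<mu>)"
      by (rule fg) blast
    ultimately show ?case
      using lt[OF R] lt[OF elim(1)] elim(2) e by linarith
  qed
  then show "\<exists>no. \<forall>n\<ge>no. norm ((\<integral>x. f x \<partial>\<mu>s n) - (\<integral>x. f x \<partial>\<mu>)) < r"
    by (simp add: eventually_sequentially)
qed

section \<open>Existence of centered normal distributions\<close>

text \<open>Elimination in the manner of Cholesky: S contains the basis vectors not yet known to lie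
  in the radical of b, and each step splits off the square of one linear form.\<close>

lemma psd_sum_of_squares:
  fixes b :: "'a::euclidean_space \<Rightarrow> 'a \<Rightarrow> real"
  assumes "finite S" "S \<subseteq> Basis" "bilinear b" "\<And>v w. b v w = b w v" "\<And>v. 0 \<le> b v v"
    "\<And>k v. k \<in> Basis - S \<Longrightarrow> b k v = 0"
  shows "\<exists>\<beta>. (\<forall>i\<in>S. linear (\<beta> i)) \<and> (\<forall>v w. b v w = (\<Sum>i\<in>S. \<beta> i v * \<beta> i w))"
  using assms
proof (induction S arbitrary: b rule: finite_induct)
  case empty
  have "b v w = 0" for v w
  proof -
    have lin: "linear (\<lambda>v. b v w)" using empty.prems(2) by (simp add: bilinear_def)
    have "b v w = b (\<Sum>k\<in>Basis. (v \<bullet> k) *\<^sub>R k) w" by (simp add: euclidean_representation)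
    also have "\<dots> = (\<Sum>k\<in>Basis. (v \<bullet> k) *\<^sub>R b k w)"
      by (simp only: linear_sum[OF lin] linear_cmul[OF lin])
    also have "\<dots> = 0" using empty.prems(5) by simp
    finally show ?thesis .
  qed
  then show ?case by simp
next
  case (insert s S)
  note bil = insert.prems(2) and sym = insert.prems(3) and psd = insert.prems(4)
  have linl: "linear (\<lambda>v. b v w)" for w using bil by (simp add: bilinear_def)
  have linr: "linear (\<lambda>w. b v w)" for v using bil by (simp add: bilinear_def)
  have expand: "b (v + c *\<^sub>R s) (v + c *\<^sub>R s) = b v v + 2 * c * b s v + c\<^sup>2 * b s s" for v c
    using sym[of v s] by (simp add: linear_add[OF linl] linear_add[OF linr] linear_cmul[OF linl]
        linear_cmul[OF linr] power2_eq_square algebra_simps)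
  show ?case
  proof (cases "b s s = 0")
    case True
    have "b s v = 0" for v
    proof (rule ccontr)
      assume nz: "b s v \<noteq> 0"
      \<comment> \<open>A null vector of a semidefinite form lies in its radical: with this c the
        quadratic expression along s would equal -1.\<close>
      define c where "c = - (b v v + 1) / (2 * b s v)"
      have "c * b s v = - (b v v + 1) / 2" using nz by (simp add: c_def)
      moreover have "0 \<le> b v v + 2 * (c * b s v)"
        using psd[of "v + c *\<^sub>R s"] unfolding expand True by simp
      ultimately show False by simp
    qed
    then have "b k v = 0" if "k \<in> Basis - S" for k v
      using insert.prems(5)[of k v] that by (cases "k = s") auto
    then obtain \<beta> where \<beta>: "\<forall>i\<in>S. linear (\<beta> i)" "\<forall>v w. b v w = (\<Sum>i\<in>S. \<beta> i v * \<beta> i w)"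
      using insert.IH[of b] insert.prems by blast
    then show ?thesis
      using insert.hyps by (intro exI[of _ "\<beta>(s := \<lambda>_. 0)"])
        (auto simp: linear_zero intro!: sum.cong)
  next
    case False
    then have pos: "b s s > 0" using psd[of s] by simp
    define l where "l v = b s v / sqrt (b s s)" for v
    have lin_l: "linear l"
      unfolding l_def by (intro linearI)
        (simp_all add: linear_add[OF linr] linear_cmul[OF linr] add_divide_distrib)
    have ll: "l v * l w = b s v * b s w / b s s" for v w using pos by (simp add: l_def)
    define b' where "b' v w = b v w - l v * l w" for v w
    have "\<exists>\<beta>. (\<forall>i\<in>S. linear (\<beta> i)) \<and> (\<forall>v w. b' v w = (\<Sum>i\<in>S. \<beta> i v * \<beta> i w))"
    proof (rule insert.IH)
      show "S \<subseteq> Basis" using insert.prems by simp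
      show "bilinear b'"
        unfolding bilinear_def b'_def
        by (intro conjI allI linearI) (simp_all add: linear_add[OF linl] linear_add[OF linr]
            linear_cmul[OF linl] linear_cmul[OF linr] linear_add[OF lin_l] linear_cmul[OF lin_l] algebra_simps)
      show "b' v w = b' w v" for v w by (simp add: b'_def sym[of v w])
      show "0 \<le> b' v v" for v
      proof -
        \<comment> \<open>The coefficient of s minimises the quadratic expression along s, and the
          minimum is exactly \<open>b' v v\<close>.\<close>
        have "0 \<le> b v v + 2 * (- b s v / b s s) * b s v + (- b s v / b s s)\<^sup>2 * b s s"
          using psd[of "v + (- b s v / b s s) *\<^sub>R s"] unfolding expand .
        also have "\<dots> = b' v v" using pos by (simp add: b'_def ll power2_eq_square field_simps)
        finally show ?thesis .
      qed
      show "b' k v = 0" if "k \<in> Basis - S" for k v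
      proof (cases "k = s")
        case True
        then show ?thesis using pos by (simp add: b'_def ll)
      next
        case False
        then have "b k w = 0" for w using insert.prems(5) that by blast
        moreover have "b s k = b k s" by (rule sym)
        ultimately show ?thesis by (simp add: b'_def ll)
      qed
    qed
    then obtain \<beta> where \<beta>: "\<forall>i\<in>S. linear (\<beta> i)" "\<forall>v w. b' v w = (\<Sum>i\<in>S. \<beta> i v * \<beta> i w)" by blast
    have "b v w = (\<Sum>i\<in>insert s S. (\<beta>(s := l)) i v * (\<beta>(s := l)) i w)" for v w
    proof -
      have "(\<Sum>i\<in>S. (\<beta>(s := l)) i v * (\<beta>(s := l)) i w) = b' v w"
        using insert.hyps \<beta>(2) by (auto intro!: sum.cong)
      then show ?thesis using insert.hyps by (simp add: b'_def)
    qed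
    then show ?thesis using \<beta>(1) lin_l by (intro exI[of _ "\<beta>(s := l)"]) auto
  qed
qed

text \<open>Independent standard normals combined with the vectors representing the forms
  \<open>\<beta> i\<close> have the required quadratic form. Degenerate covariances are
  included.\<close>

lemma normal_exists:
  fixes b :: "'a::euclidean_space \<Rightarrow> 'a \<Rightarrow> real"
  assumes "bilinear b" "\<And>v w. b v w = b w v" "\<And>v. 0 \<le> b v v"
  shows "\<exists>\<mu>. prob_space \<mu> \<and> sets \<mu> = sets borel \<and>
    (\<forall>\<xi>. (\<integral>x. cis (\<xi> \<bullet> x) \<partial>\<mu>) = complex_of_real (exp (- b \<xi> \<xi> / 2)))"
proof -
  obtain \<beta> where \<beta>: "\<And>i. i \<in> Basis \<Longrightarrow> linear (\<beta> i)" "\<And>v w. b v w = (\<Sum>i\<in>(Basis::'a set). \<beta> i v * \<beta> i w)"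
    using psd_sum_of_squares[OF finite_Basis subset_refl assms] by blast
  define c where "c i = adjoint (\<beta> i) 1" for i
  have c: "\<xi> \<bullet> c i = \<beta> i \<xi>" if "i \<in> Basis" for i \<xi>
    using adjoint_works[OF \<beta>(1)[OF that], of \<xi> 1] by (simp add: c_def)
  interpret N: real_distribution std_normal_distribution by (rule real_dist_normal_dist)
  interpret PN: product_prob_space "\<lambda>_::'a. std_normal_distribution" Basis ..
  let ?P = "PiM (Basis::'a set) (\<lambda>_. std_normal_distribution)"
  have P: "prob_space ?P" by (rule prob_space_PiM) (rule N.prob_space_axioms)
  define X where "X \<omega> = (\<Sum>i\<in>Basis. \<omega> i *\<^sub>R c i)" for \<omega> :: "'a \<Rightarrow> real"
  have X: "X \<in> borel_measurable ?P" unfolding X_def by measurable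
  have "(\<integral>x. cis (\<xi> \<bullet> x) \<partial>distr ?P borel X) = complex_of_real (exp (- b \<xi> \<xi> / 2))" for \<xi>
  proof -
    have "(\<integral>x. cis (\<xi> \<bullet> x) \<partial>distr ?P borel X) = (\<integral>\<omega>. cis (\<xi> \<bullet> X \<omega>) \<partial>?P)"
      unfolding cis_conv_exp by (intro integral_distr X borel_measurable_continuous_onI continuous_intros)
    also have "\<dots> = (\<integral>\<omega>. (\<Prod>i\<in>Basis. iexp (\<beta> i \<xi> * \<omega> i)) \<partial>?P)"
      by (simp add: X_def inner_sum_right c cis_conv_exp exp_sum[symmetric] sum_distrib_left mult.commute)
    also have "\<dots> = (\<Prod>i\<in>(Basis::'a set). \<integral>s. iexp (\<beta> i \<xi> * s) \<partial>std_normal_distribution)"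
      by (rule PN.product_integral_prod) (auto intro!: N.integrable_iexp simp flip: of_real_mult)
    also have "\<dots> = (\<Prod>i\<in>(Basis::'a set). complex_of_real (exp (- ((\<beta> i \<xi>)\<^sup>2) / 2)))"
      using char_std_normal_distribution by (simp add: char_def fun_eq_iff)
    also have "\<dots> = complex_of_real (exp (\<Sum>i\<in>Basis. - ((\<beta> i \<xi>)\<^sup>2) / 2))"
      by (simp add: exp_sum)
    also have "(\<Sum>i\<in>Basis. - ((\<beta> i \<xi>)\<^sup>2) / 2) = - b \<xi> \<xi> / 2"
      by (simp add: \<beta>(2) power2_eq_square sum_divide_distrib sum_negf)
    finally show ?thesis .
  qed
  then show ?thesis
    using prob_space.prob_space_distr[OF P X] by (intro exI[of _ "distr ?P borel X"]) auto
qed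

lemma is_normal_cov_exists:
  fixes Sig :: "real^'n^('n::finite)"
  assumes sym: "\<And>j l. Sig$j$l = Sig$l$j" and psd: "\<And>\<xi>::real^'n. 0 \<le> (\<Sum>j\<in>UNIV. \<Sum>l\<in>UNIV. \<xi>$j * Sig$j$l * \<xi>$l)"
  shows "\<exists>\<mu>. is_normal_cov Sig \<mu>"
proof -
  let ?b = "\<lambda>v w :: real^'n. \<Sum>j\<in>UNIV. \<Sum>l\<in>UNIV. v$j * Sig$j$l * w$l"
  have "bilinear ?b"
    unfolding bilinear_def
    by (intro conjI allI linearI) (simp_all add: sum.distrib sum_distrib_left algebra_simps)
  moreover have "?b v w = ?b w v" for v w
    by (subst sum.swap) (simp add: sym mult_ac)
  ultimately show ?thesis
    using normal_exists[of ?b] psd unfolding is_normal_cov_def by blast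
qed

section \<open>Characteristic functions in the central limit theorem\<close>

text \<open>The frequency is absorbed into W, so that one value of the characteristic function is
  enough: standardised sums evaluated at \<sigma> are the sums divided by \<open>sqrt n\<close>
  evaluated at 1. For zero variance the sums vanish almost surely and no standardisation is
  possible.\<close>

lemma (in prob_space) central_limit_char:
  fixes W :: "nat \<Rightarrow> 'a \<Rightarrow> real"
  assumes ind: "indep_vars (\<lambda>_. borel) W UNIV" and mean: "\<And>n. expectation (W n) = 0"
    and sq: "\<And>n. integrable M (\<lambda>x. (W n x)\<^sup>2)" and var: "\<And>n. expectation (\<lambda>x. (W n x)\<^sup>2) = v"
    and dist: "\<And>n. distr M borel (W n) = \<mu>"
  shows "(\<lambda>n. \<integral>x. cis ((\<Sum>i<n. W i x) / sqrt (real n)) \<partial>M) \<longlonglongrightarrow> complex_of_real (exp (- v / 2))"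
proof -
  have rv [measurable]: "random_variable borel (W n)" for n
    using ind unfolding indep_vars_def2 by simp
  have "v \<ge> 0" using var[of 0] by (metis Bochner_Integration.integral_nonneg zero_le_power2)
  then consider "v = 0" | "v > 0" by linarith
  then show ?thesis
  proof cases
    case 1
    have "AE x in M. W n x = 0" for n
      using integral_nonneg_eq_0_iff_AE[OF sq[of n]] var[of n] 1 by simp
    then have "AE x in M. \<forall>n. W n x = 0" by (simp add: AE_all_countable)
    then have "AE x in M. cis ((\<Sum>i<n. W i x) / sqrt (real n)) = 1" for n by eventually_elim simp
    then have "(\<integral>x. cis ((\<Sum>i<n. W i x) / sqrt (real n)) \<partial>M) = (\<integral>x. 1 \<partial>M)" for n
      by (intro integral_cong_AE) (auto simp: cis_conv_exp)
    then show ?thesis using 1 by (simp add: prob_space)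
  next
    case 2
    define \<sigma> where "\<sigma> = sqrt v"
    have \<sigma>: "\<sigma> > 0" "\<sigma>\<^sup>2 = v" using 2 by (simp_all add: \<sigma>_def)
    have "weak_conv_m (\<lambda>n. distr M borel (\<lambda>x. (\<Sum>i<n. W i x) / sqrt (real n * \<sigma>\<^sup>2))) std_normal_distribution"
      by (rule central_limit_theorem_zero_mean[OF ind mean \<sigma>(1) sq _ dist]) (simp add: mean var \<sigma>)
    then have "(\<lambda>n. char (distr M borel (\<lambda>x. (\<Sum>i<n. W i x) / sqrt (real n * \<sigma>\<^sup>2))) \<sigma>)
        \<longlonglongrightarrow> char std_normal_distribution \<sigma>"
      by (intro levy_continuity1 real_distribution_distr real_dist_normal_dist) auto
    moreover have "char (distr M borel (\<lambda>x. (\<Sum>i<n. W i x) / sqrt (real n * \<sigma>\<^sup>2))) \<sigma>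
        = (\<integral>x. cis ((\<Sum>i<n. W i x) / sqrt (real n)) \<partial>M)" for n
    proof -
      have "\<sigma> * (s / sqrt (real n * \<sigma>\<^sup>2)) = s / sqrt (real n)" for s
        using \<sigma>(1) by (simp add: real_sqrt_mult)
      then show ?thesis
        unfolding char_def by (subst integral_distr) (auto simp: cis_conv_exp simp flip: of_real_mult)
    qed
    ultimately show ?thesis
      using \<sigma> by (simp add: char_std_normal_distribution)
  qed
qed

section \<open>Right-invariant laws on the general linear group\<close>

definition GL_law :: "nat \<Rightarrow> ('n::finite) fmat measure \<Rightarrow> bool" where
  "GL_law d N \<longleftrightarrow> prob_space N \<and> sets N = sets borel \<and> emeasure N (GLF d) = 1"

definition right_invariant :: "nat \<Rightarrow> ('n::finite) fmat measure \<Rightarrow> bool" where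
  "right_invariant d N \<longleftrightarrow> (\<forall>v\<in>UF d. distr N borel (\<lambda>g. g \<otimes> v) = N)"

lemma GL_law_prob: "GL_law d N \<Longrightarrow> prob_space N"
  and GL_law_sets: "GL_law d N \<Longrightarrow> sets N = sets borel"
  by (simp_all add: GL_law_def)

lemma GL_law_AE:
  fixes N :: "('n::{finite,linorder}) fmat measure"
  assumes "GL_law d N"
  shows "AE g in N. g \<in> GLF d"
proof -
  interpret prob_space N using assms by (rule GL_law_prob)
  have "GLF d \<in> events" using GL_law_sets[OF assms] by simp
  moreover have "prob (GLF d) = 1" using assms by (simp add: GL_law_def measure_def)
  ultimately show ?thesis by (simp add: prob_eq_1)
qed

lemma GL_lawI:
  fixes N :: "('n::{finite,linorder}) fmat measure"
  assumes "prob_space N" "sets N = sets borel" "AE g in N. g \<in> GLF d"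
  shows "GL_law d N"
proof -
  interpret prob_space N by fact
  have "emeasure N (GLF d) = 1"
    using assms by (intro emeasure_eq_1_AE) auto
  then show ?thesis using assms by (simp add: GL_law_def)
qed

lemma is_haar_GL_law:
  fixes H :: "('n::{finite,linorder}) fmat measure"
  shows "is_haar d H \<Longrightarrow> GL_law d H"
  using is_haar_AE_UF[of d H]
  by (intro GL_lawI) (auto simp: is_haar_def elim!: eventually_mono intro: UF_GLF)

text \<open>Equivariance \<open>QU d (v \<otimes> g) = v \<otimes> QU d g\<close> passes left
  invariance on to the unitary factor.\<close>

lemma is_haar_QU_distr:
  fixes N :: "('n::{finite,linorder}) fmat measure"
  assumes N: "GL_law d N" and inv: "\<And>v. v \<in> UF d \<Longrightarrow> distr N borel (fmul v) = N"
  shows "is_haar d (distr N borel (QU d))"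
proof -
  note [measurable_cong] = GL_law_sets[OF N]
  interpret prob_space N using N by (rule GL_law_prob)
  have "QU d -` UF d \<inter> space N = space N" by auto
  then have "emeasure (distr N borel (QU d)) (UF d) = 1"
    by (simp add: emeasure_distr emeasure_space_1)
  moreover have "distr (distr N borel (QU d)) borel (fmul v) = distr N borel (QU d)" if v: "v \<in> UF d" for v
  proof -
    have [measurable]: "fmul v \<in> borel_measurable borel" by measurable
    have "distr (distr N borel (QU d)) borel (fmul v) = distr N borel (\<lambda>g. v \<otimes> QU d g)"
      by (subst distr_distr) (simp_all add: o_def)
    also have "\<dots> = distr N borel (\<lambda>g. QU d (v \<otimes> g))"
    proof (rule distr_cong_AE)
      show "AE g in N. v \<otimes> QU d g = QU d (v \<otimes> g)"
        using GL_law_AE[OF N] by eventually_elim (simp add: QU_UF_fmul v)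
    qed simp_all
    also have "\<dots> = distr (distr N borel (fmul v)) borel (QU d)"
      by (subst distr_distr) (simp_all add: o_def)
    finally show ?thesis by (simp add: inv[OF v])
  qed
  moreover have "prob_space (distr N borel (QU d))" by (rule prob_space_distr) simp
  ultimately show ?thesis by (simp add: is_haar_def)
qed

text \<open>For fixed u the law of \<open>g \<otimes> u\<close> is already that of g, so an
  independent Haar factor may be inserted freely. It provides the randomness that the singular value
  decomposition moves next to \<open>ediag t\<close>.\<close>

lemma right_invariant_distr_haar:
  fixes N H :: "('n::{finite,linorder}) fmat measure"
  assumes N: "GL_law d N" "right_invariant d N" and H: "is_haar d H"
  shows "distr (N \<Otimes>\<^sub>M H) borel (\<lambda>(g, u). g \<otimes> u) = N"
proof (rule measure_eqI)
  note [measurable_cong] = GL_law_sets[OF N(1)] GL_law_sets[OF is_haar_GL_law[OF H]]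
  interpret N: prob_space N using N(1) by (rule GL_law_prob)
  interpret H: prob_space H using H by (simp add: is_haar_def)
  interpret pair_sigma_finite N H ..
  show "sets (distr (N \<Otimes>\<^sub>M H) borel (\<lambda>(g, u). g \<otimes> u)) = sets N"
    by (simp add: GL_law_sets[OF N(1)])
  fix A assume "A \<in> sets (distr (N \<Otimes>\<^sub>M H) borel (\<lambda>(g, u). g \<otimes> u))"
  then have A [measurable]: "A \<in> sets borel" by simp
  have "emeasure (distr (N \<Otimes>\<^sub>M H) borel (\<lambda>(g, u). g \<otimes> u)) A
      = (\<integral>\<^sup>+p. indicator A p \<partial>distr (N \<Otimes>\<^sub>M H) borel (\<lambda>(g, u). g \<otimes> u))"
    by simp
  also have "\<dots> = (\<integral>\<^sup>+p. indicator A (fst p \<otimes> snd p) \<partial>(N \<Otimes>\<^sub>M H))"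
    by (subst nn_integral_distr) (simp_all add: case_prod_beta')
  also have "\<dots> = (\<integral>\<^sup>+u. \<integral>\<^sup>+g. indicator A (g \<otimes> u) \<partial>N \<partial>H)"
    by (subst nn_integral_snd[symmetric]) simp_all
  also have "\<dots> = (\<integral>\<^sup>+u. emeasure N A \<partial>H)"
  proof (rule nn_integral_cong_AE, use is_haar_AE_UF[OF H] in eventually_elim)
    fix u :: "'n fmat" assume u: "u \<in> UF d"
    have "(\<integral>\<^sup>+g. indicator A (g \<otimes> u) \<partial>N) = (\<integral>\<^sup>+g. indicator A g \<partial>distr N borel (\<lambda>g. g \<otimes> u))"
      by (subst nn_integral_distr) simp_all
    also have "\<dots> = emeasure N A"
      using N(2) u GL_law_sets[OF N(1)] by (simp add: right_invariant_def)
    finally show "(\<integral>\<^sup>+g. indicator A (g \<otimes> u) \<partial>N) = emeasure N A" .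
  qed
  also have "\<dots> = emeasure N A" by (simp add: H.emeasure_space_1)
  finally show "emeasure (distr (N \<Otimes>\<^sub>M H) borel (\<lambda>(g, u). g \<otimes> u)) A = emeasure N A" .
qed

lemma distr_fmul_GL_law:
  fixes N1 N2 :: "('n::{finite,linorder}) fmat measure"
  assumes N1: "GL_law d N1" and N2: "GL_law d N2"
  shows "GL_law d (distr (N1 \<Otimes>\<^sub>M N2) borel (\<lambda>(g, h). g \<otimes> h))"
proof (rule GL_lawI)
  note [measurable_cong] = GL_law_sets[OF N1] GL_law_sets[OF N2]
  interpret N1: prob_space N1 using N1 by (rule GL_law_prob)
  interpret N2: prob_space N2 using N2 by (rule GL_law_prob)
  interpret pair_prob_space N1 N2 ..
  show "prob_space (distr (N1 \<Otimes>\<^sub>M N2) borel (\<lambda>(g, h). g \<otimes> h))"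
    by (rule prob_space_distr) simp
  have "AE p in N1 \<Otimes>\<^sub>M N2. fst p \<otimes> snd p \<in> GLF d"
  proof (rule AE_pair_measure)
    show "AE g in N1. AE h in N2. fst (g, h) \<otimes> snd (g, h) \<in> GLF d"
      using GL_law_AE[OF N1]
    proof eventually_elim
      case (elim g)
      show ?case using GL_law_AE[OF N2] by eventually_elim (simp add: GLF_fmul elim)
    qed
  qed simp
  then show "AE x in distr (N1 \<Otimes>\<^sub>M N2) borel (\<lambda>(g, h). g \<otimes> h). x \<in> GLF d"
    by (subst AE_distr_iff) (simp_all add: case_prod_beta')
qed simp

lemma distr_fmul_right_invariant:
  fixes N1 N2 :: "('n::{finite,linorder}) fmat measure"
  assumes N1: "GL_law d N1" and N2: "GL_law d N2" "right_invariant d N2"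
  shows "right_invariant d (distr (N1 \<Otimes>\<^sub>M N2) borel (\<lambda>(g, h). g \<otimes> h))"
  unfolding right_invariant_def
proof
  fix v :: "'n fmat" assume v: "v \<in> UF d"
  note [measurable_cong] = GL_law_sets[OF N1] GL_law_sets[OF N2(1)]
  interpret N1: prob_space N1 using N1 by (rule GL_law_prob)
  interpret N2: prob_space N2 using N2(1) by (rule GL_law_prob)
  have [measurable]: "(\<lambda>g. g \<otimes> v) \<in> borel_measurable borel" by measurable
  let ?P = "distr (N1 \<Otimes>\<^sub>M N2) borel (\<lambda>(g, h). g \<otimes> h)"
  have em: "emeasure ?P A = (\<integral>\<^sup>+g. \<integral>\<^sup>+h. indicator A (g \<otimes> h) \<partial>N2 \<partial>N1)"
    if [measurable]: "A \<in> sets borel" for A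
  proof -
    have "emeasure ?P A = (\<integral>\<^sup>+p. indicator A p \<partial>?P)" by simp
    also have "\<dots> = (\<integral>\<^sup>+p. indicator A (fst p \<otimes> snd p) \<partial>(N1 \<Otimes>\<^sub>M N2))"
      by (subst nn_integral_distr) (simp_all add: case_prod_beta')
    finally show ?thesis by (subst (asm) N2.nn_integral_fst[symmetric]) simp_all
  qed
  show "distr ?P borel (\<lambda>g. g \<otimes> v) = ?P"
  proof (rule measure_eqI)
    fix A assume "A \<in> sets (distr ?P borel (\<lambda>g. g \<otimes> v))"
    then have A [measurable]: "A \<in> sets borel" by simp
    have A' [measurable]: "(\<lambda>g. g \<otimes> v) -` A \<in> sets borel"
      using measurable_sets[OF \<open>(\<lambda>g. g \<otimes> v) \<in> borel_measurable borel\<close> A] by simp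
    have "emeasure (distr ?P borel (\<lambda>g. g \<otimes> v)) A = emeasure ?P ((\<lambda>g. g \<otimes> v) -` A)"
      by (subst emeasure_distr) simp_all
    also have "\<dots> = (\<integral>\<^sup>+g. \<integral>\<^sup>+h. indicator A (g \<otimes> (h \<otimes> v)) \<partial>N2 \<partial>N1)"
      unfolding em[OF A'] by (simp add: indicator_def fmul_assoc)
    also have "\<dots> = (\<integral>\<^sup>+g. \<integral>\<^sup>+h. indicator A (g \<otimes> h) \<partial>distr N2 borel (\<lambda>h. h \<otimes> v) \<partial>N1)"
      by (subst nn_integral_distr) simp_all
    also have "\<dots> = emeasure ?P A"
      using N2(2) v by (simp add: right_invariant_def em[OF A])
    finally show "emeasure (distr ?P borel (\<lambda>g. g \<otimes> v)) A = emeasure ?P A" .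
  qed simp
qed

lemma measurable_cis [measurable]:
  "f \<in> borel_measurable M \<Longrightarrow> (\<lambda>x. cis (f x)) \<in> borel_measurable M"
  unfolding cis_conv_exp by measurable

lemma (in prob_space) integrable_cis:
  "f \<in> borel_measurable M \<Longrightarrow> integrable M (\<lambda>x. cis (f x))"
  by (intro integrable_const_bound[of _ 1]) auto

text \<open>With h fixed, \<open>IA_fmul\<close> replaces g by \<open>g \<otimes> QU d h\<close>,
  which has the law of g whatever h is. The inner integral no longer depends on h and factors out,
  as for a sum of independent vectors.\<close>

lemma char_IA_fmul:
  fixes N1 N2 :: "('n::{finite,linorder}) fmat measure"
  assumes N1: "GL_law d N1" "right_invariant d N1" and N2: "GL_law d N2"
  shows "(\<integral>x. cis (\<xi> \<bullet> IA d x) \<partial>distr (N1 \<Otimes>\<^sub>M N2) borel (\<lambda>(g, h). g \<otimes> h))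
    = (\<integral>g. cis (\<xi> \<bullet> IA d g) \<partial>N1) * (\<integral>h. cis (\<xi> \<bullet> IA d h) \<partial>N2)"
proof -
  note [measurable_cong] = GL_law_sets[OF N1(1)] GL_law_sets[OF N2]
  interpret N1: prob_space N1 using N1(1) by (rule GL_law_prob)
  interpret N2: prob_space N2 using N2 by (rule GL_law_prob)
  interpret P: pair_prob_space N1 N2 ..
  have int: "integrable (N1 \<Otimes>\<^sub>M N2) (\<lambda>(g, h). cis (\<xi> \<bullet> IA d (g \<otimes> h)))"
    unfolding case_prod_beta by (intro P.integrable_cis) measurable
  have "(\<integral>x. cis (\<xi> \<bullet> IA d x) \<partial>distr (N1 \<Otimes>\<^sub>M N2) borel (\<lambda>(g, h). g \<otimes> h))
      = (\<integral>p. (case p of (g, h) \<Rightarrow> cis (\<xi> \<bullet> IA d (g \<otimes> h))) \<partial>(N1 \<Otimes>\<^sub>M N2))"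
    by (subst integral_distr) (simp_all add: case_prod_beta')
  also have "\<dots> = (\<integral>h. \<integral>g. cis (\<xi> \<bullet> IA d (g \<otimes> h)) \<partial>N1 \<partial>N2)"
    by (rule P.integral_snd[symmetric, OF int])
  also have "\<dots> = (\<integral>h. (\<integral>g. cis (\<xi> \<bullet> IA d g) \<partial>N1) * cis (\<xi> \<bullet> IA d h) \<partial>N2)"
  proof (rule integral_cong_AE)
    show "(\<lambda>h. \<integral>g. cis (\<xi> \<bullet> IA d (g \<otimes> h)) \<partial>N1) \<in> borel_measurable N2"
      by measurable
    show "(\<lambda>h. (\<integral>g. cis (\<xi> \<bullet> IA d g) \<partial>N1) * cis (\<xi> \<bullet> IA d h)) \<in> borel_measurable N2"
      by measurable
    show "AE h in N2. (\<integral>g. cis (\<xi> \<bullet> IA d (g \<otimes> h)) \<partial>N1)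
        = (\<integral>g. cis (\<xi> \<bullet> IA d g) \<partial>N1) * cis (\<xi> \<bullet> IA d h)"
      using GL_law_AE[OF N2]
    proof eventually_elim
      case (elim h)
      have "(\<integral>g. cis (\<xi> \<bullet> IA d (g \<otimes> h)) \<partial>N1)
          = (\<integral>g. cis (\<xi> \<bullet> IA d (g \<otimes> QU d h)) * cis (\<xi> \<bullet> IA d h) \<partial>N1)"
      proof (rule integral_cong_AE)
        show "AE g in N1. cis (\<xi> \<bullet> IA d (g \<otimes> h)) = cis (\<xi> \<bullet> IA d (g \<otimes> QU d h)) * cis (\<xi> \<bullet> IA d h)"
          using GL_law_AE[OF N1(1)]
          by eventually_elim (simp add: IA_fmul elim inner_add_right cis_mult)
      qed measurable
      also have "\<dots> = (\<integral>g. cis (\<xi> \<bullet> IA d (g \<otimes> QU d h)) \<partial>N1) * cis (\<xi> \<bullet> IA d h)"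
        by simp
      also have "(\<integral>g. cis (\<xi> \<bullet> IA d (g \<otimes> QU d h)) \<partial>N1)
          = (\<integral>g. cis (\<xi> \<bullet> IA d g) \<partial>distr N1 borel (\<lambda>g. g \<otimes> QU d h))"
        by (subst integral_distr) simp_all
      also have "\<dots> = (\<integral>g. cis (\<xi> \<bullet> IA d g) \<partial>N1)"
        using N1(2) by (simp add: right_invariant_def)
      finally show ?case .
    qed
  qed
  finally show ?thesis by simp
qed

section \<open>Moments of the Iwasawa component\<close>

lemma is_haar_integral_translate:
  fixes f :: "('n::{finite,linorder}) fmat \<Rightarrow> 'b::{banach, second_countable_topology}"
  assumes H: "is_haar d H" and w: "w \<in> UF d" and f [measurable]: "f \<in> borel_measurable borel"
  shows "(\<integral>u. f (w \<otimes> u) \<partial>H) = (\<integral>u. f u \<partial>H)"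
proof -
  note [measurable_cong] = GL_law_sets[OF is_haar_GL_law[OF H]]
  have "(\<integral>u. f (w \<otimes> u) \<partial>H) = (\<integral>u. f u \<partial>distr H borel (fmul w))"
    by (subst integral_distr) simp_all
  then show ?thesis using H w by (simp add: is_haar_def)
qed

text \<open>Insert a Haar factor and decompose g: \<open>IA d\<close> does not see the left unitary
  factor, and the right one is absorbed by the invariance of H, which leaves
  \<open>ediag t \<otimes> u\<close>.\<close>

lemma integral_IA_eq:
  fixes N :: "('n::{finite,linorder}) fmat measure" and \<Psi> :: "(real,'n) vec \<Rightarrow> real"
  assumes N: "GL_law d N" "right_invariant d N" and H: "is_haar d H"
    and \<Psi> [measurable]: "\<Psi> \<in> borel_measurable borel" and int: "integrable N (\<lambda>g. \<Psi> (IA d g))"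
  shows "(\<integral>g. \<Psi> (IA d g) \<partial>N) = (\<integral>t. (\<integral>u. \<Psi> (IA d (ediag t \<otimes> u)) \<partial>H) \<partial>distr N borel (ln_sing d))"
proof -
  note [measurable_cong] = GL_law_sets[OF N(1)] GL_law_sets[OF is_haar_GL_law[OF H]]
  interpret N: prob_space N using N(1) by (rule GL_law_prob)
  interpret H: prob_space H using H by (simp add: is_haar_def)
  interpret P: pair_prob_space N H ..
  let ?D = "distr (N \<Otimes>\<^sub>M H) borel (\<lambda>(g, u). g \<otimes> u)"
  have "integrable ?D (\<lambda>g. \<Psi> (IA d g))"
    using int by (simp only: right_invariant_distr_haar[OF N H])
  then have int': "integrable (N \<Otimes>\<^sub>M H) (\<lambda>(g, u). \<Psi> (IA d (g \<otimes> u)))"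
    by (subst (asm) integrable_distr_eq) (simp_all add: case_prod_beta')
  have "(\<integral>g. \<Psi> (IA d g) \<partial>N) = (\<integral>g. \<Psi> (IA d g) \<partial>?D)"
    by (simp only: right_invariant_distr_haar[OF N H])
  also have "\<dots> = (\<integral>p. (case p of (g, u) \<Rightarrow> \<Psi> (IA d (g \<otimes> u))) \<partial>(N \<Otimes>\<^sub>M H))"
    by (subst integral_distr) (simp_all add: case_prod_beta')
  also have "\<dots> = (\<integral>g. \<integral>u. \<Psi> (IA d (g \<otimes> u)) \<partial>H \<partial>N)"
    by (rule P.integral_fst[symmetric, OF int'])
  also have "\<dots> = (\<integral>g. \<integral>u. \<Psi> (IA d (ediag (ln_sing d g) \<otimes> u)) \<partial>H \<partial>N)"
  proof (rule integral_cong_AE)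
    show "AE g in N. (\<integral>u. \<Psi> (IA d (g \<otimes> u)) \<partial>H) = (\<integral>u. \<Psi> (IA d (ediag (ln_sing d g) \<otimes> u)) \<partial>H)"
      using GL_law_AE[OF N(1)]
    proof eventually_elim
      case (elim g)
      obtain v w where vw: "v \<in> UF d" "w \<in> UF d" "g = v \<otimes> (ediag (ln_sing d g) \<otimes> w)"
        using ln_sing_svd[OF elim] by blast
      have "(\<integral>u. \<Psi> (IA d (g \<otimes> u)) \<partial>H) = (\<integral>u. \<Psi> (IA d (ediag (ln_sing d g) \<otimes> (w \<otimes> u))) \<partial>H)"
      proof (rule integral_cong_AE)
        show "AE u in H. \<Psi> (IA d (g \<otimes> u)) = \<Psi> (IA d (ediag (ln_sing d g) \<otimes> (w \<otimes> u)))"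
          using is_haar_AE_UF[OF H]
        proof eventually_elim
          case (elim u)
          have "g \<otimes> u = v \<otimes> (ediag (ln_sing d g) \<otimes> (w \<otimes> u))"
            by (subst vw(3)) (simp add: fmul_assoc)
          then show ?case using vw elim by (simp add: IA_UF_fmul GLF_fmul UF_GLF)
        qed
      qed measurable
      also have "\<dots> = (\<integral>u. \<Psi> (IA d (ediag (ln_sing d g) \<otimes> u)) \<partial>H)"
        by (rule is_haar_integral_translate[OF H vw(2)]) measurable
      finally show ?case .
    qed
  qed measurable
  also have "\<dots> = (\<integral>t. (\<integral>u. \<Psi> (IA d (ediag t \<otimes> u)) \<partial>H) \<partial>distr N borel (ln_sing d))"
    by (subst integral_distr) simp_all
  finally show ?thesis .
qed

lemma integral_IA_m1:
  fixes N H :: "('n::{finite,linorder}) fmat measure"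
  assumes d: "d \<in> {1, 2, 4}" and N: "GL_law d N" "right_invariant d N" and H: "is_haar d H"
    and int: "integrable N (\<lambda>g. IA d g $ j)"
  shows "m1_nu d (distr N borel (ln_sing d)) $ j = (\<integral>g. IA d g $ j \<partial>N)"
proof -
  have "(\<Prod>i\<in>UNIV. x i ^ unitv j i) = x j" for x :: "'n \<Rightarrow> real"
    by (subst prod.mono_neutral_right[of UNIV "{j}"]) (auto simp: unitv_def)
  then have "m1 d t $ j = (\<integral>u. IA d (ediag t \<otimes> u) $ j \<partial>H)" for t
    by (simp add: m1_def mom_eq[OF d H])
  then show ?thesis
    using integral_IA_eq[OF N H, of "\<lambda>x. x $ j"] int by (simp add: m1_nu_def)
qed

lemma integral_IA_m2:
  fixes N H :: "('n::{finite,linorder}) fmat measure"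
  assumes d: "d \<in> {1, 2, 4}" and N: "GL_law d N" "right_invariant d N" and H: "is_haar d H"
    and int: "integrable N (\<lambda>g. IA d g $ j * IA d g $ l)"
  shows "(\<integral>t. m2 d t $ j $ l \<partial>distr N borel (ln_sing d)) = (\<integral>g. IA d g $ j * IA d g $ l \<partial>N)"
proof -
  have "(\<Prod>i\<in>UNIV. x i ^ unitv j i) = x j" for x :: "'n \<Rightarrow> real" and j
    by (subst prod.mono_neutral_right[of UNIV "{j}"]) (auto simp: unitv_def)
  then have "m2 d t $ j $ l = (\<integral>u. IA d (ediag t \<otimes> u) $ j * IA d (ediag t \<otimes> u) $ l \<partial>H)" for t
    by (simp add: m2_def mom_eq[OF d H] power_add prod.distrib)
  then show ?thesis
    using integral_IA_eq[OF N H, of "\<lambda>x. x $ j * x $ l"] int by simp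
qed

section \<open>Singular values and the Iwasawa component differ by a tight error\<close>

text \<open>One deviating t in the chamber is enough for membership, so the Haar measure of this set
  bounds the deviation for all singular values at once.\<close>

definition Dev :: "nat \<Rightarrow> real \<Rightarrow> (('n::{finite,linorder}) fmat) set" where
  "Dev d c = {u \<in> UF d. \<exists>t\<in>CqA. c < norm (IA d (ediag t \<otimes> u) - t)}"

text \<open>The union over t is uncountable, but each of its members is relatively open in the
  unitary group.\<close>

lemma Dev_borel [measurable]: "Dev d c \<in> sets (borel :: ('n::{finite,linorder}) fmat measure)"
proof -
  have "openin (top_of_set (UF d)) {u \<in> UF d :: 'n fmat set. c < norm (IA d (ediag t \<otimes> u) - t)}" for t
  proof -
    have "continuous_on (UF d) (\<lambda>u :: 'n fmat. IA d (ediag t \<otimes> u))"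
      by (rule continuous_on_compose2[OF continuous_on_IA])
        (auto intro!: continuous_intros simp: GLF_fmul UF_GLF)
    then have "continuous_on (UF d) (\<lambda>u :: 'n fmat. norm (IA d (ediag t \<otimes> u) - t))"
      by (intro continuous_intros)
    from continuous_openin_preimage_gen[OF this open_greaterThan[of c]] show ?thesis
      by (simp add: vimage_def Int_def)
  qed
  then have "openin (top_of_set (UF d)) (\<Union>t\<in>CqA. {u \<in> UF d :: 'n fmat set. c < norm (IA d (ediag t \<otimes> u) - t)})"
    by (intro openin_Union) auto
  moreover have "Dev d c = (\<Union>t\<in>CqA. {u \<in> UF d :: 'n fmat set. c < norm (IA d (ediag t \<otimes> u) - t)})"
    by (auto simp: Dev_def)
  ultimately obtain T :: "'n fmat set" where "open T" "Dev d c = UF d \<inter> T"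
    by (auto simp: openin_open)
  then show ?thesis by simp
qed

text \<open>A matrix in every \<open>Dev d n\<close> has unbounded deviation, hence some singular
  leading block; such matrices form a null set, and continuity from above applies.\<close>

lemma Dev_tendsto_0:
  fixes H :: "('n::{finite,linorder}) fmat measure"
  assumes H: "is_haar d H"
  shows "(\<lambda>n. measure H (Dev d (real n))) \<longlonglongrightarrow> 0"
proof -
  note s [measurable_cong] = GL_law_sets[OF is_haar_GL_law[OF H]]
  interpret H: prob_space H using H by (simp add: is_haar_def)
  have "(\<lambda>n. measure H (Dev d (real n))) \<longlonglongrightarrow> measure H (\<Inter>n. Dev d (real n))"
  proof (rule H.finite_Lim_measure_decseq)
    show "range (\<lambda>n. Dev d (real n)) \<subseteq> H.events" by (simp add: s image_subset_iff)
    have "Dev d b \<subseteq> (Dev d a :: 'n fmat set)" if "a \<le> b" for a b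
      using le_less_trans[OF that] unfolding Dev_def by blast
    then show "decseq (\<lambda>n. Dev d (real n) :: 'n fmat set)"
      by (simp add: decseq_def)
  qed
  moreover have "measure H (\<Inter>n. Dev d (real n)) = 0"
  proof -
    have null: "Bad d j \<in> null_sets H" for j :: 'n
      by (rule null_setsI) (simp_all add: emeasure_Bad[OF H] s borel_closed closed_Bad)
    have sub: "(\<Inter>n. Dev d (real n)) \<subseteq> (\<Union>j::'n. Bad d j)"
    proof
      fix u :: "'n fmat" assume u: "u \<in> (\<Inter>n. Dev d (real n))"
      then have "u \<in> Dev d (real 0)" by blast
      then have uU: "u \<in> UF d" by (simp add: Dev_def)
      show "u \<in> (\<Union>j. Bad d j)"
      proof (rule ccontr)
        assume "u \<notin> (\<Union>j. Bad d j)"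
        then obtain B where B: "\<forall>t\<in>CqA. norm (IA d (ediag t \<otimes> u) - t) \<le> B"
          using IA_ediag_fmul_bounded[OF uU] by blast
        obtain n where "B \<le> real n" using real_arch_simple by blast
        moreover have "u \<in> Dev d (real n)" using u by blast
        then obtain t where "t \<in> CqA" "real n < norm (IA d (ediag t \<otimes> u) - t)"
          unfolding Dev_def by blast
        ultimately show False using B by force
      qed
    qed
    have "(\<Union>j::'n. Bad d j) \<in> null_sets H" by (intro null_sets_UN' null) simp
    then have "(\<Inter>n. Dev d (real n)) \<in> null_sets H"
      by (rule null_sets_subset[OF _ _ sub]) (simp add: s)
    then show ?thesis by (simp add: measure_eq_0_null_sets)
  qed
  ultimately show ?thesis by simp
qed

text \<open>The right-hand side does not involve N, so the bound serves the laws of all products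
  simultaneously.\<close>

lemma deviation_prob_le:
  fixes N H :: "('n::{finite,linorder}) fmat measure"
  assumes N: "GL_law d N" "right_invariant d N" and H: "is_haar d H"
  shows "measure N {g. c < norm (IA d g - ln_sing d g)} \<le> measure H (Dev d c)"
proof -
  note [measurable_cong] = GL_law_sets[OF N(1)] GL_law_sets[OF is_haar_GL_law[OF H]]
  interpret N: prob_space N using N(1) by (rule GL_law_prob)
  interpret H: prob_space H using H by (simp add: is_haar_def)
  let ?E = "{g :: 'n fmat. c < norm (IA d g - ln_sing d g)}"
  have E [measurable]: "?E \<in> sets borel" by measurable
  have "emeasure N ?E = (\<integral>\<^sup>+g. indicator ?E g \<partial>distr (N \<Otimes>\<^sub>M H) borel (\<lambda>(g, u). g \<otimes> u))"
    unfolding right_invariant_distr_haar[OF N H] using GL_law_sets[OF N(1)] by simp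
  also have "\<dots> = (\<integral>\<^sup>+p. indicator ?E (fst p \<otimes> snd p) \<partial>(N \<Otimes>\<^sub>M H))"
    by (subst nn_integral_distr) (simp_all add: case_prod_beta')
  also have "\<dots> = (\<integral>\<^sup>+g. \<integral>\<^sup>+u. indicator ?E (g \<otimes> u) \<partial>H \<partial>N)"
    by (subst H.nn_integral_fst[symmetric]) simp_all
  also have "\<dots> \<le> (\<integral>\<^sup>+g. emeasure H (Dev d c) \<partial>N)"
  proof (rule nn_integral_mono_AE, use GL_law_AE[OF N(1)] in eventually_elim)
    fix g :: "'n fmat" assume g: "g \<in> GLF d"
    define t where "t = ln_sing d g"
    obtain v w where vw: "v \<in> UF d" "w \<in> UF d" "g = v \<otimes> (ediag t \<otimes> w)" and t: "t \<in> CqA"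
      using ln_sing_svd[OF g] unfolding t_def by blast
    have "(\<integral>\<^sup>+u. indicator ?E (g \<otimes> u) \<partial>H) \<le> (\<integral>\<^sup>+u. indicator (Dev d c) (w \<otimes> u) \<partial>H)"
    proof (rule nn_integral_mono_AE, use is_haar_AE_UF[OF H] in eventually_elim)
      fix u :: "'n fmat" assume u: "u \<in> UF d"
      have "g \<otimes> u = v \<otimes> (ediag t \<otimes> (w \<otimes> u))"
        by (subst vw(3)) (simp add: fmul_assoc)
      then have "IA d (g \<otimes> u) = IA d (ediag t \<otimes> (w \<otimes> u))"
        using vw u by (simp add: IA_UF_fmul GLF_fmul UF_GLF)
      moreover have "ln_sing d (g \<otimes> u) = t" using g u by (simp add: t_def ln_sing_fmul_UF)
      ultimately have "g \<otimes> u \<in> ?E \<Longrightarrow> w \<otimes> u \<in> Dev d c"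
        using t vw u by (auto simp: Dev_def UF_fmul)
      then show "indicator ?E (g \<otimes> u) \<le> (indicator (Dev d c) (w \<otimes> u) :: ennreal)"
        by (auto simp: indicator_def)
    qed
    also have "\<dots> = (\<integral>\<^sup>+u. indicator (Dev d c) u \<partial>H)"
      by (rule is_haar_translate[OF H vw(2)]) measurable
    also have "\<dots> = emeasure H (Dev d c)" by simp
    finally show "(\<integral>\<^sup>+u. indicator ?E (g \<otimes> u) \<partial>H) \<le> emeasure H (Dev d c)" .
  qed
  also have "\<dots> = emeasure H (Dev d c)" by (simp add: N.emeasure_space_1)
  finally show ?thesis by (simp add: N.emeasure_eq_measure H.emeasure_eq_measure)
qed

lemma norm_cis_diff_le: "norm (cis a - cis b) \<le> \<bar>a - b\<bar>"
proof -
  have "cis a - cis b = cis b * (cis (a - b) - 1)"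
    by (simp add: right_diff_distrib cis_mult)
  then have "norm (cis a - cis b) = norm (cis (a - b) - 1)"
    by (simp add: norm_mult)
  also have "\<dots> \<le> \<bar>a - b\<bar>"
    using iexp_approx1[of "a - b" 0] by (simp add: cis_conv_exp)
  finally show ?thesis .
qed

text \<open>Off the deviation event the Lipschitz bound for \<open>cis\<close> applies with
  increment at most \<open>s * c\<close>; on it the difference of two unit vectors is at most
  2.\<close>

lemma char_diff_le:
  fixes N :: "('n::{finite,linorder}) fmat measure"
  assumes N: "GL_law d N" and c: "c \<ge> 0" and s: "s \<ge> 0"
  shows "norm ((\<integral>g. cis (\<xi> \<bullet> (s *\<^sub>R (ln_sing d g - a))) \<partial>N) - (\<integral>g. cis (\<xi> \<bullet> (s *\<^sub>R (IA d g - a))) \<partial>N))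
    \<le> norm \<xi> * s * c + 2 * measure N {g. c < norm (IA d g - ln_sing d g)}"
proof -
  note ss [measurable_cong] = GL_law_sets[OF N]
  interpret prob_space N using N by (rule GL_law_prob)
  let ?E = "{g :: 'n fmat. c < norm (IA d g - ln_sing d g)}"
  have E [measurable]: "?E \<in> sets borel" by measurable
  let ?f = "\<lambda>g. cis (\<xi> \<bullet> (s *\<^sub>R (ln_sing d g - a)))" and ?h = "\<lambda>g. cis (\<xi> \<bullet> (s *\<^sub>R (IA d g - a)))"
  have i: "integrable N ?f" "integrable N ?h"
    by (intro integrable_cis; measurable)+
  have pt: "norm (?f g - ?h g) \<le> norm \<xi> * s * c + 2 * indicator ?E g" for g
  proof (cases "g \<in> ?E")
    case True
    have "norm (?f g - ?h g) \<le> norm (?f g) + norm (?h g)" by (rule norm_triangle_ineq4)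
    moreover have "0 \<le> norm \<xi> * s * c" using c s by simp
    ultimately show ?thesis using True by simp
  next
    case False
    have "norm (?f g - ?h g) \<le> \<bar>\<xi> \<bullet> (s *\<^sub>R (ln_sing d g - a)) - \<xi> \<bullet> (s *\<^sub>R (IA d g - a))\<bar>"
      by (rule norm_cis_diff_le)
    also have "\<dots> = \<bar>\<xi> \<bullet> (s *\<^sub>R (ln_sing d g - IA d g))\<bar>"
      by (simp add: inner_diff_right algebra_simps)
    also have "\<dots> \<le> norm \<xi> * norm (s *\<^sub>R (ln_sing d g - IA d g))" by (rule Cauchy_Schwarz_ineq2)
    also have "\<dots> = norm \<xi> * s * norm (IA d g - ln_sing d g)"
      using s by (simp add: norm_minus_commute)
    also have "\<dots> \<le> norm \<xi> * s * c" using False s by (intro mult_left_mono) auto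
    finally show ?thesis using False by simp
  qed
  have "norm ((\<integral>g. ?f g \<partial>N) - (\<integral>g. ?h g \<partial>N)) = norm (\<integral>g. ?f g - ?h g \<partial>N)"
    using i by simp
  also have "\<dots> \<le> (\<integral>g. norm (?f g - ?h g) \<partial>N)" by (rule integral_norm_bound)
  also have "\<dots> \<le> (\<integral>g. norm \<xi> * s * c + 2 * indicator ?E g \<partial>N)"
    using i pt by (intro integral_mono) (auto intro!: integrable_real_indicator simp: ss emeasure_eq_measure)
  also have "\<dots> = norm \<xi> * s * c + 2 * measure N ?E"
    using ss by (simp add: prob_space emeasure_eq_measure)
  finally show ?thesis .
qed

section \<open>The central limit theorem\<close>

lemma fprod_cong:
  assumes "\<And>i. 1 \<le> i \<Longrightarrow> i \<le> k \<Longrightarrow> f i = g i"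
  shows "fprod f k = fprod g k"
  using assms by (induction k) auto

lemma measurable_fprod:
  assumes "\<And>i. 1 \<le> i \<Longrightarrow> i \<le> k \<Longrightarrow> (\<lambda>x. Y x i) \<in> borel_measurable M"
  shows "(\<lambda>x. fprod (Y x) k) \<in> borel_measurable M"
  using assms by (induction k) (auto intro: measurable_fmul)

lemma (in prob_space) distr_fprod_Suc:
  fixes X :: "nat \<Rightarrow> 'a \<Rightarrow> ('n::finite) fmat"
  assumes ind: "indep_vars (\<lambda>_. borel) X {1..}" and law: "\<And>k. 1 \<le> k \<Longrightarrow> distr M borel (X k) = N"
  shows "distr M borel (\<lambda>\<omega>. fprod (\<lambda>i. X i \<omega>) (Suc k))
    = distr (distr M borel (\<lambda>\<omega>. fprod (\<lambda>i. X i \<omega>) k) \<Otimes>\<^sub>M N) borel (\<lambda>(g, h). g \<otimes> h)"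
proof -
  let ?S = "\<lambda>\<omega>. fprod (\<lambda>i. X i \<omega>) k"
  have X: "random_variable borel (X i)" if "1 \<le> i" for i
    using ind that by (simp add: indep_vars_def2)
  have S [measurable]: "random_variable borel ?S"
    by (rule measurable_fprod) (rule X)
  have [measurable]: "random_variable borel (X (Suc k))" by (rule X) simp
  have "indep_var borel ((\<lambda>f. fprod f k) \<circ> (\<lambda>\<omega>. restrict (\<lambda>i. X i \<omega>) {1..k}))
      borel ((\<lambda>f. f (Suc k)) \<circ> (\<lambda>\<omega>. restrict (\<lambda>i. X i \<omega>) {Suc k}))"
    by (intro indep_var_compose[OF indep_var_restrict[OF ind]] measurable_fprod) auto
  moreover have "(\<lambda>f. fprod f k) \<circ> (\<lambda>\<omega>. restrict (\<lambda>i. X i \<omega>) {1..k}) = ?S"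
    by (auto simp: fun_eq_iff intro!: fprod_cong)
  moreover have "(\<lambda>f. f (Suc k)) \<circ> (\<lambda>\<omega>. restrict (\<lambda>i. X i \<omega>) {Suc k}) = X (Suc k)"
    by (auto simp: fun_eq_iff)
  ultimately have "indep_var borel ?S borel (X (Suc k))" by simp
  then have "distr M borel ?S \<Otimes>\<^sub>M distr M borel (X (Suc k))
      = distr M (borel \<Otimes>\<^sub>M borel) (\<lambda>\<omega>. (?S \<omega>, X (Suc k) \<omega>))"
    by (simp add: indep_var_distribution_eq)
  then have "distr (distr M borel ?S \<Otimes>\<^sub>M N) borel (\<lambda>(g, h). g \<otimes> h)
      = distr (distr M (borel \<Otimes>\<^sub>M borel) (\<lambda>\<omega>. (?S \<omega>, X (Suc k) \<omega>))) borel (\<lambda>(g, h). g \<otimes> h)"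
    by (simp add: law)
  also have "\<dots> = distr M borel (\<lambda>\<omega>. ?S \<omega> \<otimes> X (Suc k) \<omega>)"
    by (subst distr_distr) (simp_all add: o_def case_prod_beta')
  finally show ?thesis by simp
qed

text \<open>The induction starts at one factor, since the law of the empty product is the point mass
  at \<open>fid\<close>, which is not right invariant.\<close>

lemma (in prob_space) law_fprod:
  fixes X :: "nat \<Rightarrow> 'a \<Rightarrow> ('n::{finite,linorder}) fmat"
  assumes ind: "indep_vars (\<lambda>_. borel) X {1..}" and law: "\<And>k. 1 \<le> k \<Longrightarrow> distr M borel (X k) = N"
    and N: "GL_law d N" "right_invariant d N" and k: "1 \<le> k"
  defines "S \<equiv> \<lambda>k. distr M borel (\<lambda>\<omega>. fprod (\<lambda>i. X i \<omega>) k)"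
  shows "GL_law d (S k) \<and> right_invariant d (S k) \<and>
    (\<forall>\<xi>. (\<integral>x. cis (\<xi> \<bullet> IA d x) \<partial>S k) = (\<integral>x. cis (\<xi> \<bullet> IA d x) \<partial>N) ^ k)"
  using k
proof (induction k rule: nat_induct_at_least)
  case base
  have "S 1 = N" by (simp add: S_def law)
  then show ?case using N by simp
next
  case (Suc k)
  have eq: "S (Suc k) = distr (S k \<Otimes>\<^sub>M N) borel (\<lambda>(g, h). g \<otimes> h)"
    unfolding S_def by (rule distr_fprod_Suc[OF ind law])
  show ?case
    using Suc.IH N by (simp add: eq distr_fmul_GL_law distr_fmul_right_invariant char_IA_fmul)
qed

lemma (in prob_space) indep_vars_reindex:
  assumes ind: "indep_vars M' X I" and f: "inj_on f J" "f ` J \<subseteq> I"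
  shows "indep_vars (\<lambda>i. M' (f i)) (\<lambda>i. X (f i)) J"
  unfolding indep_vars_def2 indep_sets_def
proof (intro conjI ballI allI impI)
  let ?F = "\<lambda>i. {X i -` A \<inter> space M |A. A \<in> sets (M' i)}"
  note ind' = ind[unfolded indep_vars_def2 indep_sets_def]
  show "random_variable (M' (f i)) (X (f i))" if "i \<in> J" for i
    using ind' f that by blast
  show "?F (f i) \<subseteq> events" if "i \<in> J" for i
    using ind' f that by blast
  fix K A assume K: "K \<subseteq> J" "K \<noteq> {}" "finite K" and A: "A \<in> Pi K (\<lambda>i. ?F (f i))"
  have inj: "inj_on f K" using f(1) K(1) by (rule inj_on_subset)
  define A' where "A' i = A (the_inv_into K f i)" for i
  have A': "A' (f i) = A i" if "i \<in> K" for i using inj that by (simp add: A'_def the_inv_into_f_f)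
  have "f ` K \<subseteq> I" "f ` K \<noteq> {}" "finite (f ` K)" using K f by auto
  moreover have "A' \<in> Pi (f ` K) ?F"
  proof (rule Pi_I)
    fix y assume "y \<in> f ` K"
    then obtain i where "i \<in> K" "y = f i" by blast
    then show "A' y \<in> ?F y" using Pi_mem[OF A \<open>i \<in> K\<close>] A' by simp
  qed
  ultimately have "prob (\<Inter>i\<in>f ` K. A' i) = (\<Prod>i\<in>f ` K. prob (A' i))"
    using ind' by blast
  then show "prob (\<Inter>i\<in>K. A i) = (\<Prod>i\<in>K. prob (A i))"
    by (simp add: prod.reindex[OF inj] A')
qed

lemma IA_square_integrable:
  fixes N :: "('n::{finite,linorder}) fmat measure"
  assumes N: "GL_law d N"
    and mom: "\<And>j. integrable (distr N borel (ln_sing d)) (\<lambda>t. (t $ j)\<^sup>2)"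
  shows "integrable N (\<lambda>g. IA d g $ j * IA d g $ l)" "integrable N (\<lambda>g. IA d g $ j)"
proof -
  note [measurable_cong] = GL_law_sets[OF N]
  interpret N: prob_space N using N by (rule GL_law_prob)
  have "integrable N (\<lambda>g. (ln_sing d g $ j)\<^sup>2)" for j
    using mom[of j] by (subst (asm) integrable_distr_eq) simp_all
  then have int: "integrable N (\<lambda>g. \<Sum>j\<in>UNIV. (ln_sing d g $ j)\<^sup>2)"
    by (rule Bochner_Integration.integrable_sum)
  have sq: "(norm t)\<^sup>2 = (\<Sum>j\<in>UNIV. (t $ j)\<^sup>2)" for t :: "(real,'n) vec"
    unfolding power2_norm_eq_inner by (simp add: inner_vec_def power2_eq_square)
  show 2: "integrable N (\<lambda>g. IA d g $ j * IA d g $ l)" for j l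
  proof (rule Bochner_Integration.integrable_bound[OF int])
    show "AE g in N. norm (IA d g $ j * IA d g $ l) \<le> norm (\<Sum>j\<in>UNIV. (ln_sing d g $ j)\<^sup>2)"
      using GL_law_AE[OF N]
    proof eventually_elim
      case (elim g)
      have "\<bar>IA d g $ j\<bar> * \<bar>IA d g $ l\<bar> \<le> norm (ln_sing d g) * norm (ln_sing d g)"
        by (intro mult_mono abs_IA_le_norm_ln_sing[OF elim]) auto
      also have "\<dots> = (\<Sum>j\<in>UNIV. (ln_sing d g $ j)\<^sup>2)"
        unfolding sq[symmetric] by (simp add: power2_eq_square)
      finally show ?case by (simp add: abs_mult sum_nonneg)
    qed
  qed measurable
  show "integrable N (\<lambda>g. IA d g $ j)"
    by (rule N.square_integrable_imp_integrable) (use 2[of j j] in \<open>simp_all add: power2_eq_square\<close>)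
qed

text \<open>By the integral formulas for \<open>m1\<close> and \<open>m2\<close>,
  \<open>Sigma2\<close> is the covariance matrix of \<open>IA d\<close> under N. Its quadratic form
  is a variance, so it is symmetric and semidefinite, as the existence of the normal law
  requires.\<close>

lemma covariance_quadratic_form:
  fixes N H :: "('n::{finite,linorder}) fmat measure"
  assumes d: "d \<in> {1, 2, 4}" and N: "GL_law d N" "right_invariant d N" and H: "is_haar d H"
    and i2: "\<forall>j l. integrable N (\<lambda>g. IA d g $ j * IA d g $ l)" and i1: "\<forall>j. integrable N (\<lambda>g. IA d g $ j)"
  defines "\<nu> \<equiv> distr N borel (ln_sing d)"
  shows "integrable N (\<lambda>g. (\<xi> \<bullet> (IA d g - m1_nu d \<nu>))\<^sup>2)"
    and "(\<integral>g. (\<xi> \<bullet> (IA d g - m1_nu d \<nu>))\<^sup>2 \<partial>N) = (\<Sum>j\<in>UNIV. \<Sum>l\<in>UNIV. \<xi>$j * Sigma2 d \<nu> $j$l * \<xi>$l)"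
    and "(\<integral>g. \<xi> \<bullet> (IA d g - m1_nu d \<nu>) \<partial>N) = 0"
    and "Sigma2 d \<nu> $j$l = Sigma2 d \<nu> $l$j"
proof -
  interpret N: prob_space N using N(1) by (rule GL_law_prob)
  define m where "m = m1_nu d \<nu>"
  have m: "m $ j = (\<integral>g. IA d g $ j \<partial>N)" for j
    unfolding m_def \<nu>_def by (rule integral_IA_m1[OF d N H spec[OF i1]])
  have S: "Sigma2 d \<nu> $j$l = (\<integral>g. IA d g $ j * IA d g $ l \<partial>N) - m$j * m$l" for j l
    using integral_IA_m2[OF d N H spec[OF spec[OF i2]]] by (simp add: Sigma2_def m_def \<nu>_def)
  show "Sigma2 d \<nu> $j$l = Sigma2 d \<nu> $l$j" unfolding S by (simp add: mult.commute)
  have ic: "integrable N (\<lambda>g. (IA d g $ j - m$j) * (IA d g $ l - m$l))" for j l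
    unfolding left_diff_distrib right_diff_distrib using i2 i1
    by (intro Bochner_Integration.integrable_diff) auto
  have cov: "(\<integral>g. (IA d g $ j - m$j) * (IA d g $ l - m$l) \<partial>N) = Sigma2 d \<nu> $j$l" for j l
  proof -
    have "(\<integral>g. (IA d g $ j - m$j) * (IA d g $ l - m$l) \<partial>N)
        = (\<integral>g. IA d g $ j * IA d g $ l - m$l * IA d g $ j - m$j * IA d g $ l + m$j * m$l \<partial>N)"
      by (intro Bochner_Integration.integral_cong) (simp_all add: algebra_simps)
    also have "\<dots> = Sigma2 d \<nu> $j$l"
      using i2 i1 by (simp add: S m N.prob_space)
    finally show ?thesis .
  qed
  have sq: "(\<xi> \<bullet> (IA d g - m))\<^sup>2
      = (\<Sum>j\<in>UNIV. \<Sum>l\<in>UNIV. \<xi>$j * ((IA d g $ j - m$j) * (IA d g $ l - m$l)) * \<xi>$l)" for g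
    by (simp add: inner_vec_def power2_eq_square sum_product mult_ac)
  show "integrable N (\<lambda>g. (\<xi> \<bullet> (IA d g - m1_nu d \<nu>))\<^sup>2)"
    unfolding m_def[symmetric] sq using ic by (intro Bochner_Integration.integrable_sum) auto
  show "(\<integral>g. (\<xi> \<bullet> (IA d g - m1_nu d \<nu>))\<^sup>2 \<partial>N) = (\<Sum>j\<in>UNIV. \<Sum>l\<in>UNIV. \<xi>$j * Sigma2 d \<nu> $j$l * \<xi>$l)"
    unfolding m_def[symmetric] sq using ic by (simp add: Bochner_Integration.integral_sum cov)
  show "(\<integral>g. \<xi> \<bullet> (IA d g - m1_nu d \<nu>) \<partial>N) = 0"
    unfolding m_def[symmetric] inner_vec_def using i1
    by (simp add: Bochner_Integration.integral_sum m N.prob_space)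
qed

lemma (in prob_space) char_IA_fprod_tendsto:
  fixes X :: "nat \<Rightarrow> 'a \<Rightarrow> ('n::{finite,linorder}) fmat" and N H :: "'n fmat measure"
  assumes d: "d \<in> {1, 2, 4}" and N: "GL_law d N" "right_invariant d N" and H: "is_haar d H"
    and ind: "indep_vars (\<lambda>_. borel) X {1..}" and law: "\<And>k. 1 \<le> k \<Longrightarrow> distr M borel (X k) = N"
    and i2: "\<forall>j l. integrable N (\<lambda>g. IA d g $ j * IA d g $ l)" and i1: "\<forall>j. integrable N (\<lambda>g. IA d g $ j)"
  defines "\<nu> \<equiv> distr N borel (ln_sing d)"
  defines "S \<equiv> \<lambda>k. distr M borel (\<lambda>\<omega>. fprod (\<lambda>i. X i \<omega>) k)"
  shows "(\<lambda>k. \<integral>g. cis (\<xi> \<bullet> ((1 / sqrt (real k)) *\<^sub>R (IA d g - real k *\<^sub>R m1_nu d \<nu>))) \<partial>S k)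
    \<longlonglongrightarrow> complex_of_real (exp (- (\<Sum>j\<in>UNIV. \<Sum>l\<in>UNIV. \<xi>$j * Sigma2 d \<nu> $j$l * \<xi>$l) / 2))"
proof -
  define m where "m = m1_nu d \<nu>"
  define v where "v = (\<Sum>j\<in>UNIV. \<Sum>l\<in>UNIV. \<xi>$j * Sigma2 d \<nu> $j$l * \<xi>$l)"
  note [measurable_cong] = GL_law_sets[OF N(1)]
  interpret N: prob_space N using N(1) by (rule GL_law_prob)
  note quad = covariance_quadratic_form[OF d N H i2 i1, folded \<nu>_def m_def]
  have X [measurable]: "random_variable borel (X (Suc i))" for i
    using ind by (simp add: indep_vars_def2)
  define w where "w g = \<xi> \<bullet> (IA d g - m)" for g
  have w [measurable]: "w \<in> borel_measurable borel" unfolding w_def by measurable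
  have indX: "indep_vars (\<lambda>_. borel) (\<lambda>i. X (Suc i)) UNIV"
    by (rule indep_vars_reindex[OF ind]) auto
  have ex: "expectation (\<lambda>\<omega>. f (X (Suc i) \<omega>)) = (\<integral>g. f g \<partial>N)"
    if [measurable]: "f \<in> borel_measurable borel" for f :: "'n fmat \<Rightarrow> 'c::{banach,second_countable_topology}" and i
    using law[of "Suc i"] integral_distr[of "X (Suc i)" M borel f] by simp
  \<comment> \<open>The limit theorem is applied to the centered projections of
    \<open>IA d (X i)\<close>, which are genuinely independent, and not to the steps of
    \<open>IA d\<close> along the product.\<close>
  have lim: "(\<lambda>n. \<integral>\<omega>. cis ((\<Sum>i<n. w (X (Suc i) \<omega>)) / sqrt (real n)) \<partial>M) \<longlonglongrightarrow> complex_of_real (exp (- v / 2))"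
  proof (rule central_limit_char)
    show "indep_vars (\<lambda>_. borel) (\<lambda>i \<omega>. w (X (Suc i) \<omega>)) UNIV"
      using indX by (rule indep_vars_compose2) measurable
    show "expectation (\<lambda>\<omega>. w (X (Suc n) \<omega>)) = 0" for n
      unfolding ex[OF w] unfolding w_def by (rule quad(3))
    show "integrable M (\<lambda>\<omega>. (w (X (Suc n) \<omega>))\<^sup>2)" for n
      using quad(1)[of \<xi>] law[of "Suc n"] integrable_distr_eq[of "X (Suc n)" M borel "\<lambda>g. (w g)\<^sup>2"]
      by (simp add: w_def)
    show "expectation (\<lambda>\<omega>. (w (X (Suc n) \<omega>))\<^sup>2) = v" for n
    proof -
      have "expectation (\<lambda>\<omega>. (w (X (Suc n) \<omega>))\<^sup>2) = (\<integral>g. (w g)\<^sup>2 \<partial>N)" by (rule ex) measurable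
      then show ?thesis unfolding w_def v_def quad(2) .
    qed
    show "distr M borel (\<lambda>\<omega>. w (X (Suc n) \<omega>)) = distr N borel w" for n
      using law[of "Suc n"] distr_distr[of w borel borel "X (Suc n)" M] by (simp add: o_def)
  qed
  \<comment> \<open>Both sides are the k-th power of the same one-step characteristic function, up
    to the phase produced by centering.\<close>
  have eq: "(\<integral>\<omega>. cis ((\<Sum>i<k. w (X (Suc i) \<omega>)) / sqrt (real k)) \<partial>M)
      = (\<integral>g. cis (\<xi> \<bullet> ((1 / sqrt (real k)) *\<^sub>R (IA d g - real k *\<^sub>R m))) \<partial>S k)" if k: "1 \<le> k" for k
  proof -
    let ?s = "1 / sqrt (real k)"
    let ?\<phi> = "\<integral>g. cis ((?s *\<^sub>R \<xi>) \<bullet> IA d g) \<partial>N"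
    have cis_sum: "cis (\<Sum>i\<in>A. f i) = (\<Prod>i\<in>A. cis (f i))" if "finite A" for A :: "nat set" and f
      using that by (induction A) (simp_all add: cis_mult[symmetric])
    have "(\<integral>\<omega>. cis ((\<Sum>i<k. w (X (Suc i) \<omega>)) / sqrt (real k)) \<partial>M)
        = (\<integral>\<omega>. (\<Prod>i<k. cis (?s * w (X (Suc i) \<omega>))) \<partial>M)"
      by (simp add: cis_sum[symmetric] sum_divide_distrib)
    also have "\<dots> = (\<Prod>i<k. \<integral>\<omega>. cis (?s * w (X (Suc i) \<omega>)) \<partial>M)"
    proof (rule indep_vars_lebesgue_integral)
      show "indep_vars (\<lambda>_. borel) (\<lambda>i \<omega>. cis (?s * w (X (Suc i) \<omega>))) {..<k}"
        by (rule indep_vars_compose2[OF indep_vars_subset[OF indX]]) auto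
      show "integrable M (\<lambda>\<omega>. cis (?s * w (X (Suc i) \<omega>)))" for i
        by (intro integrable_cis) measurable
    qed simp
    also have "\<dots> = (\<integral>g. cis (?s * w g) \<partial>N) ^ k"
      by (subst ex) simp_all
    also have "(\<integral>g. cis (?s * w g) \<partial>N) = (\<integral>g. cis (- (?s * (\<xi> \<bullet> m))) * cis ((?s *\<^sub>R \<xi>) \<bullet> IA d g) \<partial>N)"
      by (intro Bochner_Integration.integral_cong) (simp_all add: cis_mult w_def inner_diff_right algebra_simps)
    also have "\<dots> = cis (- (?s * (\<xi> \<bullet> m))) * ?\<phi>" by simp
    also have "\<dots> ^ k = cis (- (?s * (\<xi> \<bullet> m))) ^ k * ?\<phi> ^ k" by (rule power_mult_distrib)
    also have "cis (- (?s * (\<xi> \<bullet> m))) ^ k = cis (- (?s * real k * (\<xi> \<bullet> m)))"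
      unfolding Complex.DeMoivre by (rule arg_cong[of _ _ cis]) simp
    also have "?\<phi> ^ k = (\<integral>g. cis ((?s *\<^sub>R \<xi>) \<bullet> IA d g) \<partial>S k)"
      using law_fprod[OF ind law N k] unfolding S_def by metis
    also have "cis (- (?s * real k * (\<xi> \<bullet> m))) * \<dots>
        = (\<integral>g. cis (- (?s * real k * (\<xi> \<bullet> m))) * cis ((?s *\<^sub>R \<xi>) \<bullet> IA d g) \<partial>S k)"
      by simp
    also have "\<dots> = (\<integral>g. cis (\<xi> \<bullet> (?s *\<^sub>R (IA d g - real k *\<^sub>R m))) \<partial>S k)"
      by (intro Bochner_Integration.integral_cong) (simp_all add: cis_mult inner_diff_right algebra_simps)
    finally show ?thesis .
  qed
  show ?thesis
    unfolding v_def[symmetric] m_def[symmetric]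
    by (rule Lim_transform_eventually[OF lim eventually_sequentiallyI[of 1]]) (rule eq)
qed

theorem theorem2p5:
  fixes d :: nat
    and \<nu>G :: "('n::{finite,linorder}) fmat measure"
    and M :: "'a measure"
    and X :: "nat \<Rightarrow> 'a \<Rightarrow> 'n fmat"
  assumes d: "d \<in> {1, 2, 4}"
    and q: "CARD('n) \<ge> 2"
    and nuG_prob: "prob_space \<nu>G"
    and nuG_sets: "sets \<nu>G = sets borel"
    and nuG_G: "emeasure \<nu>G (GLF d) = 1"
    and nuG_biinv: "\<forall>u\<in>UF d. \<forall>v\<in>UF d. distr \<nu>G borel (\<lambda>g. fmul u (fmul g v)) = \<nu>G"
    and M_prob: "prob_space M"
    and indep: "prob_space.indep_vars M (\<lambda>_. borel) X {1..}"
    and law: "\<forall>k\<ge>1. distr M borel (X k) = \<nu>G"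
    and moments: "\<forall>j. integrable (distr \<nu>G borel (ln_sing d)) (\<lambda>t. (t $ j)\<^sup>2)"
  shows "\<exists>\<mu>. is_normal_cov (Sigma2 d (distr \<nu>G borel (ln_sing d))) \<mu> \<and>
           weak_conv_vec
             (\<lambda>k. distr M borel (\<lambda>\<omega>. (1 / sqrt (real k)) *\<^sub>R
                 (ln_sing d (fprod (\<lambda>i. X i \<omega>) k) - real k *\<^sub>R m1_nu d (distr \<nu>G borel (ln_sing d)))))
             \<mu>"
proof -
  interpret prob_space M by (rule M_prob)
  define \<nu> where "\<nu> = distr \<nu>G borel (ln_sing d)"
  define m where "m = m1_nu d \<nu>"
  have N: "GL_law d \<nu>G" using nuG_prob nuG_sets nuG_G by (simp add: GL_law_def)
  interpret N: prob_space \<nu>G by (rule nuG_prob)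
  have inv: "distr \<nu>G borel (fmul v) = \<nu>G" if "v \<in> UF d" for v
    using bspec[OF bspec[OF nuG_biinv that] UF_fid] by simp
  have N_right: "right_invariant d \<nu>G"
    using bspec[OF nuG_biinv UF_fid] by (simp add: right_invariant_def)
  define H where "H = distr \<nu>G borel (QU d)"
  have H: "is_haar d H" unfolding H_def by (rule is_haar_QU_distr[OF N inv])
  have law': "\<And>k. 1 \<le> k \<Longrightarrow> distr M borel (X k) = \<nu>G" using law by blast
  have i2: "\<forall>j l. integrable \<nu>G (\<lambda>g. IA d g $ j * IA d g $ l)" and i1: "\<forall>j. integrable \<nu>G (\<lambda>g. IA d g $ j)"
    using IA_square_integrable[OF N] moments by blast+
  note quad = covariance_quadratic_form[OF d N N_right H i2 i1, folded \<nu>_def]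
  have "0 \<le> (\<Sum>j\<in>UNIV. \<Sum>l\<in>UNIV. \<xi>$j * Sigma2 d \<nu> $j$l * \<xi>$l)" for \<xi> :: "(real,'n) vec"
    unfolding quad(2)[symmetric] by (rule Bochner_Integration.integral_nonneg) simp
  then obtain \<mu> where \<mu>: "is_normal_cov (Sigma2 d \<nu>) \<mu>"
    using is_normal_cov_exists[OF quad(4)] by blast
  define S where "S k = distr M borel (\<lambda>\<omega>. fprod (\<lambda>i. X i \<omega>) k)" for k
  have X: "random_variable borel (X i)" if "1 \<le> i" for i
    using indep that by (simp add: indep_vars_def2)
  have Sm [measurable]: "random_variable borel (\<lambda>\<omega>. fprod (\<lambda>i. X i \<omega>) k)" for k
    by (rule measurable_fprod) (rule X)
  have SL: "GL_law d (S k)" "right_invariant d (S k)" if "1 \<le> k" for k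
    using law_fprod[OF indep law' N N_right that] by (simp_all add: S_def)
  let ?T = "\<lambda>k \<omega>. (1 / sqrt (real k)) *\<^sub>R (ln_sing d (fprod (\<lambda>i. X i \<omega>) k) - real k *\<^sub>R m)"
  let ?a = "\<lambda>\<xi> k. \<integral>g. cis (\<xi> \<bullet> ((1 / sqrt (real k)) *\<^sub>R (ln_sing d g - real k *\<^sub>R m))) \<partial>S k"
  let ?b = "\<lambda>\<xi> k. \<integral>g. cis (\<xi> \<bullet> ((1 / sqrt (real k)) *\<^sub>R (IA d g - real k *\<^sub>R m))) \<partial>S k"
  have Tm [measurable]: "random_variable borel (?T k)" for k by measurable
  have charT: "(\<integral>x. cis (\<xi> \<bullet> x) \<partial>distr M borel (?T k)) = ?a \<xi> k" for \<xi> k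
    unfolding S_def by (simp add: integral_distr)
  have lim_b: "?b \<xi> \<longlonglongrightarrow> (\<integral>x. cis (\<xi> \<bullet> x) \<partial>\<mu>)" for \<xi>
    using char_IA_fprod_tendsto[OF d N N_right H indep law' i2 i1, of \<xi>] \<mu>
    by (simp add: is_normal_cov_def m_def \<nu>_def S_def)
  have diff: "(\<lambda>k. ?a \<xi> k - ?b \<xi> k) \<longlonglongrightarrow> 0" for \<xi>
  proof (rule LIMSEQ_I)
    fix r :: real assume r: "r > 0"
    \<comment> \<open>The threshold c is fixed before k: the tail enters with factor 2 and costs
      less than \<open>r / 2\<close> uniformly in k, while the other term decays like
      \<open>1 / sqrt k\<close> and is eventually below \<open>r / 4\<close>.\<close>
    then have "\<forall>\<^sub>F n in sequentially. measure H (Dev d (real n)) < r / 4"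
      using order_tendstoD(2)[OF Dev_tendsto_0[OF H], of "r / 4"] by simp
    then obtain c where c: "measure H (Dev d (real c)) < r / 4"
      by (meson eventually_sequentially order_refl)
    have "(\<lambda>k. norm \<xi> * (1 / sqrt (real k)) * real c) \<longlonglongrightarrow> norm \<xi> * 0 * real c"
      by (intro tendsto_intros tendsto_divide_0[OF tendsto_const] filterlim_at_top_imp_at_infinity
          filterlim_compose[OF sqrt_at_top filterlim_real_sequentially])
    then have "\<forall>\<^sub>F k in sequentially. norm \<xi> * (1 / sqrt (real k)) * real c < r / 4"
      using r by (intro order_tendstoD(2)) auto
    then have "\<forall>\<^sub>F k in sequentially. norm (?a \<xi> k - ?b \<xi> k) < r"
      using eventually_ge_at_top[of 1]
    proof eventually_elim
      case (elim k)
      have "norm (?a \<xi> k - ?b \<xi> k) \<le> norm \<xi> * (1 / sqrt (real k)) * real c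
          + 2 * measure (S k) {g. real c < norm (IA d g - ln_sing d g)}"
        by (rule char_diff_le[OF SL(1)[OF elim(2)]]) simp_all
      moreover have "measure (S k) {g. real c < norm (IA d g - ln_sing d g)} \<le> measure H (Dev d (real c))"
        by (rule deviation_prob_le[OF SL[OF elim(2)] H])
      ultimately show ?case using c elim(1) r by linarith
    qed
    then show "\<exists>no. \<forall>n\<ge>no. norm (?a \<xi> n - ?b \<xi> n - 0) < r"
      by (simp add: eventually_sequentially)
  qed
  have lim_a: "?a \<xi> \<longlonglongrightarrow> (\<integral>x. cis (\<xi> \<bullet> x) \<partial>\<mu>)" for \<xi>
    using tendsto_add[OF diff[of \<xi>] lim_b[of \<xi>]] by simp
  have "weak_conv_vec (\<lambda>k. distr M borel (?T k)) \<mu>"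
    unfolding weak_conv_vec_def
  proof (intro allI impI)
    fix f :: "(real,'n) vec \<Rightarrow> real" assume f: "continuous_on UNIV f \<and> bounded (range f)"
    then obtain B where B: "\<And>x. \<bar>f x\<bar> \<le> B" by (auto simp: bounded_iff)
    show "(\<lambda>k. \<integral>x. f x \<partial>distr M borel (?T k)) \<longlonglongrightarrow> (\<integral>x. f x \<partial>\<mu>)"
    proof (rule levy_continuity_euclidean[where M = B])
      show "(\<lambda>k. \<integral>x. cis (\<xi> \<bullet> x) \<partial>distr M borel (?T k)) \<longlonglongrightarrow> (\<integral>x. cis (\<xi> \<bullet> x) \<partial>\<mu>)" for \<xi>
        unfolding charT by (rule lim_a)
    qed (use \<mu> f B in \<open>auto simp: is_normal_cov_def intro: prob_space_distr\<close>)
  qed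
  with \<mu> show ?thesis unfolding m_def \<nu>_def by blast
qed

end
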